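(* Let $(\Xi^n)_{n\ge 0}$ be generated by an edge iterated graph system satisfying the standing assumptions (canonical, distance-positive, degree-primitive, single-edge initial graph). Then all vertices of $\Xi$ share the same walk dimension: for every $v\in V(\Xi)$ and every sequence $(r_n)$ admissible for $v$, the limit $$\dim_{\mathrm W}(\Xi:v)=\lim_{n\to\infty}\frac{\log \mathbb E^v\big[\tau^{\Xi^n}_{B_{\Xi^n}(v,r_n)^{\mathrm c}}\big]}{\log r_n}$$ exists, and its value $\dim_{\mathrm W}(\Xi)$ depends neither on $v$ nor on the admissible sequence. Moreover the Einstein relation holds: $$\dim_{\mathrm W}(\Xi)=\dim_{\mathrm B}(\Xi)+\dim_{\mathrm R}(\Xi).$$
   Context: **EIGS.** Fix $K\ge1$ colours $[K]=\{1,\dots,K\}$. An edge iterated graph system (EIGS) consists of finite directed rule graphs $R_1,\dots,R_K$ whose edges are coloured by a map $\mathscr C$ with values in $[K]$, each $R_i$ having two distinct planting vertices $\beta_i^+\ne\beta_i^-$, and an initial graph $\Xi^0$, which is a single directed edge of some colour $\iota$ with endpoints $\mathfrak v_+,\mathfrak v_-$. Given $\Xi^n$, the graph $\Xi^{n+1}$ is obtained by simultaneously replacing every directed edge $e=(a,b)$ of colour $i$ by a fresh copy of $R_i$, identifying $a\equiv\beta_i^+$, $b\equiv\beta_i^-$, with no other identifications. Thus $V(\Xi^n)\subset V(\Xi^{n+1})$, and $V(\Xi):=\bigcup_nV(\Xi^n)$. The birth level of $v$ is the least $k$ with $v\in V(\Xi^k)$. $\Xi_j^n$ denotes the graph obtained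 when the initial edge has colour $j$. Distances $d_G$, degrees, paths, balls $B_G(v,r)=\{u:d_G(v,u)<r\}$, random walks and resistances refer to underlying undirected graphs, which are assumed simple and connected. **Matrices.** $\mathbf M\in\mathbb N^{K\times K}$: $[\mathbf M]_{ij}$ is the number of $j$-coloured edges of $R_i$. $\mathbf N\in\mathbb N^{2K\times2K}$ has rows $\kappa_{R_1}(\beta_1^+),\kappa_{R_1}(\beta_1^-),\dots,\kappa_{R_K}(\beta_K^+),\kappa_{R_K}(\beta_K^-)$, where $[\kappa_G(v)]_{2j-1}$ (resp. $[\kappa_G(v)]_{2j}$) is the number of $j$-coloured edges of $G$ leaving (resp. entering) $v$. $\mathcal D$ is the finite set of $K\times K$ matrices obtained by choosing, for each $i$, a simple path in $R_i$ between $\beta_i^+$ and $\beta_i^-$ and letting the $(i,j)$ entry be the number of $j$-coloured edges on the chosen path. $\rho(\cdot)$ is the spectral radius and $\rho_{\min}(\mathcal D)=\min_{D\in\mathcal D}\rho(D)$. **Resistance map.** For $\mathbf x\in(0,\infty)^K$, $[\Psi(\mathbf x)]_i$ is the effective resistance between $\beta_i^+$ and $\beta_i^-$ in $R_i$ when each $j$-coloured edge has resistance $[\mathbf x]_j$. There is a unique $\rho(\Psi)>0$ for which $\Psi(\mathbf v)=\rho(\Psi)\mathbf v$ has a solution $\mathbf v\in(0,\infty)^K$. **Standing assumptions.** (1) Canonical: every edge of every $R_i$ lies on a simple path joining $\beta_i^+$ and $\beta_i^-$. (2) Distance-positive: all matrices in $\mathcal D$ have positive entries; if $K=1$, additionally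 $d_{R_1}(\beta_1^+,\beta_1^-)\ge2$. (3) $\mathbf N$ is primitive. (4) $\Xi^0$ is a single edge. **Dimensions.** $\dim_{\mathrm B}(\Xi)=\frac{\log\rho(\mathbf M)}{\log\rho_{\min}(\mathcal D)}$. The resistance dimension is $\dim_{\mathrm R}(\Xi)=\lim_n\frac{\log\mathscr R_{\Xi^n}(u,w)}{\log d_{\Xi^n}(u,w)}$ for distinct $u,w\in V(\Xi^0)$, with $\mathscr R_{\Xi^n}$ the unit-resistance effective resistance; it equals $\frac{\log\rho(\Psi)}{\log\rho_{\min}(\mathcal D)}$. **Constants and admissibility.** Constants $c_{\mathrm d},C_{\mathrm d}>0$ are fixed with $c_{\mathrm d}\rho_{\min}(\mathcal D)^m\le d_{\Xi_j^m}(\mathfrak v_+,\mathfrak v_-)\le\mathrm{diam}(\Xi_j^m)\le C_{\mathrm d}\rho_{\min}(\mathcal D)^m$ for all $j\in[K]$, $m\in\mathbb N$, and an integer $c_0$ is fixed so large that $C_{\mathrm d}\rho_{\min}(\mathcal D)^{-c_0}\le\frac{c_{\mathrm d}}{4\rho_{\min}(\mathcal D)}$ and $c_{\mathrm d}\rho_{\min}(\mathcal D)^{c_0}\ge4C_{\mathrm d}$. For $v$ of birth level $k$, a sequence $(r_n)_{n\ge k}$ is admissible for $v$ if $r_n\to\infty$ and there are integers $m_n$ such that, for all large $n$, $c_0\le m_n\le n-k-c_0$ and $c_{\mathrm d}\rho_{\min}(\mathcal D)^{m_n}\le r_n\le C_{\mathrm d}\rho_{\min}(\mathcal D)^{m_n}$.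 **Walk.** $(X_j^{\Xi^n})_{j\ge0}$ is discrete-time simple random walk on $\Xi^n$, and $\tau^{\Xi^n}_{A^{\mathrm c}}=\inf\{j\ge0:X_j^{\Xi^n}\notin A\}$; $\mathbb E^v$ is expectation for the walk started at $v$. *)

theory Defs
  imports
    "HOL-Probability.Probability"
    "Graph_Theory.Graph_Theory"
    "Jordan_Normal_Form.Spectral_Radius"
begin

section \<open>Finite graphs through their underlying undirected graph\<close>

text \<open>
  A directed graph is a \<^typ>\<open>('a, 'b) pre_digraph\<close>; its underlying undirected graph is the
  symmetric digraph \<^term>\<open>mk_symmetric G\<close>, in which every edge is present in both orientations.
\<close>

definition simple_underlying :: "('a, 'b) pre_digraph \<Rightarrow> bool" where
  "simple_underlying G \<longleftrightarrow>
     loopfree_digraph G \<and> inj_on (\<lambda>e. {tail G e, head G e}) (arcs G)"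

definition und_walk :: "('a, 'b) pre_digraph \<Rightarrow> 'a \<Rightarrow> ('a \<times> 'a) list \<Rightarrow> 'a \<Rightarrow> bool" where
  "und_walk G u p v \<longleftrightarrow> pre_digraph.awalk (with_proj (mk_symmetric G)) u p v"

definition und_path :: "('a, 'b) pre_digraph \<Rightarrow> 'a \<Rightarrow> ('a \<times> 'a) list \<Rightarrow> 'a \<Rightarrow> bool" where
  "und_path G u p v \<longleftrightarrow> pre_digraph.apath (with_proj (mk_symmetric G)) u p v"

definition on_path :: "('a, 'b) pre_digraph \<Rightarrow> ('a \<times> 'a) list \<Rightarrow> 'b \<Rightarrow> bool" where
  "on_path G p e \<longleftrightarrow> (tail G e, head G e) \<in> set p \<or> (head G e, tail G e) \<in> set p"

definition nbrs :: "('a, 'b) pre_digraph \<Rightarrow> 'a \<Rightarrow> 'a set" where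
  "nbrs G v = {u. v \<rightarrow>\<^bsub>with_proj (mk_symmetric G)\<^esub> u}"

definition gdist :: "('a, 'b) pre_digraph \<Rightarrow> 'a \<Rightarrow> 'a \<Rightarrow> nat" where
  "gdist G u v = (LEAST l. \<exists>p. und_walk G u p v \<and> length p = l)"

definition gdiam :: "('a, 'b) pre_digraph \<Rightarrow> nat" where
  "gdiam G = Max {gdist G u v | u v. u \<in> verts G \<and> v \<in> verts G}"

definition gball :: "('a, 'b) pre_digraph \<Rightarrow> 'a \<Rightarrow> real \<Rightarrow> 'a set" where
  "gball G v r = {u \<in> verts G. real (gdist G u v) < r}"

text \<open>
  Effective resistance with unit resistors: the potential difference between \<open>u\<close> and \<open>w\<close> for
  a potential \<open>h\<close> whose current (Ohm's law) satisfies Kirchhoff's node law with one unit of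
  current entering at \<open>u\<close> and leaving at \<open>w\<close>.  For a finite simple connected graph, \<open>h\<close> is unique
  up to an additive constant.
\<close>

definition eff_resistance :: "('a, 'b) pre_digraph \<Rightarrow> 'a \<Rightarrow> 'a \<Rightarrow> real" where
  "eff_resistance G u w = (THE R. \<exists>h :: 'a \<Rightarrow> real.
     (\<forall>x\<in>verts G. (\<Sum>y\<in>nbrs G x. h x - h y) = of_bool (x = u) - of_bool (x = w)) \<and>
     R = h u - h w)"


section \<open>Simple random walk\<close>

text \<open>
  The law of the walk started at \<open>v\<close> is the measure on trajectories \<^typ>\<open>nat \<Rightarrow> 'a\<close> that the
  Ionescu-Tulcea theorem produces from the transition kernels below.
\<close>

definition srw_kernel :: "('a, 'b) pre_digraph \<Rightarrow> 'a \<Rightarrow> nat \<Rightarrow> (nat \<Rightarrow> 'a) \<Rightarrow> 'a measure" where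
  "srw_kernel G v t X = (case t of
       0 \<Rightarrow> measure_pmf (return_pmf v)
     | Suc s \<Rightarrow> measure_pmf (pmf_of_set (nbrs G (X s))))"

lemma Ionescu_Tulcea_srw: "Ionescu_Tulcea (srw_kernel G v) (\<lambda>_. count_space UNIV)"
proof (rule Ionescu_Tulcea.intro)
  fix t :: nat
  have pmf: "measure_pmf q \<in> space (subprob_algebra (count_space UNIV))" for q :: "'a pmf"
    by (simp add: space_subprob_algebra prob_space_imp_subprob_space
        measure_pmf.prob_space_axioms)
  show "srw_kernel G v t \<in> PiM {0..<t} (\<lambda>_. count_space UNIV)
      \<rightarrow>\<^sub>M subprob_algebra (count_space UNIV)"
  proof (cases t)
    case 0
    have "srw_kernel G v t = (\<lambda>_. measure_pmf (return_pmf v))"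
      by (simp add: 0 srw_kernel_def fun_eq_iff)
    then show ?thesis
      using pmf by simp
  next
    case (Suc s)
    have eq: "srw_kernel G v t = (\<lambda>X. measure_pmf (pmf_of_set (nbrs G (X s))))"
      by (simp add: Suc srw_kernel_def fun_eq_iff)
    have step: "(\<lambda>x. measure_pmf (pmf_of_set (nbrs G x)))
        \<in> count_space UNIV \<rightarrow>\<^sub>M subprob_algebra (count_space UNIV)"
      using pmf by simp
    have "(\<lambda>X. X s) \<in> PiM {0..<t} (\<lambda>_. count_space UNIV) \<rightarrow>\<^sub>M count_space UNIV"
      using Suc by (intro measurable_component_singleton) simp
    from measurable_compose[OF this step] show ?thesis
      unfolding eq .
  qed
next
  fix t :: nat and X :: "nat \<Rightarrow> 'a"
  show "prob_space (srw_kernel G v t X)"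
    by (simp add: srw_kernel_def measure_pmf.prob_space_axioms split: nat.split)
qed

definition srw :: "('a, 'b) pre_digraph \<Rightarrow> 'a \<Rightarrow> (nat \<Rightarrow> 'a) measure" where
  "srw G v = projective_family.lim UNIV
     (Ionescu_Tulcea.CI (srw_kernel G v) (\<lambda>_. count_space UNIV)) (\<lambda>_. count_space UNIV)"

definition exit_time :: "'a set \<Rightarrow> (nat \<Rightarrow> 'a) \<Rightarrow> ennreal" where
  "exit_time A X = Inf (of_nat ` {t. X t \<notin> A})"

definition expected_exit_time :: "('a, 'b) pre_digraph \<Rightarrow> 'a \<Rightarrow> 'a set \<Rightarrow> ennreal" where
  "expected_exit_time G v A = (\<integral>\<^sup>+ X. exit_time A X \<partial>srw G v)"


section \<open>Edge iterated graph systems\<close>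

text \<open>
  Colours are \<open>0, \<dots>, K - 1\<close> rather than \<open>1, \<dots>, K\<close>, in accordance with matrix indices.
  The edge colouring is given separately on each rule graph.
\<close>

record ('a, 'b) eigs =
  num_colours :: nat
  rule_graph :: "nat \<Rightarrow> ('a, 'b) pre_digraph"
  edge_colour :: "nat \<Rightarrow> 'b \<Rightarrow> nat"
  plant_plus :: "nat \<Rightarrow> 'a"
  plant_minus :: "nat \<Rightarrow> 'a"
  initial_colour :: nat

definition eigs :: "('a, 'b) eigs \<Rightarrow> bool" where
  "eigs S \<longleftrightarrow> num_colours S \<ge> 1 \<and> initial_colour S < num_colours S \<and>
     (\<forall>i < num_colours S.
        fin_digraph (rule_graph S i) \<and>
        simple_underlying (rule_graph S i) \<and>
        Digraph_Component.connected (rule_graph S i) \<and>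
        (\<forall>e \<in> arcs (rule_graph S i). edge_colour S i e < num_colours S) \<and>
        plant_plus S i \<in> verts (rule_graph S i) \<and>
        plant_minus S i \<in> verts (rule_graph S i) \<and>
        plant_plus S i \<noteq> plant_minus S i)"

text \<open>
  An edge of the \<open>n\<close>-th iterate is addressed by a list of \<open>n\<close> rule-graph edges, most recent first:
  \<open>f # e\<close> is the edge \<open>f\<close> of the copy that replaces the edge \<open>e\<close> of the previous iterate.
  \<open>Born e x\<close> is the copy of the non-planting vertex \<open>x\<close> in the graph replacing \<open>e\<close>; the planting
  vertices of that copy are identified with the endpoints of \<open>e\<close>.  With this naming, the vertex
  sets of successive iterates are literally nested.
\<close>

datatype ('a, 'b) xvertex = Init_plus | Init_minus | Born "'b list" 'a

primrec xcolour :: "('a, 'b) eigs \<Rightarrow> nat \<Rightarrow> 'b list \<Rightarrow> nat" where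
  "xcolour S j [] = j"
| "xcolour S j (f # e) = edge_colour S (xcolour S j e) f"

definition planted :: "('a, 'b) eigs \<Rightarrow> nat \<Rightarrow> (('a, 'b) xvertex, 'b list) pre_digraph \<Rightarrow>
    'b list \<Rightarrow> 'a \<Rightarrow> ('a, 'b) xvertex" where
  "planted S j G e x =
     (if x = plant_plus S (xcolour S j e) then tail G e
      else if x = plant_minus S (xcolour S j e) then head G e
      else Born e x)"

definition substitute :: "('a, 'b) eigs \<Rightarrow> nat \<Rightarrow> (('a, 'b) xvertex, 'b list) pre_digraph \<Rightarrow>
    (('a, 'b) xvertex, 'b list) pre_digraph" where
  "substitute S j G =
     \<lparr> verts = verts G \<union>
         {planted S j G e x | e x. e \<in> arcs G \<and> x \<in> verts (rule_graph S (xcolour S j e))},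
       arcs = {f # e | f e. e \<in> arcs G \<and> f \<in> arcs (rule_graph S (xcolour S j e))},
       tail = (\<lambda>a. planted S j G (tl a) (tail (rule_graph S (xcolour S j (tl a))) (hd a))),
       head = (\<lambda>a. planted S j G (tl a) (head (rule_graph S (xcolour S j (tl a))) (hd a))) \<rparr>"

primrec Xi_from :: "('a, 'b) eigs \<Rightarrow> nat \<Rightarrow> nat \<Rightarrow> (('a, 'b) xvertex, 'b list) pre_digraph" where
  "Xi_from S j 0 =
     \<lparr> verts = {Init_plus, Init_minus}, arcs = {[]},
       tail = (\<lambda>_. Init_plus), head = (\<lambda>_. Init_minus) \<rparr>"
| "Xi_from S j (Suc n) = substitute S j (Xi_from S j n)"

abbreviation Xi :: "('a, 'b) eigs \<Rightarrow> nat \<Rightarrow> (('a, 'b) xvertex, 'b list) pre_digraph" where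
  "Xi S \<equiv> Xi_from S (initial_colour S)"

definition limit_verts :: "('a, 'b) eigs \<Rightarrow> ('a, 'b) xvertex set" where
  "limit_verts S = (\<Union>n. verts (Xi S n))"

definition birth_level :: "('a, 'b) eigs \<Rightarrow> ('a, 'b) xvertex \<Rightarrow> nat" where
  "birth_level S v = (LEAST k. v \<in> verts (Xi S k))"


section \<open>Matrices\<close>

definition nat_spectral_radius :: "nat mat \<Rightarrow> real" where
  "nat_spectral_radius A = spectral_radius (map_mat of_nat A :: complex mat)"

definition mass_matrix :: "('a, 'b) eigs \<Rightarrow> nat mat" where
  "mass_matrix S = Matrix.mat (num_colours S) (num_colours S)
     (\<lambda>(i, j). card {e \<in> arcs (rule_graph S i). edge_colour S i e = j})"

text \<open>Position \<open>2 j\<close> counts outgoing and position \<open>2 j + 1\<close> counts incoming edges of colour \<open>j\<close>.\<close>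

definition kappa :: "('a, 'b) pre_digraph \<Rightarrow> ('b \<Rightarrow> nat) \<Rightarrow> 'a \<Rightarrow> nat \<Rightarrow> nat" where
  "kappa G cl v c =
     card {e \<in> (if even c then out_arcs G v else in_arcs G v). cl e = c div 2}"

definition degree_matrix :: "('a, 'b) eigs \<Rightarrow> nat mat" where
  "degree_matrix S = Matrix.mat (2 * num_colours S) (2 * num_colours S)
     (\<lambda>(r, c). kappa (rule_graph S (r div 2)) (edge_colour S (r div 2))
        (if even r then plant_plus S (r div 2) else plant_minus S (r div 2)) c)"

definition positive_mat :: "nat mat \<Rightarrow> bool" where
  "positive_mat A \<longleftrightarrow> (\<forall>i < dim_row A. \<forall>j < dim_col A. A $$ (i, j) > 0)"

definition primitive_mat :: "nat mat \<Rightarrow> bool" where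
  "primitive_mat A \<longleftrightarrow> (\<exists>m \<ge> 1. positive_mat (A ^\<^sub>m m))"

definition path_matrices :: "('a, 'b) eigs \<Rightarrow> nat mat set" where
  "path_matrices S =
     {Matrix.mat (num_colours S) (num_colours S)
        (\<lambda>(i, j). card {e \<in> arcs (rule_graph S i).
                          edge_colour S i e = j \<and> on_path (rule_graph S i) (p i) e}) | p.
      \<forall>i < num_colours S. und_path (rule_graph S i) (plant_plus S i) (p i) (plant_minus S i)}"

definition rho_min :: "('a, 'b) eigs \<Rightarrow> real" where
  "rho_min S = Min (nat_spectral_radius ` path_matrices S)"


section \<open>Standing assumptions\<close>

definition canonical :: "('a, 'b) eigs \<Rightarrow> bool" where
  "canonical S \<longleftrightarrow> (\<forall>i < num_colours S. \<forall>e \<in> arcs (rule_graph S i).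
     \<exists>p. und_path (rule_graph S i) (plant_plus S i) p (plant_minus S i) \<and>
         on_path (rule_graph S i) p e)"

definition distance_positive :: "('a, 'b) eigs \<Rightarrow> bool" where
  "distance_positive S \<longleftrightarrow> (\<forall>A \<in> path_matrices S. positive_mat A) \<and>
     (num_colours S = 1 \<longrightarrow> gdist (rule_graph S 0) (plant_plus S 0) (plant_minus S 0) \<ge> 2)"

definition degree_primitive :: "('a, 'b) eigs \<Rightarrow> bool" where
  "degree_primitive S \<longleftrightarrow> primitive_mat (degree_matrix S)"


section \<open>Dimensions and admissible radii\<close>

definition box_dim :: "('a, 'b) eigs \<Rightarrow> real" where
  "box_dim S = ln (nat_spectral_radius (mass_matrix S)) / ln (rho_min S)"

text \<open>
  The two vertices of the initial edge are the only distinct pair, and both the resistance and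
  the distance are symmetric.
\<close>

definition resistance_dim :: "('a, 'b) eigs \<Rightarrow> real" where
  "resistance_dim S = lim (\<lambda>n. ln (eff_resistance (Xi S n) Init_plus Init_minus) /
                                ln (real (gdist (Xi S n) Init_plus Init_minus)))"

definition scale_constants :: "('a, 'b) eigs \<Rightarrow> real \<Rightarrow> real \<Rightarrow> int \<Rightarrow> bool" where
  "scale_constants S cd Cd c0 \<longleftrightarrow> cd > 0 \<and> Cd > 0 \<and>
     (\<forall>j < num_colours S. \<forall>m.
        cd * rho_min S ^ m \<le> real (gdist (Xi_from S j m) Init_plus Init_minus) \<and>
        gdist (Xi_from S j m) Init_plus Init_minus \<le> gdiam (Xi_from S j m) \<and>
        real (gdiam (Xi_from S j m)) \<le> Cd * rho_min S ^ m) \<and>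
     Cd * rho_min S powi (- c0) \<le> cd / (4 * rho_min S) \<and>
     cd * rho_min S powi c0 \<ge> 4 * Cd"

text \<open>Only the values \<open>r n\<close> with \<open>n\<close> at least the birth level of \<open>v\<close> matter.\<close>

definition admissible ::
    "('a, 'b) eigs \<Rightarrow> real \<Rightarrow> real \<Rightarrow> int \<Rightarrow> ('a, 'b) xvertex \<Rightarrow> (nat \<Rightarrow> real) \<Rightarrow> bool" where
  "admissible S cd Cd c0 v r \<longleftrightarrow> filterlim r at_top sequentially \<and>
     (\<exists>m :: nat \<Rightarrow> int. \<forall>\<^sub>F n in sequentially.
        c0 \<le> m n \<and> m n \<le> int n - int (birth_level S v) - c0 \<and>
        cd * rho_min S powi m n \<le> r n \<and> r n \<le> Cd * rho_min S powi m n)"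

end

theory Submission
  imports Defs "HOL-Real_Asymp.Real_Asymp"
begin


text \<open>
  An iterate \<open>\<Xi>\<^sup>n\<close> is, for every split \<open>n = q + p\<close>, the graph \<open>\<Xi>\<^sup>p\<close> with each edge replaced by an
  iterate of order \<open>q\<close>.  Gluing unit potentials of the copies onto a function on \<open>\<Xi>\<^sup>p\<close> turns its
  weighted energy on \<open>\<Xi>\<^sup>p\<close>, the weights being the conductances of the copies, into an energy on
  \<open>\<Xi>\<^sup>n\<close>.  Hence conductances are multiplicative in the order up to constants that do not depend on
  the colour, because every colour separates the planting vertices of every rule graph, and they have an
  exponential rate; the numbers of edges grow like the powers of the spectral radius of the mass matrix.

  The expected exit time \<open>f\<close> of a ball solves \<open>\<Delta> f = deg\<close> in the ball, so that testing with \<open>H\<close>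
  compares the energy of \<open>f\<close> and \<open>H\<close> with the degree-weighted mass of \<open>H\<close>.  For a ball of
  radius about \<open>\<rho>\<^sup>m\<close> around \<open>v\<close>, glued test functions supported in the copies of order about \<open>m\<close> at \<open>v\<close>
  give \<open>f(v) \<approx> E\<^sub>m / C\<^sub>m\<close>, where \<open>E\<^sub>m\<close> and \<open>C\<^sub>m\<close> are the number of edges and the conductance of an
  iterate of order \<open>m\<close>: the degree of \<open>v\<close> cancels, as it multiplies both the mass and the conductance.
\<close>

section \<open>Walks and distances\<close>

text \<open>The degree of a fixed vertex can grow with the level, so no estimate may lose a factor
  of it. Both exit-time bounds are therefore proved on a level where each side becomes a sum over
  the edges at \<open>v\<close>, and the common factor is divided out. The constant
  \<open>c0\<close> selects these levels. Copies of order \<open>m + c0\<close> have planting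
  vertices further apart than the radius, so on that level the exit time from the ball is supported
  at \<open>v\<close> alone. Copies of order \<open>m - c0\<close> at \<open>v\<close> and at its
  neighbours are so small that a test function living on them vanishes outside the ball. The bounded
  shift of the order disappears in the logarithmic limit. On one level the copies of different
  colours act as different weights, and these must be comparable. Positivity of the path matrices
  provides this: no colour can be avoided on the way between two planting vertices, so the edges of
  the colour with the smallest conductance form a cut in every rule graph and bound all conductances
  of the next order.\<close>

definition adj :: "('a, 'b) pre_digraph \<Rightarrow> ('a \<times> 'a) set" where
  "adj G = (\<Union>e\<in>arcs G. {(tail G e, head G e), (head G e, tail G e)})"

lemma adj_sym: "(x, y) \<in> adj G \<Longrightarrow> (y, x) \<in> adj G"
  by (auto simp: adj_def)

lemma adjE:
  assumes "(x, y) \<in> adj G"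
  obtains e where "e \<in> arcs G" "tail G e = x" "head G e = y"
    | e where "e \<in> arcs G" "tail G e = y" "head G e = x"
  using assms by (auto simp: adj_def)

lemma adj_arc: "e \<in> arcs G \<Longrightarrow> (tail G e, head G e) \<in> adj G"
  by (auto simp: adj_def)

lemma rtrancl_adj_sym: "(x, y) \<in> (adj G)\<^sup>* \<Longrightarrow> (y, x) \<in> (adj G)\<^sup>*"
  by (metis adj_sym symI sym_rtrancl symD)

lemma parcs_mk_symmetric_adj: "parcs (mk_symmetric G) = adj G"
  by (simp add: parcs_mk_symmetric adj_def)

lemma nbrs_adj: "nbrs G x = {y. (x, y) \<in> adj G}"
  unfolding nbrs_def by (simp add: parcs_mk_symmetric_adj)

lemma und_walk_iff:
  "und_walk G u p v \<longleftrightarrow> u \<in> verts G \<and> set p \<subseteq> adj G \<and> pre_digraph.cas (with_proj (mk_symmetric G)) u p v"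
  unfolding und_walk_def pre_digraph.awalk_def by (simp add: parcs_mk_symmetric_adj)

text \<open>Only the lengths of walks matter for distances; relation powers of \<open>adj\<close>
  can be composed, reversed and split without handling arc lists.\<close>

lemma cas_relpow:
  "(\<exists>p. set p \<subseteq> adj G \<and> pre_digraph.cas (with_proj (mk_symmetric G)) u p v \<and> length p = l)
     \<longleftrightarrow> (u, v) \<in> adj G ^^ l"
proof (induction l arbitrary: u)
  case 0
  then show ?case by (auto simp: pre_digraph.cas.simps)
next
  case (Suc l)
  show ?case
  proof
    assume "\<exists>p. set p \<subseteq> adj G \<and> pre_digraph.cas (with_proj (mk_symmetric G)) u p v \<and> length p = Suc l"
    then obtain a p where p: "set (a # p) \<subseteq> adj G"
        "pre_digraph.cas (with_proj (mk_symmetric G)) u (a # p) v" "length p = l"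
      by (metis length_Suc_conv)
    then have a: "fst a = u" "pre_digraph.cas (with_proj (mk_symmetric G)) (snd a) p v"
      by (auto simp: pre_digraph.cas.simps)
    have "a \<in> adj G" "set p \<subseteq> adj G"
      using p by auto
    then have "(snd a, v) \<in> adj G ^^ l" "(u, snd a) \<in> adj G"
      using Suc.IH[of "snd a"] p(3) a by auto
    then show "(u, v) \<in> adj G ^^ Suc l"
      by (meson relpow_Suc_I2)
  next
    assume "(u, v) \<in> adj G ^^ Suc l"
    then obtain w where w: "(u, w) \<in> adj G" "(w, v) \<in> adj G ^^ l"
      by (meson relpow_Suc_D2)
    then obtain p where "set p \<subseteq> adj G" "pre_digraph.cas (with_proj (mk_symmetric G)) w p v" "length p = l"
      using Suc.IH by blast
    then show "\<exists>p. set p \<subseteq> adj G \<and> pre_digraph.cas (with_proj (mk_symmetric G)) u p v \<and> length p = Suc l"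
      using w by (intro exI[of _ "(u, w) # p"]) (auto simp: pre_digraph.cas.simps)
  qed
qed

lemma gdist_relpow:
  assumes "u \<in> verts G"
  shows "gdist G u v = (LEAST l. (u, v) \<in> adj G ^^ l)"
  unfolding gdist_def und_walk_iff using assms cas_relpow[of G u v] by (metis (no_types, lifting))

lemma gdist_le:
  assumes "u \<in> verts G" "(u, v) \<in> adj G ^^ l"
  shows "gdist G u v \<le> l"
  using assms by (simp add: gdist_relpow Least_le)

lemma relpow_gdist:
  assumes "u \<in> verts G" "(u, v) \<in> (adj G)\<^sup>*"
  shows "(u, v) \<in> adj G ^^ gdist G u v"
  using assms by (metis LeastI_ex gdist_relpow rtrancl_imp_relpow)

lemma relpow_adj_sym: "(u, v) \<in> adj G ^^ l \<Longrightarrow> (v, u) \<in> adj G ^^ l"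
proof (induction l arbitrary: u)
  case (Suc l)
  then obtain w where "(u, w) \<in> adj G" "(w, v) \<in> adj G ^^ l"
    by (meson relpow_Suc_D2)
  then show ?case
    using Suc.IH adj_sym by (metis relpow_Suc_I)
qed auto

lemma gdist_sym:
  assumes "u \<in> verts G" "v \<in> verts G"
  shows "gdist G u v = gdist G v u"
proof -
  have "(u, v) \<in> adj G ^^ l \<longleftrightarrow> (v, u) \<in> adj G ^^ l" for l
    using relpow_adj_sym by metis
  then show ?thesis
    using assms by (simp add: gdist_relpow)
qed

lemma gdist_self: "u \<in> verts G \<Longrightarrow> gdist G u u = 0"
  using gdist_le[of u G u 0] by simp

text \<open>One estimate for three uses: \<open>s = 1\<close> for lower bounds on distances,
  \<open>s = 0\<close> for functions without energy, and the square root of the energy for bounding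
  exit times.\<close>

lemma lipschitz_relpow:
  fixes f :: "'a \<Rightarrow> real"
  assumes "\<And>e. e \<in> arcs G \<Longrightarrow> \<bar>f (tail G e) - f (head G e)\<bar> \<le> s" "(x, y) \<in> adj G ^^ l"
  shows "\<bar>f x - f y\<bar> \<le> real l * s"
  using assms(2)
proof (induction l arbitrary: x)
  case (Suc l)
  then obtain w where w: "(x, w) \<in> adj G" "(w, y) \<in> adj G ^^ l"
    by (meson relpow_Suc_D2)
  have "\<bar>f x - f w\<bar> \<le> s"
    using w(1) assms(1) by (auto simp: adj_def abs_minus_commute)
  then show ?case
    using Suc.IH[OF w(2)] by (auto simp: algebra_simps)
qed auto

definition connected_graph :: "('a, 'b) pre_digraph \<Rightarrow> bool" where
  "connected_graph G \<longleftrightarrow> (\<forall>x\<in>verts G. \<forall>y\<in>verts G. (x, y) \<in> (adj G)\<^sup>*)"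

lemma connected_graphD: "connected_graph G \<Longrightarrow> x \<in> verts G \<Longrightarrow> y \<in> verts G \<Longrightarrow> (x, y) \<in> (adj G)\<^sup>*"
  by (simp add: connected_graph_def)

lemma rtrancl_on_imp_rtrancl: "(a, b) \<in> rtrancl_on F r \<Longrightarrow> (a, b) \<in> r\<^sup>*"
  by (induction rule: rtrancl_on.induct) (auto intro: rtrancl.rtrancl_into_rtrancl)

lemma connected_imp_connected_graph:
  assumes "Digraph_Component.connected G"
  shows "connected_graph G"
  unfolding connected_graph_def
proof (intro ballI)
  fix x y assume "x \<in> verts G" "y \<in> verts G"
  then have "x \<rightarrow>\<^sup>*\<^bsub>with_proj (mk_symmetric G)\<^esub> y"
    using assms unfolding Digraph_Component.connected_def strongly_connected_def by simp
  then show "(x, y) \<in> (adj G)\<^sup>*"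
    unfolding reachable_def by (auto dest!: rtrancl_on_imp_rtrancl simp: parcs_mk_symmetric_adj)
qed

lemma gdist_lipschitz:
  assumes "wf_digraph G" "connected_graph G" "z \<in> verts G" "e \<in> arcs G"
  shows "\<bar>real (gdist G (tail G e) z) - real (gdist G (head G e) z)\<bar> \<le> 1"
proof -
  have v: "tail G e \<in> verts G" "head G e \<in> verts G"
    using assms by (auto simp: wf_digraph_def)
  have *: "gdist G x z \<le> Suc (gdist G y z)" if "(x, y) \<in> adj G" "x \<in> verts G" "y \<in> verts G" for x y
    using that assms connected_graphD by (intro gdist_le relpow_Suc_I2[OF that(1)] relpow_gdist) auto
  from *[of "tail G e" "head G e"] *[of "head G e" "tail G e"] v adj_arc[OF assms(4)] adj_sym
  show ?thesis by fastforce
qed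

lemma gdist_le_gdiam:
  assumes "finite (verts G)" "u \<in> verts G" "v \<in> verts G"
  shows "gdist G u v \<le> gdiam G"
proof -
  have "{gdist G u v | u v. u \<in> verts G \<and> v \<in> verts G} = (\<lambda>(u, v). gdist G u v) ` (verts G \<times> verts G)"
    by auto
  then have "finite {gdist G u v | u v. u \<in> verts G \<and> v \<in> verts G}"
    using assms by simp
  then show ?thesis
    unfolding gdiam_def using assms by (intro Max_ge) auto
qed

lemma gdist_ge_lipschitz:
  fixes f :: "'a \<Rightarrow> real"
  assumes "connected_graph G" "u \<in> verts G" "v \<in> verts G"
    and "\<And>e. e \<in> arcs G \<Longrightarrow> \<bar>f (tail G e) - f (head G e)\<bar> \<le> 1"
  shows "\<bar>f u - f v\<bar> \<le> real (gdist G u v)"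
  using lipschitz_relpow[OF assms(4), where x=u and y=v] relpow_gdist[of u G v]
    connected_graphD[OF assms(1-3)] assms(2) by fastforce


section \<open>Dirichlet energy\<close>

definition energy :: "('a, 'b) pre_digraph \<Rightarrow> ('b \<Rightarrow> real) \<Rightarrow> ('a \<Rightarrow> real) \<Rightarrow> ('a \<Rightarrow> real) \<Rightarrow> real" where
  "energy G c f g = (\<Sum>e\<in>arcs G. c e * (f (tail G e) - f (head G e)) * (g (tail G e) - g (head G e)))"

text \<open>The energy of \<open>f\<close> against the indicator of \<open>x\<close>. The bracket
  makes each incident arc contribute \<open>f x\<close> minus the value at its other end, whatever
  its orientation.\<close>

definition laplacian :: "('a, 'b) pre_digraph \<Rightarrow> ('b \<Rightarrow> real) \<Rightarrow> ('a \<Rightarrow> real) \<Rightarrow> 'a \<Rightarrow> real" where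
  "laplacian G c f x = (\<Sum>e\<in>arcs G. c e * (f (tail G e) - f (head G e)) *
      (of_bool (tail G e = x) - of_bool (head G e = x)))"

text \<open>The degree-weighted sum of \<open>f\<close>, written over arcs so that it splits over
  the copies in the same way as the energy.\<close>

definition mass :: "('a, 'b) pre_digraph \<Rightarrow> ('a \<Rightarrow> real) \<Rightarrow> real" where
  "mass G f = (\<Sum>e\<in>arcs G. f (tail G e) + f (head G e))"

abbreviation unit_energy :: "('a, 'b) pre_digraph \<Rightarrow> ('a \<Rightarrow> real) \<Rightarrow> ('a \<Rightarrow> real) \<Rightarrow> real" where
  "unit_energy G \<equiv> energy G (\<lambda>_. 1)"

lemma energy_commute: "energy G c f g = energy G c g f"
  unfolding energy_def by (rule sum.cong) (auto simp: ac_simps)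

lemma energy_diff: "energy G c f (\<lambda>x. g x - h x) = energy G c f g - energy G c f h"
  unfolding energy_def by (simp add: sum_subtractf[symmetric] algebra_simps)

lemma energy_scale: "energy G c f (\<lambda>x. s * g x) = s * energy G c f g"
  unfolding energy_def by (simp add: sum_distrib_left algebra_simps)

lemma energy_nonneg: "(\<And>e. e \<in> arcs G \<Longrightarrow> 0 \<le> c e) \<Longrightarrow> 0 \<le> energy G c f f"
  unfolding energy_def by (intro sum_nonneg) (simp add: mult.assoc)

lemma sum_of_bool_mult:
  fixes f :: "'a \<Rightarrow> real"
  assumes "finite V" "z \<in> V"
  shows "(\<Sum>x\<in>V. f x * of_bool (z = x)) = f z"
  using sum.delta'[OF assms(1), of z f] assms(2) by (simp add: of_bool_def if_distrib cong: if_cong)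

text \<open>Green's formula: expand \<open>g\<close> at the two ends of each arc and exchange the
  sums over vertices and arcs.\<close>

lemma energy_eq_sum_laplacian:
  assumes "fin_digraph G"
  shows "energy G c f g = (\<Sum>x\<in>verts G. g x * laplacian G c f x)"
proof -
  interpret fin_digraph G by fact
  have "(\<Sum>x\<in>verts G. g x * laplacian G c f x)
      = (\<Sum>x\<in>verts G. \<Sum>e\<in>arcs G. c e * (f (tail G e) - f (head G e)) *
          (g x * of_bool (tail G e = x) - g x * of_bool (head G e = x)))"
    unfolding laplacian_def sum_distrib_left by (intro sum.cong) (auto simp: algebra_simps)
  also have "\<dots> = (\<Sum>e\<in>arcs G. \<Sum>x\<in>verts G. c e * (f (tail G e) - f (head G e)) *
          (g x * of_bool (tail G e = x) - g x * of_bool (head G e = x)))"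
    by (rule sum.swap)
  also have "\<dots> = (\<Sum>e\<in>arcs G. c e * (f (tail G e) - f (head G e)) * (g (tail G e) - g (head G e)))"
    by (intro sum.cong refl)
      (simp add: sum_distrib_left[symmetric] sum_subtractf sum_of_bool_mult)
  finally show ?thesis
    by (simp add: energy_def)
qed

locale fin_graph = fin_digraph G for G :: "('a, 'b) pre_digraph" +
  assumes simple: "simple_underlying G"
    and conn: "connected_graph G"
begin

lemma no_loop: "e \<in> arcs G \<Longrightarrow> tail G e \<noteq> head G e"
  using simple by (simp add: simple_underlying_def loopfree_digraph_def loopfree_digraph_axioms_def)

lemma ends_inj: "e \<in> arcs G \<Longrightarrow> e' \<in> arcs G \<Longrightarrow>
    {tail G e, head G e} = {tail G e', head G e'} \<Longrightarrow> e = e'"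
  using simple by (auto simp: simple_underlying_def inj_on_def)

lemma nbrs_subset: "nbrs G x \<subseteq> verts G"
  by (auto simp: nbrs_adj elim!: adjE)

lemma finite_nbrs: "finite (nbrs G x)"
  using nbrs_subset finite_verts by (rule finite_subset)

text \<open>Passage from sums over arcs to sums over neighbour sets. Simplicity makes the map from
  the arcs at \<open>x\<close> to their opposite ends a bijection onto the neighbours.\<close>

lemma sum_nbrs:
  fixes F :: "'a \<Rightarrow> real"
  shows "(\<Sum>e\<in>arcs G. of_bool (tail G e = x) * F (head G e) + of_bool (head G e = x) * F (tail G e))
     = (\<Sum>y\<in>nbrs G x. F y)"
proof -
  let ?E = "{e \<in> arcs G. tail G e = x \<or> head G e = x}"
  let ?o = "\<lambda>e. if tail G e = x then head G e else tail G e"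
  have img: "?o ` ?E = nbrs G x"
  proof
    show "?o ` ?E \<subseteq> nbrs G x"
      by (auto simp: nbrs_adj intro: adj_arc adj_sym)
    show "nbrs G x \<subseteq> ?o ` ?E"
    proof
      fix y assume "y \<in> nbrs G x"
      then have "(x, y) \<in> adj G" by (simp add: nbrs_adj)
      then show "y \<in> ?o ` ?E"
      proof (cases rule: adjE)
        case (1 e)
        then show ?thesis by (intro image_eqI[of _ _ e]) auto
      next
        case (2 e)
        then show ?thesis using no_loop by (intro image_eqI[of _ _ e]) auto
      qed
    qed
  qed
  have inj: "inj_on ?o ?E"
  proof (rule inj_onI)
    fix e e' assume "e \<in> ?E" "e' \<in> ?E" "?o e = ?o e'"
    then have "{tail G e, head G e} = {tail G e', head G e'}"
      by (auto split: if_splits)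
    then show "e = e'"
      using \<open>e \<in> ?E\<close> \<open>e' \<in> ?E\<close> ends_inj by blast
  qed
  have "(\<Sum>e\<in>arcs G. of_bool (tail G e = x) * F (head G e) + of_bool (head G e = x) * F (tail G e))
      = (\<Sum>e\<in>arcs G. if tail G e = x \<or> head G e = x then F (?o e) else 0)"
    by (rule sum.cong) (auto simp: of_bool_def dest: no_loop)
  also have "\<dots> = (\<Sum>e\<in>?E. F (?o e))"
    by (simp add: sum.If_cases Int_def)
  also have "\<dots> = (\<Sum>y\<in>nbrs G x. F y)"
    using sum.reindex[OF inj, of F] by (simp only: img o_def)
  finally show ?thesis .
qed

lemma laplacian_unit: "laplacian G (\<lambda>_. 1) f x = (\<Sum>y\<in>nbrs G x. f x - f y)"
  unfolding laplacian_def sum_nbrs[symmetric]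
  using no_loop by (intro sum.cong) auto

lemma mass_eq_sum: "mass G f = (\<Sum>x\<in>verts G. f x * real (card (nbrs G x)))"
proof -
  have "(\<Sum>x\<in>verts G. f x * real (card (nbrs G x)))
      = (\<Sum>x\<in>verts G. f x * (\<Sum>e\<in>arcs G. of_bool (tail G e = x) * 1 + of_bool (head G e = x) * 1))"
    unfolding sum_nbrs[of _ "\<lambda>_. 1"] by simp
  also have "\<dots> = (\<Sum>x\<in>verts G. f x * (\<Sum>e\<in>arcs G. of_bool (tail G e = x) + of_bool (head G e = x)))"
    by simp
  also have "\<dots> = (\<Sum>x\<in>verts G. \<Sum>e\<in>arcs G. f x * of_bool (tail G e = x) + f x * of_bool (head G e = x))"
    by (simp only: sum_distrib_left distrib_left)
  also have "\<dots> = (\<Sum>e\<in>arcs G. \<Sum>x\<in>verts G. f x * of_bool (tail G e = x) + f x * of_bool (head G e = x))"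
    by (rule sum.swap)
  also have "\<dots> = mass G f"
    unfolding mass_def by (intro sum.cong refl) (simp add: sum.distrib sum_of_bool_mult)
  finally show ?thesis by simp
qed

lemma energy_zero_imp_const:
  assumes "\<And>e. e \<in> arcs G \<Longrightarrow> f (tail G e) = (f (head G e) :: real)" "u \<in> verts G" "v \<in> verts G"
  shows "f u = f v"
proof -
  obtain l where "(u, v) \<in> adj G ^^ l"
    using connected_graphD[OF conn assms(2,3)] rtrancl_imp_relpow by blast
  then show ?thesis
    using lipschitz_relpow[of G f 0 u v l] assms(1) by auto
qed

subsection \<open>Unit potentials\<close>

text \<open>Monotone iteration: averaging over neighbours, with the values at \<open>u\<close> and
  \<open>w\<close> held fixed, increases from 0 and stays below 1, so it converges to a function
  that is harmonic elsewhere. Its energy against \<open>g\<close> then involves only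
  \<open>g u\<close> and \<open>g w\<close>.\<close>

lemma exists_potential:
  assumes u: "u \<in> verts G" and w: "w \<in> verts G" and "u \<noteq> w"
  shows "\<exists>h. (\<forall>x. 0 \<le> h x \<and> h x \<le> 1) \<and> h u = 1 \<and> h w = 0 \<and>
    (\<forall>g. unit_energy G h g = unit_energy G h h * (g u - g w))"
proof -
  define T where "T f x = (if x = u then 1 else if x = w then 0
      else (\<Sum>y\<in>nbrs G x. f y) / real (card (nbrs G x)))" for f :: "'a \<Rightarrow> real" and x
  define H where "H k = (T ^^ k) (\<lambda>x. 0)" for k
  have H_Suc: "H (Suc k) = T (H k)" for k
    by (simp add: H_def)
  have T_mono: "T f x \<le> T g x" if "\<And>y. f y \<le> g y" for f g x
    unfolding T_def using that by (auto intro!: divide_right_mono sum_mono)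
  have H_range: "0 \<le> H k x \<and> H k x \<le> 1" for k x
  proof (induction k arbitrary: x)
    case 0
    then show ?case by (simp add: H_def)
  next
    case (Suc k)
    have "(\<Sum>y\<in>nbrs G x. H k y) \<le> (\<Sum>y\<in>nbrs G x. 1)"
      using Suc by (intro sum_mono) auto
    then have "(\<Sum>y\<in>nbrs G x. H k y) / real (card (nbrs G x)) \<le> 1"
      by (auto simp: divide_le_eq_1)
    then show ?case
      using Suc by (auto simp: H_Suc T_def intro!: divide_nonneg_nonneg sum_nonneg)
  qed
  have H_mono: "H k x \<le> H (Suc k) x" for k x
  proof (induction k arbitrary: x)
    case 0
    then show ?case using H_range[of 1 x] by (simp add: H_def)
  next
    case (Suc k)
    then show ?case by (metis H_Suc T_mono)
  qed
  have "\<exists>l. (\<lambda>k. H k x) \<longlonglongrightarrow> l" for x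
  proof -
    have "incseq (\<lambda>k. H k x)" "\<And>k. H k x \<le> 1"
      using H_mono H_range by (auto intro: incseq_SucI)
    then show ?thesis
      using incseq_convergent[of "\<lambda>k. H k x" 1] by blast
  qed
  then obtain h where h: "\<And>x. (\<lambda>k. H k x) \<longlonglongrightarrow> h x"
    by metis
  have h_range: "0 \<le> h x \<and> h x \<le> 1" for x
    using h[of x] H_range by (auto intro: LIMSEQ_le_const LIMSEQ_le_const2)
  have hT: "h x = T h x" for x
  proof -
    have "(\<lambda>k. T (H k) x) \<longlonglongrightarrow> T h x"
      unfolding T_def using h by (auto simp: divide_inverse intro!: tendsto_intros)
    moreover have "(\<lambda>k. T (H k) x) \<longlonglongrightarrow> h x"
      using h[of x, THEN LIMSEQ_Suc] by (simp add: H_Suc)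
    ultimately show ?thesis
      using LIMSEQ_unique by blast
  qed
  have hu: "h u = 1" "h w = 0"
    using hT[of u] hT[of w] \<open>u \<noteq> w\<close> by (auto simp: T_def)
  have harm: "laplacian G (\<lambda>_. 1) h x = 0" if "x \<noteq> u" "x \<noteq> w" for x
  proof (cases "nbrs G x = {}")
    case False
    then have "card (nbrs G x) > 0"
      using finite_nbrs by (simp add: card_gt_0_iff)
    moreover have "h x = (\<Sum>y\<in>nbrs G x. h y) / real (card (nbrs G x))"
      using hT[of x] that by (simp add: T_def)
    ultimately show ?thesis
      by (simp add: laplacian_unit sum_subtractf field_simps)
  qed (simp add: laplacian_unit)
  define Lu Lw where "Lu = laplacian G (\<lambda>_. 1) h u" and "Lw = laplacian G (\<lambda>_. 1) h w"
  have en: "unit_energy G h g = g u * Lu + g w * Lw" for g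
  proof -
    have "unit_energy G h g = (\<Sum>x\<in>verts G. g x * laplacian G (\<lambda>_. 1) h x)"
      using energy_eq_sum_laplacian fin_digraph_axioms by blast
    also have "\<dots> = (\<Sum>x\<in>{u, w}. g x * laplacian G (\<lambda>_. 1) h x)"
      using harm u w by (intro sum.mono_neutral_right) auto
    finally show ?thesis
      using \<open>u \<noteq> w\<close> by (simp add: Lu_def Lw_def)
  qed
  \<comment> \<open>Constants have no energy, so the currents at \<open>u\<close> and
    \<open>w\<close> cancel and one number describes both.\<close>
  have "unit_energy G h (\<lambda>_. 1) = 0"
    by (simp add: energy_def)
  then have "Lu + Lw = 0"
    using en[of "\<lambda>_. 1"] by simp
  moreover have "unit_energy G h h = Lu"
    using en[of h] hu by simp
  ultimately have "unit_energy G h g = unit_energy G h h * (g u - g w)" for g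
    using en[of g] by (simp add: algebra_simps add_eq_0_iff)
  then show ?thesis
    using h_range hu by blast
qed

text \<open>The node law is the weak equation tested with indicators. The number defined by
  \<open>THE\<close> is unique by symmetry of the energy: for two unit flows \<open>k\<close> and
  \<open>k'\<close>, the energy of \<open>k'\<close> against \<open>k\<close> equals both potential
  differences.\<close>

lemma eff_resistance_potential:
  assumes u: "u \<in> verts G" and w: "w \<in> verts G"
    and en: "\<And>g. unit_energy G h g = I * (g u - g w)" and I: "I \<noteq> 0" and h: "h u = 1" "h w = 0"
  shows "eff_resistance G u w = 1 / I"
proof -
  have weak: "(\<forall>x\<in>verts G. (\<Sum>y\<in>nbrs G x. k x - k y) = of_bool (x = u) - of_bool (x = w))
      \<longleftrightarrow> (\<forall>g. unit_energy G k g = g u - g w)" (is "?A \<longleftrightarrow> ?B") for k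
  proof
    assume A: ?A
    show ?B
    proof
      fix g
      have "unit_energy G k g = (\<Sum>x\<in>verts G. g x * laplacian G (\<lambda>_. 1) k x)"
        using energy_eq_sum_laplacian fin_digraph_axioms by blast
      also have "\<dots> = (\<Sum>x\<in>verts G. g x * of_bool (u = x) - g x * of_bool (w = x))"
        using A by (intro sum.cong) (auto simp: laplacian_unit)
      finally show "unit_energy G k g = g u - g w"
        using u w by (simp add: sum_subtractf sum_of_bool_mult)
    qed
  next
    assume B: ?B
    show ?A
    proof
      fix x assume x: "x \<in> verts G"
      have "laplacian G (\<lambda>_. 1) k x = unit_energy G k (\<lambda>y. of_bool (y = x))"
        unfolding laplacian_def energy_def by simp
      also have "\<dots> = of_bool (x = u) - of_bool (x = w)"
        using B by auto
      finally show "(\<Sum>y\<in>nbrs G x. k x - k y) = of_bool (x = u) - of_bool (x = w)"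
        by (simp add: laplacian_unit)
    qed
  qed
  let ?k = "\<lambda>x. 1 / I * h x"
  have k: "\<forall>g. unit_energy G ?k g = g u - g w"
    unfolding energy_commute[of G _ ?k] energy_scale energy_commute[of G _ _ h] en using I by simp
  show ?thesis
    unfolding eff_resistance_def
  proof (rule the_equality)
    show "\<exists>k. (\<forall>x\<in>verts G. (\<Sum>y\<in>nbrs G x. k x - k y) = of_bool (x = u) - of_bool (x = w)) \<and> 1 / I = k u - k w"
      using k h weak by (intro exI[of _ ?k]) simp
  next
    fix R :: real assume "\<exists>k. (\<forall>x\<in>verts G. (\<Sum>y\<in>nbrs G x. k x - k y) = of_bool (x = u) - of_bool (x = w)) \<and> R = k u - k w"
    then obtain k' where k': "\<forall>g. unit_energy G k' g = g u - g w" "R = k' u - k' w"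
      using weak by metis
    then show "R = 1 / I"
      using k h energy_commute[of G "\<lambda>_. 1" k' ?k] by simp
  qed
qed

end


section \<open>Expected exit times\<close>

text \<open>First-step analysis: where all points of \<open>A\<close> have neighbours, this is the
  expectation of the exit time truncated at \<open>t\<close>, and \<open>survival\<close> is the
  probability of being in \<open>A\<close> at all times up to \<open>t\<close>.\<close>

primrec mean_exit :: "('a, 'b) pre_digraph \<Rightarrow> 'a set \<Rightarrow> nat \<Rightarrow> 'a \<Rightarrow> real" where
  "mean_exit G A 0 x = 0"
| "mean_exit G A (Suc t) x =
    (if x \<in> A then 1 + (\<Sum>y\<in>nbrs G x. mean_exit G A t y) / real (card (nbrs G x)) else 0)"

primrec survival :: "('a, 'b) pre_digraph \<Rightarrow> 'a set \<Rightarrow> nat \<Rightarrow> 'a \<Rightarrow> real" where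
  "survival G A 0 x = of_bool (x \<in> A)"
| "survival G A (Suc t) x =
    (if x \<in> A then (\<Sum>y\<in>nbrs G x. survival G A t y) / real (card (nbrs G x)) else 0)"

lemma survival_nonneg: "0 \<le> survival G A t x"
  by (induction t arbitrary: x) (auto intro!: divide_nonneg_nonneg sum_nonneg)

lemma mean_exit_eq_sum: "mean_exit G A t x = (\<Sum>s<t. survival G A s x)"
proof (induction t arbitrary: x)
  case (Suc t)
  show ?case
    unfolding sum.lessThan_Suc_shift
    by (simp add: Suc sum.swap[of _ "nbrs G x"] sum_divide_distrib)
qed simp

lemma mean_exit_mono: "mean_exit G A t x \<le> mean_exit G A (Suc t) x"
  unfolding mean_exit_eq_sum by (simp add: survival_nonneg)

lemma mean_exit_nonneg: "0 \<le> mean_exit G A t x"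
  unfolding mean_exit_eq_sum by (intro sum_nonneg survival_nonneg)

text \<open>The exit time counts the times up to which the trajectory has stayed in
  \<open>A\<close>. For a trajectory that never leaves both sides are infinite, since the infimum of
  the empty set is the top element.\<close>

lemma exit_time_eq_suminf:
  "exit_time A X = (\<Sum>t. indicator {X. \<forall>s\<le>t. X s \<in> A} X :: ennreal)"
proof (cases "\<exists>t. X t \<notin> A")
  case False
  then have "exit_time A X = \<infinity>" "\<And>t. indicator {X. \<forall>s\<le>t. X s \<in> A} X = (1 :: ennreal)"
    by (auto simp: exit_time_def infinity_ennreal_def)
  then show ?thesis
    by (simp add: suminf_eq_SUP ennreal_SUP_of_nat_eq_top infinity_ennreal_def)
next
  case True
  define T where "T = (LEAST t. X t \<notin> A)"
  have T: "X T \<notin> A" "\<And>t. X t \<notin> A \<Longrightarrow> T \<le> t"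
    unfolding T_def using LeastI_ex[of "\<lambda>t. X t \<notin> A"] True by (auto intro: Least_le)
  have TA: "X s \<in> A" if "s < T" for s
    using T(2) that not_less by blast
  have "exit_time A X = of_nat T"
    unfolding exit_time_def
  proof (rule antisym)
    show "Inf (of_nat ` {t. X t \<notin> A}) \<le> (of_nat T :: ennreal)"
      using T by (intro Inf_lower) auto
    show "(of_nat T :: ennreal) \<le> Inf (of_nat ` {t. X t \<notin> A})"
      using T by (intro Inf_greatest) auto
  qed
  also have "\<dots> = (\<Sum>t<T. 1)"
    by simp
  also have "\<dots> = (\<Sum>t<T. indicator {X. \<forall>s\<le>t. X s \<in> A} X)"
    by (intro sum.cong) (auto simp: indicator_def intro!: TA)
  also have "\<dots> = (\<Sum>t. indicator {X. \<forall>s\<le>t. X s \<in> A} X)"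
    using T by (intro suminf_finite[symmetric]) (auto simp: indicator_def not_less)
  finally show ?thesis .
qed

section \<open>The law of the walk and its survival probabilities\<close>

context
  fixes G :: "('a, 'b) pre_digraph" and v :: 'a and A :: "'a set"
  assumes nbrs: "\<And>x. x \<in> A \<Longrightarrow> finite (nbrs G x) \<and> nbrs G x \<noteq> {}"
begin

interpretation IT: Ionescu_Tulcea "srw_kernel G v" "\<lambda>_. count_space UNIV"
  by (rule Ionescu_Tulcea_srw)

text \<open>Transition operator of the walk killed on leaving \<open>A\<close>.\<close>

definition killed_step :: "('a \<Rightarrow> ennreal) \<Rightarrow> 'a \<Rightarrow> ennreal" where
  "killed_step \<phi> x = indicator A x * (\<integral>\<^sup>+y. \<phi> y \<partial>measure_pmf (pmf_of_set (nbrs G x)))"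

text \<open>Integrating out the last step replaces \<open>\<phi>\<close> by
  \<open>killed_step \<phi>\<close> one time earlier, so \<open>\<phi>\<close> has to vary in the
  induction. The argument \<open>\<lambda>_. undefined\<close> is the only history of length
  0.\<close>

lemma nn_integral_killed:
  "(\<integral>\<^sup>+\<omega>. (\<Prod>s<t. indicator A (\<omega> s)) * \<phi> (\<omega> t) \<partial>IT.C 0 (Suc t) (\<lambda>_. undefined))
     = (killed_step ^^ t) \<phi> v"
proof (induction t arbitrary: \<phi>)
  case 0
  have "(\<integral>\<^sup>+\<omega>. \<phi> (\<omega> 0) \<partial>IT.C 0 (Suc 0) (\<lambda>_. undefined))
      = (\<integral>\<^sup>+\<omega>. \<phi> (\<omega> 0) \<partial>IT.eP 0 (\<lambda>_. undefined))"
    unfolding IT.C.simps add_0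
    by (rule arg_cong[where f="\<lambda>M. nn_integral M _"], rule bind_return[OF IT.measurable_eP])
      (simp add: space_PiM)
  also have "\<dots> = (\<integral>\<^sup>+y. \<phi> y \<partial>srw_kernel G v 0 (\<lambda>_. undefined))"
    by (subst IT.nn_integral_eP)
      (auto simp: space_PiM intro: measurable_compose[OF measurable_component_singleton])
  also have "\<dots> = \<phi> v"
    by (simp add: srw_kernel_def)
  finally show ?case by simp
next
  case (Suc t)
  let ?P = "\<lambda>n. PiM {0..<n} (\<lambda>_. count_space UNIV) :: (nat \<Rightarrow> 'a) measure"
  have meas: "(\<lambda>\<omega>. (\<Prod>s<Suc t. indicator A (\<omega> s)) * \<phi> (\<omega> (Suc t))) \<in> borel_measurable (?P (Suc (Suc t)))"
    by (intro borel_measurable_times_ennreal borel_measurable_prod_ennreal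
        measurable_compose[OF measurable_component_singleton]) auto
  have "(\<integral>\<^sup>+\<omega>. (\<Prod>s<Suc t. indicator A (\<omega> s)) * \<phi> (\<omega> (Suc t)) \<partial>IT.C 0 (Suc (Suc t)) (\<lambda>_. undefined))
      = (\<integral>\<^sup>+\<omega>. \<integral>\<^sup>+\<omega>'. (\<Prod>s<Suc t. indicator A (\<omega>' s)) * \<phi> (\<omega>' (Suc t)) \<partial>IT.eP (Suc t) \<omega>
            \<partial>IT.C 0 (Suc t) (\<lambda>_. undefined))"
    unfolding IT.C.simps(2)[of 0 "Suc t"] add_0
  proof (rule nn_integral_bind[where B="?P (Suc (Suc t))"])
    have "sets (IT.C 0 (Suc t) (\<lambda>_. undefined)) = sets (?P (Suc t))"
      using IT.sets_C[of "\<lambda>_. undefined" 0 "Suc t"] by (simp add: space_PiM del: IT.C.simps)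
    then show "IT.eP (Suc t) \<in> measurable (IT.C 0 (Suc t) (\<lambda>_. undefined)) (subprob_algebra (?P (Suc (Suc t))))"
      using IT.measurable_eP[of "Suc t"] by (subst measurable_cong_sets[OF _ refl]) assumption+
  qed (rule meas)
  also have "\<dots> = (\<integral>\<^sup>+\<omega>. (\<Prod>s<t. indicator A (\<omega> s)) * killed_step \<phi> (\<omega> t) \<partial>IT.C 0 (Suc t) (\<lambda>_. undefined))"
  proof (rule nn_integral_cong)
    fix \<omega> assume "\<omega> \<in> space (IT.C 0 (Suc t) (\<lambda>_. undefined))"
    then have \<omega>: "\<omega> \<in> space (?P (Suc t))"
      by (simp add: IT.space_C del: IT.C.simps)
    have "(\<integral>\<^sup>+\<omega>'. (\<Prod>s<Suc t. indicator A (\<omega>' s)) * \<phi> (\<omega>' (Suc t)) \<partial>IT.eP (Suc t) \<omega>)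
        = (\<integral>\<^sup>+y. (\<Prod>s<Suc t. indicator A (\<omega> s)) * \<phi> y \<partial>srw_kernel G v (Suc t) \<omega>)"
    proof -
      have "(\<Prod>s<Suc t. indicator A (fun_upd \<omega> (Suc t) y s)) = (\<Prod>s<Suc t. indicator A (\<omega> s) :: ennreal)" for y
        by (rule prod.cong) auto
      then show ?thesis
        unfolding IT.nn_integral_eP[OF \<omega> meas] by (simp only: fun_upd_same)
    qed
    also have "\<dots> = (\<Prod>s<t. indicator A (\<omega> s)) * killed_step \<phi> (\<omega> t)"
      by (simp add: srw_kernel_def killed_step_def nn_integral_cmult mult.assoc)
    finally show "(\<integral>\<^sup>+\<omega>'. (\<Prod>s<Suc t. indicator A (\<omega>' s)) * \<phi> (\<omega>' (Suc t)) \<partial>IT.eP (Suc t) \<omega>)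
        = (\<Prod>s<t. indicator A (\<omega> s)) * killed_step \<phi> (\<omega> t)" .
  qed
  also have "\<dots> = (killed_step ^^ Suc t) \<phi> v"
    unfolding Suc.IH by (simp add: funpow_swap1)
  finally show ?case .
qed

lemma killed_step_survival:
  "(killed_step ^^ t) (indicator A) x = ennreal (survival G A t x)"
proof (induction t arbitrary: x)
  case 0
  then show ?case by (simp add: indicator_def)
next
  case (Suc t)
  have "killed_step (\<lambda>x. ennreal (survival G A t x)) x = ennreal (survival G A (Suc t) x)"
  proof (cases "x \<in> A")
    case True
    then have "card (nbrs G x) > 0"
      using nbrs by (simp add: card_gt_0_iff)
    have "(\<integral>\<^sup>+y. ennreal (survival G A t y) \<partial>measure_pmf (pmf_of_set (nbrs G x)))
        = (\<Sum>y\<in>nbrs G x. ennreal (survival G A t y)) / of_nat (card (nbrs G x))"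
      using nbrs True by (intro nn_integral_pmf_of_set) auto
    also have "\<dots> = ennreal ((\<Sum>y\<in>nbrs G x. survival G A t y) / real (card (nbrs G x)))"
      using \<open>card (nbrs G x) > 0\<close>
      by (simp add: sum_ennreal survival_nonneg sum_nonneg divide_ennreal ennreal_of_nat_eq_real_of_nat)
    finally show ?thesis
      using True by (simp add: killed_step_def)
  qed (simp add: killed_step_def)
  then show ?case
    by (simp add: Suc[abs_def])
qed

text \<open>The event depends on the coordinates up to \<open>t\<close> only, so the projective
  limit can be replaced by the composition of the first \<open>t + 1\<close> kernels, whose integral
  is the killed iteration.\<close>

lemma emeasure_survival:
  "emeasure (srw G v) {X. \<forall>s\<le>t. X s \<in> A} = ennreal (survival G A t v)"
proof -
  let ?M = "\<lambda>_ :: nat. count_space (UNIV :: 'a set)"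
  let ?X = "PiE {0..<Suc t} (\<lambda>_. A)"
  have X: "?X \<in> sets (PiM {0..<Suc t} ?M)"
    by (intro sets_PiM_I_finite) auto
  have "{X. \<forall>s\<le>t. X s \<in> A} = prod_emb UNIV ?M {0..<Suc t} ?X"
    by (auto simp: prod_emb_def space_PiM PiE_iff extensional_def restrict_def less_Suc_eq_le)
  then have "emeasure (srw G v) {X. \<forall>s\<le>t. X s \<in> A} = emeasure (IT.CI {0..<Suc t}) ?X"
    unfolding srw_def using IT.lim[OF _ X] by simp
  also have "\<dots> = emeasure (IT.C 0 (Suc t) (\<lambda>_. undefined)) (prod_emb {0..<Suc t} ?M {0..<Suc t} ?X)"
    by (rule IT.emeasure_CI[OF _ X]) simp
  also have "prod_emb {0..<Suc t} ?M {0..<Suc t} ?X = ?X"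
    by (rule prod_emb_id) (auto simp: PiE_iff)
  also have "emeasure (IT.C 0 (Suc t) (\<lambda>_. undefined)) ?X
      = (\<integral>\<^sup>+\<omega>. indicator ?X \<omega> \<partial>IT.C 0 (Suc t) (\<lambda>_. undefined))"
    using X by (subst nn_integral_indicator) (auto simp: IT.sets_C simp del: IT.C.simps)
  also have "\<dots> = (\<integral>\<^sup>+\<omega>. (\<Prod>s<t. indicator A (\<omega> s)) * indicator A (\<omega> t) \<partial>IT.C 0 (Suc t) (\<lambda>_. undefined))"
  proof (rule nn_integral_cong)
    fix \<omega> :: "nat \<Rightarrow> 'a" assume "\<omega> \<in> space (IT.C 0 (Suc t) (\<lambda>_. undefined))"
    then have \<omega>: "\<omega> \<in> extensional {0..<Suc t}"
      by (simp add: IT.space_C space_PiM PiE_def del: IT.C.simps)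
    have "(\<Prod>s<Suc t. indicator A (\<omega> s)) = (indicator ?X \<omega> :: ennreal)"
    proof (cases "\<omega> \<in> ?X")
      case True
      then show ?thesis by (auto simp: PiE_iff indicator_def)
    next
      case False
      then obtain s where "s < Suc t" "\<omega> s \<notin> A"
        using \<omega> by (auto simp: PiE_iff)
      then show ?thesis
        using False prod_zero[of "{..<Suc t}" "\<lambda>s. indicator A (\<omega> s) :: ennreal"] by force
    qed
    then show "indicator ?X \<omega> = (\<Prod>s<t. indicator A (\<omega> s)) * (indicator A (\<omega> t) :: ennreal)"
      by simp
  qed
  also have "\<dots> = ennreal (survival G A t v)"
    unfolding nn_integral_killed killed_step_survival ..
  finally show ?thesis .
qed

lemma expected_exit_time_eq_SUP:
  "expected_exit_time G v A = (SUP t. ennreal (mean_exit G A t v))"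
proof -
  let ?S = "\<lambda>t. {X. \<forall>s\<le>t. X s \<in> A}"
  have meas: "?S t \<in> sets (srw G v)" for t
  proof -
    have "?S t = prod_emb UNIV (\<lambda>_. count_space UNIV) {..t} (PiE {..t} (\<lambda>_. A))"
      by (auto simp: prod_emb_def space_PiM PiE_iff extensional_def restrict_def)
    then show ?thesis
      unfolding srw_def IT.PF.sets_lim by (auto intro!: sets_PiM_I)
  qed
  have "expected_exit_time G v A = (\<Sum>t. \<integral>\<^sup>+X. indicator (?S t) X \<partial>srw G v)"
    unfolding expected_exit_time_def exit_time_eq_suminf
    using meas by (intro nn_integral_suminf) auto
  also have "\<dots> = (\<Sum>t. ennreal (survival G A t v))"
    using meas by (simp add: emeasure_survival)
  also have "\<dots> = (SUP t. ennreal (mean_exit G A t v))"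
    unfolding suminf_eq_SUP mean_exit_eq_sum by (simp add: sum_ennreal survival_nonneg)
  finally show ?thesis .
qed

end

section \<open>Exit times as solutions of a Poisson problem\<close>

context fin_graph
begin

lemma nbrs_nonempty:
  assumes "x \<in> verts G" "y \<in> verts G" "x \<noteq> y"
  shows "nbrs G x \<noteq> {}"
  using connected_graphD[OF conn assms(1,2)] assms(3)
  by (cases rule: converse_rtranclE) (auto simp: nbrs_adj)

text \<open>The Laplacian of the truncated exit time is at most the degree on \<open>A\<close>,
  because the expectation grows with the truncation; hence its energy \<open>D\<close> is at most
  its mass. Its differences along arcs are at most \<open>sqrt D\<close> and it vanishes at
  \<open>z\<close>, so its mass is at most a constant times \<open>sqrt D\<close>. Together these
  bound \<open>D\<close>, and with it the function, uniformly in \<open>t\<close>.\<close>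

lemma mean_exit_bounded:
  assumes A: "A \<subseteq> verts G" and z: "z \<in> verts G" "z \<notin> A"
  shows "\<exists>B. \<forall>t x. mean_exit G A t x \<le> B"
proof -
  have "\<exists>l. (x, z) \<in> adj G ^^ l" if "x \<in> verts G" for x
    using connected_graphD[OF conn that z(1)] rtrancl_imp_relpow by blast
  then obtain l where l: "\<And>x. x \<in> verts G \<Longrightarrow> (x, z) \<in> adj G ^^ l x"
    by metis
  define N where "N = real (Max (l ` verts G))"
  have lN: "real (l x) \<le> N" if "x \<in> verts G" for x
    unfolding N_def using that by simp
  define a where "a = 2 * real (card (arcs G))"
  have "mean_exit G A t x \<le> a * N * N" for t x
  proof -
    let ?f = "mean_exit G A t"
    define D where "D = unit_energy G ?f ?f"
    have D0: "0 \<le> D"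
      unfolding D_def by (rule energy_nonneg) simp
    have fz: "mean_exit G A t x = 0" if "x \<notin> A" for x
      using that by (cases t) auto
    have lap: "laplacian G (\<lambda>_. 1) ?f x \<le> real (card (nbrs G x))" if "x \<in> A" for x
    proof -
      have "nbrs G x \<noteq> {}"
        using nbrs_nonempty[of x z] that A z by auto
      then have c: "card (nbrs G x) > 0"
        using finite_nbrs by (simp add: card_gt_0_iff)
      have "?f x \<le> 1 + (\<Sum>y\<in>nbrs G x. ?f y) / real (card (nbrs G x))"
        using mean_exit_mono[of G A t x] that by simp
      then show ?thesis
        using c by (simp add: laplacian_unit sum_subtractf field_simps)
    qed
    have "D = (\<Sum>x\<in>verts G. ?f x * laplacian G (\<lambda>_. 1) ?f x)"
      unfolding D_def using energy_eq_sum_laplacian fin_digraph_axioms by blast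
    also have "\<dots> \<le> (\<Sum>x\<in>verts G. ?f x * real (card (nbrs G x)))"
      using lap fz mean_exit_nonneg[of G A t] by (intro sum_mono) (metis mult_left_mono mult_zero_left order_refl)
    also have "\<dots> = mass G ?f"
      by (simp add: mass_eq_sum)
    finally have Dm: "D \<le> mass G ?f" .
    have grad: "\<bar>?f (tail G e) - ?f (head G e)\<bar> \<le> sqrt D" if "e \<in> arcs G" for e
    proof -
      have "(?f (tail G e) - ?f (head G e))\<^sup>2 \<le> D"
        unfolding D_def energy_def using that
        by (simp add: power2_eq_square) (rule member_le_sum, auto)
      then show ?thesis
        using real_le_rsqrt by (metis power2_abs)
    qed
    have fx: "?f x \<le> N * sqrt D" if "x \<in> verts G" for x
    proof -
      have "\<bar>?f x - ?f z\<bar> \<le> real (l x) * sqrt D"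
        using grad l[OF that] by (rule lipschitz_relpow)
      also have "\<dots> \<le> N * sqrt D"
        using lN[OF that] D0 by (simp add: mult_right_mono)
      finally show ?thesis
        using fz[OF z(2)] by simp
    qed
    have "mass G ?f \<le> (\<Sum>e\<in>arcs G. N * sqrt D + N * sqrt D)"
      unfolding mass_def by (intro sum_mono add_mono fx) auto
    also have "\<dots> = a * N * sqrt D"
      by (simp add: a_def)
    finally have "sqrt D * sqrt D \<le> a * N * sqrt D"
      using Dm D0 by simp
    then have "sqrt D \<le> a * N"
      using D0 mult_right_le_imp_le[of "sqrt D" "sqrt D" "a * N"] by (cases "D = 0") (auto simp: a_def N_def)
    then have "N * sqrt D \<le> a * N * N"
      by (metis N_def mult.commute mult_left_mono of_nat_0_le_iff)
    then show ?thesis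
      using fx[of x] fz[of x] A by (cases "x \<in> A") (auto simp: a_def N_def)
  qed
  then show ?thesis by blast
qed

text \<open>The limit of the truncated times solves the Poisson equation in \<open>A\<close>.
  Outside \<open>A\<close> it attains its minimum 0, so its Laplacian is nonpositive there: the
  equality for \<open>g\<close> supported in \<open>A\<close> becomes an inequality for all
  nonnegative \<open>g\<close>. The upper bound on exit times relies on the inequality, since its
  test function can stick out of the ball.\<close>

lemma exit_time_weak:
  assumes A: "A \<subseteq> verts G" and z: "z \<in> verts G" "z \<notin> A"
  obtains f where "\<And>x. 0 \<le> f x" "\<And>x. x \<notin> A \<Longrightarrow> f x = 0"
    "\<And>v. expected_exit_time G v A = ennreal (f v)"
    "\<And>g. (\<And>x. x \<in> verts G \<Longrightarrow> 0 \<le> g x) \<Longrightarrow> unit_energy G f g \<le> mass G g"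
    "\<And>g. (\<And>x. x \<in> verts G - A \<Longrightarrow> g x = 0) \<Longrightarrow> unit_energy G f g = mass G g"
proof -
  have ne: "finite (nbrs G x) \<and> nbrs G x \<noteq> {}" if "x \<in> A" for x
    using nbrs_nonempty[of x z] that A z finite_nbrs by auto
  obtain B where B: "\<And>t x. mean_exit G A t x \<le> B"
    using mean_exit_bounded[OF assms] by blast
  have "\<exists>l. (\<lambda>t. mean_exit G A t x) \<longlonglongrightarrow> l" for x
  proof -
    have "incseq (\<lambda>t. mean_exit G A t x)"
      using mean_exit_mono by (rule incseq_SucI)
    moreover have "bdd_above (range (\<lambda>t. mean_exit G A t x))"
      using B by (intro bdd_aboveI[of _ B]) auto
    ultimately show ?thesis
      using LIMSEQ_incseq_SUP by blast
  qed
  then obtain f where f: "\<And>x. (\<lambda>t. mean_exit G A t x) \<longlonglongrightarrow> f x"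
    by metis
  have f0: "0 \<le> f x" for x
    by (intro LIMSEQ_le_const[OF f[of x]]) (simp add: mean_exit_nonneg)
  have f_Suc: "f x = (if x \<in> A then 1 + (\<Sum>y\<in>nbrs G x. f y) / real (card (nbrs G x)) else 0)" for x
  proof -
    have "(\<lambda>t. mean_exit G A (Suc t) x) \<longlonglongrightarrow>
        (if x \<in> A then 1 + (\<Sum>y\<in>nbrs G x. f y) / real (card (nbrs G x)) else 0)"
      using f by (auto simp: divide_inverse intro!: tendsto_intros)
    then show ?thesis
      using f[of x, THEN LIMSEQ_Suc] LIMSEQ_unique by blast
  qed
  have fA: "f x = 0" if "x \<notin> A" for x
    using f_Suc[of x] that by simp
  have ex: "expected_exit_time G v A = ennreal (f v)" for v
  proof -
    have "expected_exit_time G v A = (SUP t. ennreal (mean_exit G A t v))"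
      using ne by (rule expected_exit_time_eq_SUP)
    also have "\<dots> = ennreal (f v)"
    proof (rule LIMSEQ_unique)
      show "(\<lambda>t. ennreal (mean_exit G A t v)) \<longlonglongrightarrow> (SUP t. ennreal (mean_exit G A t v))"
        by (intro LIMSEQ_SUP incseq_SucI ennreal_leI mean_exit_mono)
      show "(\<lambda>t. ennreal (mean_exit G A t v)) \<longlonglongrightarrow> ennreal (f v)"
        using f by (rule tendsto_ennrealI)
    qed
    finally show ?thesis .
  qed
  have lapA: "laplacian G (\<lambda>_. 1) f x = real (card (nbrs G x))" if "x \<in> A" for x
  proof -
    have "card (nbrs G x) > 0"
      using ne[OF that] by (simp add: card_gt_0_iff)
    then show ?thesis
      using f_Suc[of x] that by (simp add: laplacian_unit sum_subtractf field_simps)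
  qed
  have lap_le: "laplacian G (\<lambda>_. 1) f x \<le> real (card (nbrs G x))" for x
  proof (cases "x \<in> A")
    case False
    have "(\<Sum>y\<in>nbrs G x. f x - f y) \<le> 0"
      using fA[OF False] f0 by (intro sum_nonpos) auto
    then show ?thesis
      by (simp add: laplacian_unit)
  qed (simp add: lapA)
  have en: "unit_energy G f g = (\<Sum>x\<in>verts G. g x * laplacian G (\<lambda>_. 1) f x)" for g
    using energy_eq_sum_laplacian fin_digraph_axioms by blast
  show ?thesis
  proof (rule that[of f])
    show "unit_energy G f g \<le> mass G g" if "\<And>x. x \<in> verts G \<Longrightarrow> 0 \<le> g x" for g
      unfolding en mass_eq_sum using that lap_le by (intro sum_mono mult_left_mono) auto
    show "unit_energy G f g = mass G g" if "\<And>x. x \<in> verts G - A \<Longrightarrow> g x = 0" for g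
      unfolding en mass_eq_sum using that lapA by (intro sum.cong refl) (metis DiffI mult_zero_left)
  qed (use f0 fA ex in auto)
qed

end


section \<open>Structure of the iterates\<close>

text \<open>A walk with steps in \<open>B\<close> is cut down to a simple path with steps in
  \<open>B\<close>; this is how a connection avoiding a colour is confronted with the path
  matrices.\<close>

lemma exists_und_path:
  assumes "wf_digraph G" "B \<subseteq> adj G" "u \<in> verts G" "(u, v) \<in> B\<^sup>*"
  shows "\<exists>p. und_path G u p v \<and> set p \<subseteq> B"
proof -
  let ?W = "with_proj (mk_symmetric G)"
  interpret W: wf_digraph ?W
    using assms(1) by unfold_locales (auto simp: parcs_mk_symmetric wf_digraph_def)
  have "\<exists>p. set p \<subseteq> B \<and> pre_digraph.cas ?W u p v"
    using assms(4)
  proof (induction rule: converse_rtrancl_induct)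
    case base
    show ?case by (intro exI[of _ "[]"]) (simp add: pre_digraph.cas.simps)
  next
    case (step x y)
    then obtain p where "set p \<subseteq> B" "pre_digraph.cas ?W y p v" by blast
    then show ?case
      using step by (intro exI[of _ "(x, y) # p"]) (simp add: pre_digraph.cas.simps)
  qed
  then obtain p where p: "set p \<subseteq> B" "pre_digraph.cas ?W u p v" by blast
  then have "W.awalk u p v"
    unfolding W.awalk_def using assms(2,3) by (auto simp: parcs_mk_symmetric_adj)
  then show ?thesis
    unfolding und_path_def using W.apath_awalk_to_apath W.awalk_to_apath_subset p by blast
qed

section \<open>Self-similarity: addresses, copies and gluing\<close>

definition embed :: "(('a, 'b) xvertex, 'b list) pre_digraph \<Rightarrow> 'b list \<Rightarrow> ('a, 'b) xvertex \<Rightarrow> ('a, 'b) xvertex" where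
  "embed G g w = (case w of Init_plus \<Rightarrow> tail G g | Init_minus \<Rightarrow> head G g | Born e x \<Rightarrow> Born (e @ g) x)"

lemma embed_simps [simp]:
  "embed G g Init_plus = tail G g" "embed G g Init_minus = head G g" "embed G g (Born e x) = Born (e @ g) x"
  by (simp_all add: embed_def)

text \<open>\<open>glue p a F\<close> has the values \<open>a\<close> on the vertices of level \<open>p\<close> and \<open>F g\<close> inside the copy at
  the level-\<open>p\<close> edge \<open>g\<close>.\<close>

definition glue :: "nat \<Rightarrow> (('a, 'b) xvertex \<Rightarrow> real) \<Rightarrow> ('b list \<Rightarrow> ('a, 'b) xvertex \<Rightarrow> real) \<Rightarrow>
    ('a, 'b) xvertex \<Rightarrow> real" where
  "glue p a F w = (case w of
      Born l y \<Rightarrow> if p \<le> length l then F (drop (length l - p) l) (Born (take (length l - p) l) y) else a w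
    | _ \<Rightarrow> a w)"

lemma xcolour_append: "xcolour S j (f @ g) = xcolour S (xcolour S j g) f"
  by (induction f) auto

lemma arcs_Xi_Suc: "arcs (Xi_from S j (Suc n)) =
    {f # e | f e. e \<in> arcs (Xi_from S j n) \<and> f \<in> arcs (rule_graph S (xcolour S j e))}"
  by (simp add: substitute_def)

lemma length_arc: "e \<in> arcs (Xi_from S j n) \<Longrightarrow> length e = n"
proof (induction n arbitrary: e)
  case (Suc n)
  then show ?case unfolding arcs_Xi_Suc by auto
qed simp

text \<open>Addresses list the most recent edge first, so the edges in the copy at \<open>g\<close>
  are those whose addresses end in \<open>g\<close>, and this copy is an iterate started with the
  colour of \<open>g\<close>.\<close>

lemma arcs_Xi_append:
  "arcs (Xi_from S j (q + p)) =
     {f @ g | f g. g \<in> arcs (Xi_from S j p) \<and> f \<in> arcs (Xi_from S (xcolour S j g) q)}"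
proof (induction q)
  case (Suc q)
  show ?case
    unfolding add_Suc arcs_Xi_Suc Suc
    by (auto simp: xcolour_append) (metis append_Cons, metis xcolour_append)
qed simp

lemma tail_Xi_Suc:
  "tail (Xi_from S j (Suc n)) (f # e) = planted S j (Xi_from S j n) e (tail (rule_graph S (xcolour S j e)) f)"
  "head (Xi_from S j (Suc n)) (f # e) = planted S j (Xi_from S j n) e (head (rule_graph S (xcolour S j e)) f)"
  by (simp_all add: substitute_def)

lemma ends_embed:
  assumes "length f = q"
  shows "tail (Xi_from S j (q + p)) (f @ g) = embed (Xi_from S j p) g (tail (Xi_from S (xcolour S j g) q) f)"
    "head (Xi_from S j (q + p)) (f @ g) = embed (Xi_from S j p) g (head (Xi_from S (xcolour S j g) q) f)"
  using assms
proof (induction q arbitrary: f)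
  case 0
  {
    case 1
    then show ?case by simp
  next
    case 2
    then show ?case by simp
  }
next
  case (Suc q)
  {
    case 1
    then obtain a e where "f = a # e" "length e = q" by (metis length_Suc_conv)
    then show ?case
      using Suc[of e] by (simp add: tail_Xi_Suc planted_def xcolour_append del: Xi_from.simps)
  next
    case 2
    then obtain a e where "f = a # e" "length e = q" by (metis length_Suc_conv)
    then show ?case
      using Suc[of e] by (simp add: tail_Xi_Suc planted_def xcolour_append del: Xi_from.simps)
  }
qed

section \<open>Consequences of the assumptions on the rule graphs\<close>

locale eigs_system =
  fixes S :: "('a, 'b) eigs"
  assumes eigs: "eigs S" and distance_positive: "distance_positive S"
begin

abbreviation "K \<equiv> num_colours S"
abbreviation "R \<equiv> rule_graph S"
abbreviation "X \<equiv> Xi_from S"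
abbreviation "ecol \<equiv> xcolour S"
abbreviation "bp \<equiv> plant_plus S"
abbreviation "bm \<equiv> plant_minus S"

lemma K_pos: "0 < K"
  using eigs by (simp add: eigs_def)

lemma plant_facts:
  assumes "i < K"
  shows "bp i \<in> verts (R i)" "bm i \<in> verts (R i)" "bp i \<noteq> bm i"
  using eigs assms by (auto simp: eigs_def)

lemma edge_colour_less: "i < K \<Longrightarrow> f \<in> arcs (R i) \<Longrightarrow> edge_colour S i f < K"
  using eigs by (auto simp: eigs_def)

lemma rule_fin_graph: "i < K \<Longrightarrow> fin_graph (R i)"
  using eigs by (auto simp: eigs_def fin_graph_def fin_graph_axioms_def intro: connected_imp_connected_graph)

lemma col_less: "j < K \<Longrightarrow> e \<in> arcs (X j n) \<Longrightarrow> ecol j e < K"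
proof (induction n arbitrary: e)
  case (Suc n)
  then show ?case
    unfolding arcs_Xi_Suc using edge_colour_less by auto
qed simp

text \<open>A path matrix needs a path in every rule graph at once, so \<open>p\<close> is completed
  by arbitrary paths in the others; then the entry \<open>(i, c)\<close> is positive.\<close>

lemma path_uses_colour:
  assumes i: "i < K" and p: "und_path (R i) (bp i) p (bm i)" and c: "c < K"
  shows "\<exists>e\<in>arcs (R i). edge_colour S i e = c \<and> on_path (R i) p e"
proof -
  have "\<exists>p. und_path (R k) (bp k) p (bm k)" if "k < K" for k
  proof -
    interpret fin_graph "R k" using that by (rule rule_fin_graph)
    show ?thesis
      using exists_und_path[OF wf_digraph order_refl, of "bp k" "bm k"] plant_facts[OF that]
        connected_graphD[OF conn] by blast
  qed
  then obtain P where P: "\<And>k. k < K \<Longrightarrow> und_path (R k) (bp k) (P k) (bm k)"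
    by metis
  let ?P = "P(i := p)"
  let ?M = "Matrix.mat K K (\<lambda>(i, j). card {e \<in> arcs (R i). edge_colour S i e = j \<and> on_path (R i) (?P i) e})"
  have "?M \<in> path_matrices S"
    unfolding path_matrices_def using P p by (intro CollectI exI[of _ ?P]) auto
  then have "positive_mat ?M"
    using distance_positive by (simp add: distance_positive_def)
  then have "?M $$ (i, c) > 0"
    using i c unfolding positive_mat_def by (metis (no_types, lifting) dim_row_mat(1) dim_col_mat(1))
  then have "card {e \<in> arcs (R i). edge_colour S i e = c \<and> on_path (R i) p e} > 0"
    using i c by simp
  then show ?thesis
    by (metis (mono_tags, lifting) card_gt_0_iff ex_in_conv mem_Collect_eq)
qed

text \<open>A connection without colour \<open>c\<close> would contain a simple path, which must use
  an edge of colour \<open>c\<close>. Paths record pairs of vertices, and simplicity recovers the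
  edge and its colour from such a pair.\<close>

lemma colour_cut:
  assumes i: "i < K" and c: "c < K"
    and B: "B = (\<Union>e\<in>{e \<in> arcs (R i). edge_colour S i e \<noteq> c}. {(tail (R i) e, head (R i) e), (head (R i) e, tail (R i) e)})"
  shows "(bp i, bm i) \<notin> B\<^sup>*"
proof
  interpret fin_graph "R i" using i by (rule rule_fin_graph)
  assume "(bp i, bm i) \<in> B\<^sup>*"
  moreover have "B \<subseteq> adj (R i)"
    unfolding B adj_def by auto
  ultimately obtain p where p: "und_path (R i) (bp i) p (bm i)" "set p \<subseteq> B"
    using exists_und_path[OF wf_digraph] plant_facts[OF i] by blast
  obtain e where e: "e \<in> arcs (R i)" "edge_colour S i e = c" "on_path (R i) p e"
    using path_uses_colour[OF i p(1) c] by blast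
  then have "(tail (R i) e, head (R i) e) \<in> B \<or> (head (R i) e, tail (R i) e) \<in> B"
    using p(2) by (auto simp: on_path_def)
  then obtain e' where "e' \<in> arcs (R i)" "edge_colour S i e' \<noteq> c"
      "{tail (R i) e, head (R i) e} = {tail (R i) e', head (R i) e'}"
    unfolding B by (auto simp: doubleton_eq_iff)
  then show False
    using ends_inj[OF e(1)] e(2) by blast
qed

text \<open>A direct edge would be a path with a single colour, which misses some colour when there
  are at least two. For one colour the distance clause excludes it.\<close>

lemma no_direct_arc:
  assumes i: "i < K" and f: "f \<in> arcs (R i)"
  shows "{tail (R i) f, head (R i) f} \<noteq> {bp i, bm i}"
proof
  interpret fin_graph "R i" using i by (rule rule_fin_graph)
  assume ends: "{tail (R i) f, head (R i) f} = {bp i, bm i}"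
  then have adj: "(bp i, bm i) \<in> adj (R i)"
    using f plant_facts(3)[OF i] by (auto simp: adj_def doubleton_eq_iff intro!: bexI[of _ f])
  show False
  proof (cases "K = 1")
    case True
    then have "gdist (R i) (bp i) (bm i) \<ge> 2"
      using distance_positive i by (simp add: distance_positive_def)
    moreover have "gdist (R i) (bp i) (bm i) \<le> 1"
      using adj plant_facts[OF i] by (intro gdist_le) auto
    ultimately show False by simp
  next
    case False
    define c where "c = (if edge_colour S i f = 0 then 1 else 0 :: nat)"
    have c: "c < K" "c \<noteq> edge_colour S i f"
      using False K_pos by (auto simp: c_def)
    have "(bp i, bm i) \<in> (\<Union>e\<in>{e \<in> arcs (R i). edge_colour S i e \<noteq> c}.
        {(tail (R i) e, head (R i) e), (head (R i) e, tail (R i) e)})"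
      using f c ends by (auto simp: doubleton_eq_iff intro!: bexI[of _ f])
    then show False
      using colour_cut[OF i c(1) refl] by blast
  qed
qed

lemma colour_occurs:
  assumes "i < K" "c < K"
  shows "\<exists>f\<in>arcs (R i). edge_colour S i f = c"
proof -
  interpret fin_graph "R i" using assms(1) by (rule rule_fin_graph)
  show ?thesis
    using exists_und_path[OF wf_digraph order_refl, of "bp i" "bm i"] plant_facts[OF assms(1)]
        connected_graphD[OF conn] path_uses_colour[OF assms(1) _ assms(2)] by blast
qed

section \<open>The iterates are finite, simple and connected\<close>

lemma verts_Xi_Suc: "verts (X j (Suc n)) = verts (X j n) \<union>
    {planted S j (X j n) e x | e x. e \<in> arcs (X j n) \<and> x \<in> verts (R (ecol j e))}"
  by (simp add: substitute_def)

lemma fin_digraph_Xi: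
  assumes j: "j < K"
  shows "fin_digraph (X j n)"
proof (induction n)
  case 0
  show ?case by unfold_locales auto
next
  case (Suc n)
  interpret fin_digraph "X j n" by fact
  have R: "fin_digraph (R (ecol j e))" if "e \<in> arcs (X j n)" for e
    using rule_fin_graph[OF col_less[OF j that]] by (simp add: fin_graph_def)
  show ?case
  proof (intro fin_digraph.intro wf_digraph.intro fin_digraph_axioms.intro)
    have "verts (X j (Suc n)) = verts (X j n) \<union>
        (\<Union>e\<in>arcs (X j n). planted S j (X j n) e ` verts (R (ecol j e)))"
      unfolding verts_Xi_Suc by auto
    then show "finite (verts (X j (Suc n)))"
      using R by (auto simp: fin_digraph_def fin_digraph_axioms_def)
    have "arcs (X j (Suc n)) = (\<Union>e\<in>arcs (X j n). (\<lambda>f. f # e) ` arcs (R (ecol j e)))"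
      unfolding arcs_Xi_Suc by auto
    then show "finite (arcs (X j (Suc n)))"
      using R by (auto simp: fin_digraph_def fin_digraph_axioms_def)
  next
    fix a assume "a \<in> arcs (X j (Suc n))"
    then obtain f e where "a = f # e" "e \<in> arcs (X j n)" "f \<in> arcs (R (ecol j e))"
      unfolding arcs_Xi_Suc by auto
    then show "tail (X j (Suc n)) a \<in> verts (X j (Suc n))" "head (X j (Suc n)) a \<in> verts (X j (Suc n))"
      using R[of e] unfolding verts_Xi_Suc
      by (auto simp: tail_Xi_Suc fin_digraph_def wf_digraph_def simp del: Xi_from.simps)
  qed
qed

lemma verts_mono: "p \<le> n \<Longrightarrow> verts (X j p) \<subseteq> verts (X j n)"
  by (rule lift_Suc_mono_le[of "\<lambda>n. verts (X j n)"]) (auto simp: verts_Xi_Suc simp del: Xi_from.simps)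

lemma Init_verts: "Init_plus \<in> verts (X j n)" "Init_minus \<in> verts (X j n)"
  using verts_mono[of 0 n j] by auto

text \<open>The address length tells when a vertex is born: \<open>Born e y\<close> is present
  exactly from level \<open>length e + 1\<close> on. This is what separates new vertices from old
  ones.\<close>

lemma Born_verts_iff:
  assumes j: "j < K"
  shows "Born e y \<in> verts (X j n) \<longleftrightarrow>
    length e < n \<and> e \<in> arcs (X j (length e)) \<and> y \<in> verts (R (ecol j e)) - {bp (ecol j e), bm (ecol j e)}"
proof (induction n)
  case (Suc n)
  interpret fin_digraph "X j n" using j by (rule fin_digraph_Xi)
  have "Born e y \<in> verts (X j (Suc n)) \<longleftrightarrow> Born e y \<in> verts (X j n) \<or>
     (e \<in> arcs (X j n) \<and> y \<in> verts (R (ecol j e)) - {bp (ecol j e), bm (ecol j e)})"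
    unfolding verts_Xi_Suc
  proof (intro iffI; elim UnE disjE)
    assume "Born e y \<in> {planted S j (X j n) e x | e x. e \<in> arcs (X j n) \<and> x \<in> verts (R (ecol j e))}"
    then obtain e' x where e': "Born e y = planted S j (X j n) e' x" "e' \<in> arcs (X j n)" "x \<in> verts (R (ecol j e'))"
      by blast
    then show "Born e y \<in> verts (X j n) \<or>
     (e \<in> arcs (X j n) \<and> y \<in> verts (R (ecol j e)) - {bp (ecol j e), bm (ecol j e)})"
      using wellformed[OF e'(2)] by (auto simp: planted_def split: if_splits)
  next
    assume "e \<in> arcs (X j n) \<and> y \<in> verts (R (ecol j e)) - {bp (ecol j e), bm (ecol j e)}"
    then have "Born e y = planted S j (X j n) e y" "e \<in> arcs (X j n)" "y \<in> verts (R (ecol j e))"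
      by (auto simp: planted_def)
    then show "Born e y \<in> verts (X j n) \<union>
        {planted S j (X j n) e x | e x. e \<in> arcs (X j n) \<and> x \<in> verts (R (ecol j e))}"
      by blast
  qed auto
  then show ?case
    unfolding Suc using length_arc[of e S j] by (auto simp: less_Suc_eq)
qed simp

lemma embed_verts:
  assumes j: "j < K" and g: "g \<in> arcs (X j p)" and w: "w \<in> verts (X (ecol j g) q)"
  shows "embed (X j p) g w \<in> verts (X j (q + p))"
proof -
  interpret fin_digraph "X j p" using j by (rule fin_digraph_Xi)
  show ?thesis
  proof (cases w)
    case (Born e y)
    have "e @ g \<in> arcs (X j (length e + p))"
      unfolding arcs_Xi_append using g w j col_less[OF j g] unfolding Born by (auto simp: Born_verts_iff)
    then show ?thesis
      using w j col_less[OF j g] length_arc[OF g] unfolding Born by (auto simp: Born_verts_iff xcolour_append)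
  qed (use wellformed[OF g] verts_mono[of p "q + p" j] in auto)
qed

lemma planted_inj:
  assumes j: "j < K" and e: "e \<in> arcs (X j n)" and "tail (X j n) e \<noteq> head (X j n) e"
    and "planted S j (X j n) e x = planted S j (X j n) e y"
  shows "x = y"
proof -
  interpret fin_digraph "X j n" using j by (rule fin_digraph_Xi)
  have "Born e z \<notin> verts (X j n)" for z
    using length_arc[OF e] j by (simp add: Born_verts_iff)
  then have "tail (X j n) e \<noteq> Born e z" "head (X j n) e \<noteq> Born e z" for z
    using wellformed[OF e] by metis+
  then show ?thesis
    using assms(3,4) by (auto simp: planted_def split: if_splits dest: sym)
qed

text \<open>Each new edge has an end that is not a planting vertex. This end carries the address of
  the replaced edge, so two edges with the same ends lie in the same copy, where planting is
  injective and the rule graph is simple.\<close>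

lemma simple_Xi:
  assumes j: "j < K"
  shows "simple_underlying (X j n)"
proof (induction n)
  case 0
  show ?case
    unfolding simple_underlying_def by (auto intro!: loopfree_digraph.intro wf_digraph.intro loopfree_digraph_axioms.intro)
next
  case (Suc n)
  interpret fin_digraph "X j n" using j by (rule fin_digraph_Xi)
  interpret S: fin_digraph "X j (Suc n)" using j by (rule fin_digraph_Xi)
  have nl: "tail (X j n) e \<noteq> head (X j n) e" if "e \<in> arcs (X j n)" for e
    using Suc that by (simp add: simple_underlying_def loopfree_digraph_def loopfree_digraph_axioms_def)
  have R: "fin_graph (R (ecol j e))" if "e \<in> arcs (X j n)" for e
    using rule_fin_graph[OF col_less[OF j that]] .
  have "loopfree_digraph (X j (Suc n))"
  proof (intro loopfree_digraph.intro loopfree_digraph_axioms.intro)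
    fix a assume "a \<in> arcs (X j (Suc n))"
    then obtain f e where a: "a = f # e" "e \<in> arcs (X j n)" "f \<in> arcs (R (ecol j e))"
      unfolding arcs_Xi_Suc by auto
    then show "tail (X j (Suc n)) a \<noteq> head (X j (Suc n)) a"
      using planted_inj[OF j a(2) nl[OF a(2)]] fin_graph.no_loop[OF R[OF a(2)] a(3)]
      by (auto simp: tail_Xi_Suc simp del: Xi_from.simps)
  qed unfold_locales
  moreover have "inj_on (\<lambda>a. {tail (X j (Suc n)) a, head (X j (Suc n)) a}) (arcs (X j (Suc n)))"
  proof (rule inj_onI)
    fix a a' assume "a \<in> arcs (X j (Suc n))" "a' \<in> arcs (X j (Suc n))"
      and eq: "{tail (X j (Suc n)) a, head (X j (Suc n)) a} = {tail (X j (Suc n)) a', head (X j (Suc n)) a'}"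
    then obtain f e f' e' where a: "a = f # e" "e \<in> arcs (X j n)" "f \<in> arcs (R (ecol j e))"
      and a': "a' = f' # e'" "e' \<in> arcs (X j n)" "f' \<in> arcs (R (ecol j e'))"
      unfolding arcs_Xi_Suc by blast
    let ?p = "planted S j (X j n) e" and ?p' = "planted S j (X j n) e'"
    let ?t = "tail (R (ecol j e)) f" and ?h = "head (R (ecol j e)) f"
    let ?t' = "tail (R (ecol j e')) f'" and ?h' = "head (R (ecol j e')) f'"
    have pp: "{?p ?t, ?p ?h} = {?p' ?t', ?p' ?h'}"
      using eq by (simp only: a a' tail_Xi_Suc)
    have "?t \<notin> {bp (ecol j e), bm (ecol j e)} \<or> ?h \<notin> {bp (ecol j e), bm (ecol j e)}"
      using no_direct_arc[OF col_less[OF j a(2)] a(3)] fin_graph.no_loop[OF R[OF a(2)] a(3)] by auto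
    then obtain x where x: "x \<in> {?t, ?h}" "x \<notin> {bp (ecol j e), bm (ecol j e)}"
      by blast
    then have "Born e x \<in> {?p' ?t', ?p' ?h'}"
      unfolding pp[symmetric] by (auto simp: planted_def)
    moreover have "Born e x \<notin> verts (X j n)"
      using length_arc[OF a(2)] j by (simp add: Born_verts_iff)
    then have "tail (X j n) e' \<noteq> Born e x" "head (X j n) e' \<noteq> Born e x"
      using wellformed[OF a'(2)] by metis+
    ultimately have "e' = e"
      by (auto simp: planted_def split: if_splits)
    then have "?p ` {?t, ?h} = ?p ` {?t', ?h'}"
      using pp by simp
    then have "{?t, ?h} = {?t', ?h'}"
      using planted_inj[OF j a(2) nl[OF a(2)]] by (subst (asm) inj_image_eq_iff) (auto intro: injI)
    then have "f = f'"
      using fin_graph.ends_inj[OF R[OF a(2)] a(3)] a'(3) \<open>e' = e\<close> by simp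
    then show "a = a'"
      using a a' \<open>e' = e\<close> by simp
  qed
  ultimately show ?case
    by (simp add: simple_underlying_def)
qed

lemma connected_Xi:
  assumes j: "j < K"
  shows "connected_graph (X j n)"
proof (induction n)
  case 0
  have "(Init_plus, Init_minus) \<in> adj (X j 0)" "(Init_minus, Init_plus) \<in> adj (X j 0)"
    by (auto simp: adj_def)
  then show ?case
    unfolding connected_graph_def by auto
next
  case (Suc n)
  interpret fin_digraph "X j n" using j by (rule fin_digraph_Xi)
  let ?r = "(adj (X j (Suc n)))\<^sup>*"
  have copy: "(planted S j (X j n) e x, planted S j (X j n) e y) \<in> ?r"
    if e: "e \<in> arcs (X j n)" and "x \<in> verts (R (ecol j e))" "y \<in> verts (R (ecol j e))" for e x y
  proof -
    have "(x, y) \<in> (adj (R (ecol j e)))\<^sup>*"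
      using that connected_graphD[OF fin_graph.conn[OF rule_fin_graph[OF col_less[OF j e]]]] by blast
    then show ?thesis
    proof induction
      case (step y z)
      from step(2) have "(planted S j (X j n) e y, planted S j (X j n) e z) \<in> adj (X j (Suc n))"
      proof (cases rule: adjE)
        case (1 f)
        then have "f # e \<in> arcs (X j (Suc n))"
          using e unfolding arcs_Xi_Suc by blast
        from adj_arc[OF this] show ?thesis
          using 1 by (simp add: tail_Xi_Suc del: Xi_from.simps)
      next
        case (2 f)
        then have "f # e \<in> arcs (X j (Suc n))"
          using e unfolding arcs_Xi_Suc by blast
        from adj_arc[OF this, THEN adj_sym] show ?thesis
          using 2 by (simp add: tail_Xi_Suc del: Xi_from.simps)
      qed
      then show ?case
        using step by (meson rtrancl.rtrancl_into_rtrancl)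
    qed simp
  qed
  have ends: "planted S j (X j n) e (bp (ecol j e)) = tail (X j n) e"
    "planted S j (X j n) e (bm (ecol j e)) = head (X j n) e" if "e \<in> arcs (X j n)" for e
    using plant_facts[OF col_less[OF j that]] by (auto simp: planted_def)
  have old: "(x, y) \<in> ?r" if "(x, y) \<in> (adj (X j n))\<^sup>*" for x y
    using that
  proof induction
    case (step y z)
    from step(2) have "(y, z) \<in> ?r"
    proof (cases rule: adjE)
      case (1 e)
      then show ?thesis
        using copy[of e "bp (ecol j e)" "bm (ecol j e)"] plant_facts[OF col_less[OF j 1(1)]] ends by simp
    next
      case (2 e)
      then show ?thesis
        using copy[of e "bm (ecol j e)" "bp (ecol j e)"] plant_facts[OF col_less[OF j 2(1)]] ends by simp
    qed
    then show ?case
      using step by (meson rtrancl_trans)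
  qed simp
  have root: "(Init_plus, x) \<in> ?r" if x: "x \<in> verts (X j (Suc n))" for x
  proof (cases "x \<in> verts (X j n)")
    case True
    then show ?thesis
      using old connected_graphD[OF Suc] Init_verts by blast
  next
    case False
    then obtain e y where e: "x = planted S j (X j n) e y" "e \<in> arcs (X j n)" "y \<in> verts (R (ecol j e))"
      using x unfolding verts_Xi_Suc by blast
    have "(Init_plus, tail (X j n) e) \<in> ?r"
      using old connected_graphD[OF Suc] Init_verts wellformed[OF e(2)] by blast
    moreover have "(tail (X j n) e, x) \<in> ?r"
      using copy[of e "bp (ecol j e)" y] e plant_facts[OF col_less[OF j e(2)]] ends by simp
    ultimately show ?thesis
      by (rule rtrancl_trans)
  qed
  show ?case
    unfolding connected_graph_def using root rtrancl_adj_sym by (metis rtrancl_trans)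
qed

lemma fin_graph_Xi: "j < K \<Longrightarrow> fin_graph (X j n)"
  using fin_digraph_Xi simple_Xi connected_Xi by (simp add: fin_graph_def fin_graph_axioms_def)

section \<open>Gluing functions and splitting sums over copies\<close>

lemma glue_level:
  assumes "j < K" "w \<in> verts (X j p)"
  shows "glue p a F w = a w"
  using assms by (cases w) (auto simp: glue_def Born_verts_iff)

lemma glue_embed:
  assumes "j < K" "g \<in> arcs (X j p)"
    and "F g Init_plus = a (tail (X j p) g)" "F g Init_minus = a (head (X j p) g)"
  shows "glue p a F (embed (X j p) g w) = F g w"
proof -
  interpret fin_digraph "X j p" using assms(1) by (rule fin_digraph_Xi)
  show ?thesis
    using assms wellformed[OF assms(2)] length_arc[OF assms(2)]
    by (cases w) (auto simp: glue_level, simp add: glue_def)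
qed

lemma sum_arcs_append:
  fixes F :: "'b list \<Rightarrow> 'c :: comm_monoid_add"
  assumes j: "j < K"
  shows "(\<Sum>l\<in>arcs (X j (q + p)). F l) = (\<Sum>g\<in>arcs (X j p). \<Sum>f\<in>arcs (X (ecol j g) q). F (f @ g))"
proof -
  let ?D = "Sigma (arcs (X j p)) (\<lambda>g. arcs (X (ecol j g) q))"
  have fin: "finite (arcs (X j p))" "\<And>g. g \<in> arcs (X j p) \<Longrightarrow> finite (arcs (X (ecol j g) q))"
    using fin_digraph_Xi j col_less by (auto simp: fin_digraph_def fin_digraph_axioms_def)
  have "(\<Sum>g\<in>arcs (X j p). \<Sum>f\<in>arcs (X (ecol j g) q). F (f @ g)) = (\<Sum>(g, f)\<in>?D. F (f @ g))"
    using fin by (intro sum.Sigma) auto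
  also have "\<dots> = (\<Sum>l\<in>arcs (X j (q + p)). F l)"
  proof (rule sum.reindex_cong[where l="\<lambda>(g, f). f @ g", symmetric])
    \<comment> \<open>Addresses of one level have equal length, so a concatenation splits in one way
      only.\<close>
    show "inj_on (\<lambda>(g, f). f @ g) ?D"
      by (rule inj_onI) (clarsimp, metis length_arc append_eq_append_conv)
    show "arcs (X j (q + p)) = (\<lambda>(g, f). f @ g) ` ?D"
      unfolding arcs_Xi_append by auto
  qed auto
  finally show ?thesis ..
qed

lemma energy_append:
  assumes "j < K"
  shows "unit_energy (X j (q + p)) f h =
    (\<Sum>g\<in>arcs (X j p). unit_energy (X (ecol j g) q) (\<lambda>w. f (embed (X j p) g w)) (\<lambda>w. h (embed (X j p) g w)))"
  unfolding energy_def sum_arcs_append[OF assms]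
  by (intro sum.cong refl) (simp add: ends_embed length_arc)

lemma mass_append:
  assumes "j < K"
  shows "mass (X j (q + p)) f = (\<Sum>g\<in>arcs (X j p). mass (X (ecol j g) q) (\<lambda>w. f (embed (X j p) g w)))"
  unfolding mass_def sum_arcs_append[OF assms]
  by (intro sum.cong refl) (simp add: ends_embed length_arc)

end


section \<open>Conductances of the iterates\<close>

lemma energy_affine: "energy G c (\<lambda>w. b + s * h w) k = s * energy G c h k"
  unfolding energy_def sum_distrib_left by (intro sum.cong refl) (simp add: algebra_simps)

context eigs_system
begin

definition pot :: "nat \<Rightarrow> nat \<Rightarrow> ('a, 'b) xvertex \<Rightarrow> real" where
  "pot j n = (SOME h. (\<forall>x. 0 \<le> h x \<and> h x \<le> 1) \<and> h Init_plus = 1 \<and> h Init_minus = 0 \<and>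
     (\<forall>g. unit_energy (X j n) h g = unit_energy (X j n) h h * (g Init_plus - g Init_minus)))"

text \<open>Effective conductance: \<open>pot\<close> has potential difference 1, so its energy is
  the total current.\<close>

definition cond :: "nat \<Rightarrow> nat \<Rightarrow> real" where
  "cond j n = unit_energy (X j n) (pot j n) (pot j n)"

lemma pot:
  assumes "j < K"
  shows pot_nonneg: "0 \<le> pot j n x" and pot_le_1: "pot j n x \<le> 1"
    and pot_plus: "pot j n Init_plus = 1" and pot_minus: "pot j n Init_minus = 0"
    and energy_pot: "unit_energy (X j n) (pot j n) g = cond j n * (g Init_plus - g Init_minus)"
proof -
  interpret fin_graph "X j n" using assms by (rule fin_graph_Xi)
  have "\<exists>h. (\<forall>x. 0 \<le> h x \<and> h x \<le> 1) \<and> h Init_plus = 1 \<and> h Init_minus = 0 \<and>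
     (\<forall>g. unit_energy (X j n) h g = unit_energy (X j n) h h * (g Init_plus - g Init_minus))"
    using exists_potential[of Init_plus Init_minus] Init_verts by simp
  from someI_ex[OF this] show "0 \<le> pot j n x" "pot j n x \<le> 1" "pot j n Init_plus = 1" "pot j n Init_minus = 0"
    "unit_energy (X j n) (pot j n) g = cond j n * (g Init_plus - g Init_minus)"
    unfolding pot_def cond_def by blast+
qed

text \<open>Subtract from \<open>f\<close> the multiple of \<open>pot\<close> with the same
  potential difference; the energy of the remainder is nonnegative and \<open>energy_pot\<close>
  evaluates the cross terms.\<close>

lemma dirichlet_principle:
  assumes "j < K"
  shows "cond j n * (f Init_plus - f Init_minus)\<^sup>2 \<le> unit_energy (X j n) f f"
proof -
  let ?s = "f Init_plus - f Init_minus"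
  let ?D = "\<lambda>w. f w - ?s * pot j n w"
  have D: "unit_energy (X j n) ?D g = unit_energy (X j n) f g - ?s * unit_energy (X j n) (pot j n) g" for g
    unfolding energy_def sum_distrib_left sum_subtractf[symmetric]
    by (intro sum.cong refl) (simp add: algebra_simps)
  have "0 \<le> unit_energy (X j n) ?D ?D"
    by (rule energy_nonneg) simp
  also have "\<dots> = unit_energy (X j n) ?D f - ?s * unit_energy (X j n) ?D (pot j n)"
    by (simp add: energy_diff energy_scale)
  also have "\<dots> = unit_energy (X j n) f f - ?s * unit_energy (X j n) (pot j n) f
      - ?s * (unit_energy (X j n) (pot j n) f - ?s * unit_energy (X j n) (pot j n) (pot j n))"
    unfolding D energy_commute[of "X j n" _ f "pot j n"] ..
  also have "\<dots> = unit_energy (X j n) f f - cond j n * ?s\<^sup>2"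
    by (simp add: energy_pot[OF assms] pot_plus[OF assms] pot_minus[OF assms] power2_eq_square algebra_simps)
  finally show ?thesis by simp
qed

lemma cond_pos:
  assumes "j < K"
  shows "0 < cond j n"
proof -
  interpret fin_graph "X j n" using assms by (rule fin_graph_Xi)
  have "\<not> (\<forall>e\<in>arcs (X j n). pot j n (tail (X j n) e) = pot j n (head (X j n) e))"
    using energy_zero_imp_const[of "pot j n" Init_plus Init_minus] Init_verts pot_plus pot_minus assms
    by auto
  then obtain e where e: "e \<in> arcs (X j n)" "pot j n (tail (X j n) e) \<noteq> pot j n (head (X j n) e)"
    by blast
  show ?thesis
    unfolding cond_def energy_def using e by (intro sum_pos2[of _ e]) (auto simp: zero_less_mult_iff)
qed

lemma arcs_nonempty: "j < K \<Longrightarrow> arcs (X j n) \<noteq> {}"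
  using cond_pos[of j n] by (auto simp: cond_def energy_def)

lemma eff_resistance_Xi:
  assumes "j < K"
  shows "eff_resistance (X j n) Init_plus Init_minus = 1 / cond j n"
proof -
  interpret fin_graph "X j n" using assms by (rule fin_graph_Xi)
  show ?thesis
    using cond_pos[OF assms] pot[OF assms] Init_verts
    by (intro eff_resistance_potential[of _ _ "pot j n"]) (auto simp: less_imp_neq[symmetric])
qed

text \<open>The harmonic extension of \<open>a\<close> from level \<open>p\<close> into the copies:
  in each copy the unit potential is rescaled to the two end values.\<close>

definition lift :: "nat \<Rightarrow> nat \<Rightarrow> nat \<Rightarrow> (('a, 'b) xvertex \<Rightarrow> real) \<Rightarrow> ('a, 'b) xvertex \<Rightarrow> real" where
  "lift j p q a = glue p a (\<lambda>g w. a (head (X j p) g) +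
     (a (tail (X j p) g) - a (head (X j p) g)) * pot (ecol j g) q w)"

lemma lift_level: "j < K \<Longrightarrow> w \<in> verts (X j p) \<Longrightarrow> lift j p q a w = a w"
  unfolding lift_def by (rule glue_level)

lemma lift_embed:
  assumes "j < K" "g \<in> arcs (X j p)"
  shows "lift j p q a (embed (X j p) g w) =
    a (head (X j p) g) + (a (tail (X j p) g) - a (head (X j p) g)) * pot (ecol j g) q w"
  unfolding lift_def
  by (subst glue_embed[OF assms]) (simp_all add: pot_plus pot_minus col_less[OF assms])

text \<open>In each copy the energy of the unit potential against \<open>f\<close> depends only on
  the end values of \<open>f\<close>. So the pairing is computed on level \<open>p\<close> for
  arbitrary \<open>f\<close>, in particular for an exit time that is not itself a lift.\<close>

lemma energy_lift:
  assumes j: "j < K"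
  shows "unit_energy (X j (q + p)) (lift j p q a) f = energy (X j p) (\<lambda>g. cond (ecol j g) q) a f"
  unfolding energy_append[OF j] energy_def[of "X j p"]
proof (intro sum.cong refl)
  fix g assume g: "g \<in> arcs (X j p)"
  show "unit_energy (X (ecol j g) q) (\<lambda>w. lift j p q a (embed (X j p) g w)) (\<lambda>w. f (embed (X j p) g w))
      = cond (ecol j g) q * (a (tail (X j p) g) - a (head (X j p) g)) * (f (tail (X j p) g) - f (head (X j p) g))"
    unfolding lift_embed[OF j g] energy_affine energy_pot[OF col_less[OF j g]] by simp
qed

lemma energy_lift_lift:
  assumes j: "j < K"
  shows "unit_energy (X j (q + p)) (lift j p q a) (lift j p q a) = energy (X j p) (\<lambda>g. cond (ecol j g) q) a a"
proof -
  interpret fin_digraph "X j p" using j by (rule fin_digraph_Xi)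
  show ?thesis
    unfolding energy_lift[OF j] unfolding energy_def
    using wellformed by (intro sum.cong refl) (simp add: lift_level[OF j])
qed

text \<open>The Dirichlet principle is applied twice to the potential of the whole iterate: inside
  every copy, and then to its restriction to level \<open>p\<close>.\<close>

lemma cond_append_ge:
  assumes j: "j < K" and m: "\<And>l. l < K \<Longrightarrow> m \<le> cond l q" "0 \<le> m"
  shows "m * cond j p \<le> cond j (q + p)"
proof -
  let ?h = "pot j (q + p)"
  have "m * cond j p \<le> m * unit_energy (X j p) ?h ?h"
    using dirichlet_principle[OF j, of p ?h] m(2) by (simp add: pot_plus[OF j] pot_minus[OF j] mult_left_mono)
  also have "\<dots> = (\<Sum>g\<in>arcs (X j p). m * (?h (tail (X j p) g) - ?h (head (X j p) g))\<^sup>2)"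
    by (simp add: energy_def sum_distrib_left power2_eq_square mult.assoc)
  also have "\<dots> \<le> (\<Sum>g\<in>arcs (X j p). unit_energy (X (ecol j g) q)
      (\<lambda>w. ?h (embed (X j p) g w)) (\<lambda>w. ?h (embed (X j p) g w)))"
  proof (rule sum_mono)
    fix g assume g: "g \<in> arcs (X j p)"
    have "m * (?h (tail (X j p) g) - ?h (head (X j p) g))\<^sup>2
        \<le> cond (ecol j g) q * (?h (tail (X j p) g) - ?h (head (X j p) g))\<^sup>2"
      using m(1)[OF col_less[OF j g]] by (rule mult_right_mono) simp
    also have "\<dots> \<le> unit_energy (X (ecol j g) q) (\<lambda>w. ?h (embed (X j p) g w)) (\<lambda>w. ?h (embed (X j p) g w))"
      using dirichlet_principle[OF col_less[OF j g], of q "\<lambda>w. ?h (embed (X j p) g w)"] by simp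
    finally show "m * (?h (tail (X j p) g) - ?h (head (X j p) g))\<^sup>2
        \<le> unit_energy (X (ecol j g) q) (\<lambda>w. ?h (embed (X j p) g w)) (\<lambda>w. ?h (embed (X j p) g w))" .
  qed
  also have "\<dots> = cond j (q + p)"
    unfolding cond_def energy_append[OF j] ..
  finally show ?thesis .
qed

lemma cond_append_le_energy:
  assumes j: "j < K" and a: "a Init_plus = 1" "a Init_minus = 0"
  shows "cond j (q + p) \<le> energy (X j p) (\<lambda>g. cond (ecol j g) q) a a"
  using dirichlet_principle[OF j, of "q + p" "lift j p q a"]
  by (simp add: energy_lift_lift[OF j] lift_level[OF j Init_verts(1)] lift_level[OF j Init_verts(2)] a)

lemma cond_append_le:
  assumes j: "j < K" and M: "\<And>l. l < K \<Longrightarrow> cond l q \<le> M"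
  shows "cond j (q + p) \<le> M * cond j p"
proof -
  have "cond j (q + p) \<le> energy (X j p) (\<lambda>g. cond (ecol j g) q) (pot j p) (pot j p)"
    by (rule cond_append_le_energy[OF j pot_plus[OF j] pot_minus[OF j]])
  also have "\<dots> \<le> (\<Sum>g\<in>arcs (X j p). M * ((pot j p (tail (X j p) g) - pot j p (head (X j p) g))
      * (pot j p (tail (X j p) g) - pot j p (head (X j p) g))))"
    unfolding energy_def mult.assoc using M col_less[OF j] by (intro sum_mono mult_right_mono) auto
  also have "\<dots> = M * cond j p"
    by (simp add: cond_def energy_def sum_distrib_left)
  finally show ?thesis .
qed

lemma sum_arcs_1:
  fixes F :: "'b list \<Rightarrow> 'c :: comm_monoid_add"
  shows "(\<Sum>l\<in>arcs (X j 1). F l) = (\<Sum>f\<in>arcs (R j). F [f])"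
proof (rule sum.reindex_cong[of "\<lambda>f. [f]"])
  show "arcs (X j 1) = (\<lambda>f. [f]) ` arcs (R j)"
    unfolding One_nat_def arcs_Xi_Suc by auto
qed (auto intro: inj_onI)

text \<open>The edges of colour \<open>l\<close> separate the planting vertices of each rule graph.\<close>

lemma cond_Suc_le:
  assumes j: "j < K" and l: "l < K"
  shows "cond j (Suc q) \<le> real (card (arcs (R j))) * cond l q"
proof -
  define B where "B = (\<Union>e\<in>{e \<in> arcs (R j). edge_colour S j e \<noteq> l}.
    {(tail (R j) e, head (R j) e), (head (R j) e, tail (R j) e)})"
  \<comment> \<open>What can be reached from the plus planting vertex without colour
    \<open>l\<close>. Only edges of colour \<open>l\<close> leave this set and the minus planting
    vertex lies outside, so its indicator is a competitor with energy at most
    \<open>cond l q\<close> per edge.\<close>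
  define C where "C = {x. (bp j, x) \<in> B\<^sup>*}"
  define a :: "('a, 'b) xvertex \<Rightarrow> real" where
    "a w = (case w of Init_plus \<Rightarrow> 1 | Init_minus \<Rightarrow> 0 | Born e x \<Rightarrow> of_bool (x \<in> C))" for w
  have "bp j \<in> C" "bm j \<notin> C"
    using colour_cut[OF j l B_def] by (auto simp: C_def)
  then have a_planted: "a (planted S j (X j 0) [] x) = of_bool (x \<in> C)" for x
    by (auto simp: planted_def a_def)
  have C_B: "x \<in> C \<longleftrightarrow> y \<in> C" if "(x, y) \<in> B" for x y
  proof -
    have "(y, x) \<in> B" using that by (auto simp: B_def)
    then show ?thesis
      using that unfolding C_def by (auto intro: rtrancl.rtrancl_into_rtrancl)
  qed
  have "cond j (q + 1) \<le> energy (X j 1) (\<lambda>g. cond (ecol j g) q) a a"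
    by (rule cond_append_le_energy[OF j]) (simp_all add: a_def)
  also have "\<dots> = (\<Sum>f\<in>arcs (R j). cond (edge_colour S j f) q *
      (of_bool (tail (R j) f \<in> C) - of_bool (head (R j) f \<in> C)) *
      (of_bool (tail (R j) f \<in> C) - of_bool (head (R j) f \<in> C)))"
    unfolding energy_def sum_arcs_1 unfolding One_nat_def tail_Xi_Suc xcolour.simps a_planted ..
  also have "\<dots> \<le> (\<Sum>f\<in>arcs (R j). cond l q)"
  proof (rule sum_mono)
    fix f assume f: "f \<in> arcs (R j)"
    show "cond (edge_colour S j f) q * (of_bool (tail (R j) f \<in> C) - of_bool (head (R j) f \<in> C)) *
      (of_bool (tail (R j) f \<in> C) - of_bool (head (R j) f \<in> C)) \<le> cond l q"
    proof (cases "edge_colour S j f = l")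
      case True
      then show ?thesis
        using cond_pos[OF l, of q] by (auto simp: of_bool_def)
    next
      case False
      then have "(tail (R j) f, head (R j) f) \<in> B"
        using f by (auto simp: B_def)
      then show ?thesis
        using cond_pos[OF l, of q] C_B by simp
    qed
  qed
  finally show ?thesis by simp
qed

definition rule_size :: real where
  "rule_size = real (Max ((\<lambda>i. card (arcs (R i))) ` {..<K}))"

lemma card_rule_le: "i < K \<Longrightarrow> real (card (arcs (R i))) \<le> rule_size"
  unfolding rule_size_def by simp

lemma rule_size_ge_1: "1 \<le> rule_size"
proof -
  interpret fin_graph "R 0" using K_pos by (rule rule_fin_graph)
  have "card (arcs (R 0)) \<noteq> 0"
    using colour_occurs[OF K_pos K_pos] by auto
  then show ?thesis
    using card_rule_le[OF K_pos] by linarith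
qed

text \<open>Let \<open>m\<close> be the smallest conductance of order \<open>q\<close>. Cutting
  along its colour bounds every conductance of order \<open>q + 1\<close> by
  \<open>rule_size * m\<close>, while \<open>cond_append_ge\<close> bounds it below by
  \<open>m\<close> times a conductance of order 1.\<close>

lemma cond_comparable:
  obtains \<kappa> where "1 \<le> \<kappa>" "\<And>n j l. j < K \<Longrightarrow> l < K \<Longrightarrow> cond j n \<le> \<kappa> * cond l n"
proof
  define c where "c = Min ((\<lambda>l. cond l 1) ` {..<K})"
  have c: "0 < c" "\<And>l. l < K \<Longrightarrow> c \<le> cond l 1"
    unfolding c_def using K_pos cond_pos by (subst Min_gr_iff) (auto simp: lessThan_empty_iff)
  \<comment> \<open>The maximum with 1 covers \<open>n = 0\<close>, where all conductances equal
    1.\<close>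
  let ?k = "max 1 (rule_size / c)"
  show "1 \<le> ?k" by simp
  fix n j l assume j: "j < K" and l: "l < K"
  show "cond j n \<le> ?k * cond l n"
  proof (cases n)
    case 0
    have "cond i 0 = 1" if "i < K" for i
      using energy_pot[OF that, of 0 "pot i 0"] pot_plus[OF that, of 0] pot_minus[OF that, of 0]
      by (simp add: cond_def energy_def)
    then show ?thesis
      using 0 j l by simp
  next
    case (Suc q)
    define m where "m = Min ((\<lambda>l. cond l q) ` {..<K})"
    have m: "0 < m" "\<And>l. l < K \<Longrightarrow> m \<le> cond l q"
      unfolding m_def using K_pos cond_pos by (subst Min_gr_iff) (auto simp: lessThan_empty_iff)
    have "m \<in> (\<lambda>l. cond l q) ` {..<K}"
      unfolding m_def using K_pos by (intro Min_in) (auto simp: lessThan_empty_iff)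
    then obtain i where i: "i < K" "m = cond i q" by auto
    have "cond j n \<le> rule_size * m"
      using cond_Suc_le[OF j i(1), of q] card_rule_le[OF j] cond_pos[OF i(1), of q]
      unfolding Suc i(2) by (meson less_imp_le mult_right_mono order_trans)
    also have "\<dots> = (rule_size / c) * (m * c)"
      using c by simp
    also have "\<dots> \<le> (rule_size / c) * cond l n"
    proof (rule mult_left_mono)
      have "m * c \<le> m * cond l 1"
        using c(2)[OF l] m(1) by simp
      also have "\<dots> \<le> cond l (q + 1)"
        using m by (intro cond_append_ge[OF l]) auto
      finally show "m * c \<le> cond l n"
        by (simp add: Suc)
    qed (use c rule_size_ge_1 in simp)
    also have "\<dots> \<le> ?k * cond l n"
      using cond_pos[OF l, of n] by (intro mult_right_mono) auto
    finally show ?thesis .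
  qed
qed

end

text \<open>A two-sided Fekete argument: \<open>b (m * n) / (m * n)\<close> is within
  \<open>c / n\<close> of \<open>b n / n\<close> and within \<open>c / m\<close> of
  \<open>b m / m\<close>, so the quotients form a Cauchy sequence.\<close>

lemma quasi_additive_convergent:
  fixes b :: "nat \<Rightarrow> real"
  assumes "\<And>m n. \<bar>b (m + n) - b m - b n\<bar> \<le> c"
  shows "convergent (\<lambda>n. b n / real n)"
proof -
  have c: "0 \<le> c"
    using assms[of 0 0] by linarith
  have mult: "\<bar>b (Suc k * n) - real (Suc k) * b n\<bar> \<le> real k * c" for k n
  proof (induction k)
    case (Suc k)
    have "\<bar>b (n + Suc k * n) - b n - b (Suc k * n)\<bar> \<le> c"
      by (rule assms)
    then show ?case
      using Suc by (simp add: algebra_simps)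
  qed simp
  have approx: "\<bar>b (m * n) / real (m * n) - b n / real n\<bar> \<le> c / real n" if "0 < m" "0 < n" for m n
  proof -
    obtain k where k: "m = Suc k" using \<open>0 < m\<close> by (cases m) auto
    have "\<bar>b (m * n) - real m * b n\<bar> \<le> real m * c"
      using mult[of k n] c unfolding k by (simp add: algebra_simps)
    moreover have "b (m * n) / real (m * n) - b n / real n = (b (m * n) - real m * b n) / (real m * real n)"
      using that by (simp add: field_simps)
    ultimately show ?thesis
      using that by (simp add: abs_mult divide_le_cancel field_simps)
  qed
  have "Cauchy (\<lambda>n. b n / real n)"
  proof (rule metric_CauchyI)
    fix e :: real assume e: "0 < e"
    obtain N :: nat where N: "2 * c / e < real N"
      using reals_Archimedean2 by blast
    have "0 \<le> 2 * c / e" using c e by simp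
    then have N0: "0 < N" using N by (cases N) auto
    show "\<exists>M. \<forall>m\<ge>M. \<forall>n\<ge>M. dist (b m / real m) (b n / real n) < e"
    proof (intro exI[of _ N] allI impI)
      fix m n assume mn: "N \<le> m" "N \<le> n"
      have small: "c / real k < e / 2" if "N \<le> k" for k
      proof -
        have "2 * c < e * real N"
          using N e by (simp add: field_simps)
        also have "\<dots> \<le> e * real k"
          using e that by simp
        finally have "2 * c < e * real k" .
        then show ?thesis
          using N0 that by (simp add: field_simps)
      qed
      have "\<bar>b (m * n) / real (m * n) - b n / real n\<bar> \<le> c / real n"
        "\<bar>b (m * n) / real (m * n) - b m / real m\<bar> \<le> c / real m"
        using approx[of m n] approx[of n m] mn N0 by (auto simp: mult.commute)
      then show "dist (b m / real m) (b n / real n) < e"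
        using small[OF mn(1)] small[OF mn(2)] unfolding dist_real_def by linarith
    qed
  qed
  then show ?thesis
    by (rule Cauchy_convergent)
qed

lemma mult_mat_vec_index:
  "A \<in> carrier_mat n n \<Longrightarrow> i < n \<Longrightarrow> (A *\<^sub>v vec n f) $ i = (\<Sum>l<n. A $$ (i, l) * f l)"
  by (auto simp: scalar_prod_def atLeast0LessThan intro!: sum.cong)

context eigs_system
begin

text \<open>Multiplicativity up to \<open>\<kappa>\<close> makes the logarithms additive up to
  \<open>ln \<kappa>\<close>. The rate stays an unspecified limit: it enters the walk dimension and
  the resistance dimension in the same way.\<close>

lemma cond_growth:
  assumes j: "j < K"
  shows "convergent (\<lambda>n. ln (cond j n) / real n)"
proof -
  obtain \<kappa> where \<kappa>: "1 \<le> \<kappa>" "\<And>n j l. j < K \<Longrightarrow> l < K \<Longrightarrow> cond j n \<le> \<kappa> * cond l n"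
    using cond_comparable by blast
  have "\<bar>ln (cond j (m + n)) - ln (cond j m) - ln (cond j n)\<bar> \<le> ln \<kappa>" for m n
  proof -
    have pos: "0 < cond j m" "0 < cond j n" "0 < cond j (m + n)"
      using cond_pos[OF j] by auto
    have "cond j (m + n) \<le> \<kappa> * cond j m * cond j n"
      using \<kappa>(2)[OF _ j] by (intro cond_append_le[OF j]) auto
    then have "ln (cond j (m + n)) \<le> ln (\<kappa> * cond j m * cond j n)"
      using pos \<kappa>(1) by (subst ln_le_cancel_iff) auto
    then have 1: "ln (cond j (m + n)) \<le> ln \<kappa> + ln (cond j m) + ln (cond j n)"
      using pos \<kappa>(1) by (simp add: ln_mult)
    have "cond j m / \<kappa> * cond j n \<le> cond j (m + n)"
      using \<kappa> pos j by (intro cond_append_ge[OF j]) (auto simp: field_simps)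
    then have "ln (cond j m / \<kappa> * cond j n) \<le> ln (cond j (m + n))"
      using pos \<kappa>(1) by (subst ln_le_cancel_iff) auto
    then have 2: "ln (cond j m) - ln \<kappa> + ln (cond j n) \<le> ln (cond j (m + n))"
      using pos \<kappa>(1) by (simp add: ln_mult ln_div)
    show ?thesis
      using 1 2 by linarith
  qed
  then show ?thesis
    by (rule quasi_additive_convergent)
qed


section \<open>Numbers of edges of the iterates\<close>

definition size_Xi :: "nat \<Rightarrow> nat \<Rightarrow> real" where
  "size_Xi j n = real (card (arcs (X j n)))"

lemma finite_arcs_Xi: "j < K \<Longrightarrow> finite (arcs (X j n))"
  using fin_digraph_Xi by (simp add: fin_digraph_def fin_digraph_axioms_def)

lemma size_Xi_ge_1: "j < K \<Longrightarrow> 1 \<le> size_Xi j n"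
  using arcs_nonempty finite_arcs_Xi by (simp add: size_Xi_def Suc_le_eq card_gt_0_iff)

lemma size_Xi_append:
  assumes "j < K"
  shows "size_Xi j (q + p) = (\<Sum>g\<in>arcs (X j p). size_Xi (ecol j g) q)"
  using sum_arcs_append[OF assms, of "\<lambda>_. 1 :: real" q p] by (simp add: size_Xi_def)

lemma size_Xi_Suc: "j < K \<Longrightarrow> size_Xi j (Suc q) = (\<Sum>f\<in>arcs (R j). size_Xi (edge_colour S j f) q)"
  using size_Xi_append[of j q 1] sum_arcs_1[of "\<lambda>g. size_Xi (ecol j g) q" j]
  by (simp del: Xi_from.simps)

text \<open>Every colour occurs in every rule graph. For \<open>n > 0\<close> the iterate of colour
  \<open>l\<close> thus contains copies of all iterates of order \<open>n - 1\<close>, and the one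
  of colour \<open>j\<close> is made of at most \<open>rule_size\<close> of them.\<close>

lemma size_Xi_comparable:
  assumes j: "j < K" and l: "l < K"
  shows "size_Xi j n \<le> rule_size * size_Xi l n"
proof (cases n)
  case 0
  then show ?thesis
    using rule_size_ge_1 by (simp add: size_Xi_def)
next
  case (Suc q)
  have le: "size_Xi i q \<le> size_Xi l n" if i: "i < K" for i
  proof -
    interpret fin_graph "R l" using l by (rule rule_fin_graph)
    obtain f where f: "f \<in> arcs (R l)" "edge_colour S l f = i"
      using colour_occurs[OF l i] by blast
    have "size_Xi (edge_colour S l f) q \<le> size_Xi l n"
      unfolding Suc size_Xi_Suc[OF l] using f(1)
      by (intro member_le_sum) (auto simp: size_Xi_def)
    then show ?thesis by (simp add: f)
  qed
  have "size_Xi j n \<le> (\<Sum>f\<in>arcs (R j). size_Xi l n)"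
    unfolding Suc size_Xi_Suc[OF j] using le edge_colour_less[OF j] unfolding Suc by (intro sum_mono) auto
  also have "\<dots> = real (card (arcs (R j))) * size_Xi l n"
    by simp
  also have "\<dots> \<le> rule_size * size_Xi l n"
    using card_rule_le[OF j] by (intro mult_right_mono) (auto simp: size_Xi_def)
  finally show ?thesis .
qed

definition mass_mat :: "complex mat" where
  "mass_mat = map_mat of_nat (mass_matrix S)"

lemma mass_mat_carrier: "mass_mat \<in> carrier_mat K K"
  by (simp add: mass_mat_def mass_matrix_def)

lemma size_Xi_Suc_mass:
  assumes j: "j < K"
  shows "complex_of_real (size_Xi j (Suc q)) = (\<Sum>l<K. mass_mat $$ (j, l) * complex_of_real (size_Xi l q))"
proof -
  interpret fin_graph "R j" using j by (rule rule_fin_graph)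
  have "size_Xi j (Suc q) = (\<Sum>l<K. \<Sum>f\<in>{f \<in> arcs (R j). edge_colour S j f = l}. size_Xi (edge_colour S j f) q)"
    unfolding size_Xi_Suc[OF j] using edge_colour_less[OF j] by (subst sum.group) auto
  also have "\<dots> = (\<Sum>l<K. real (card {f \<in> arcs (R j). edge_colour S j f = l}) * size_Xi l q)"
    by (intro sum.cong refl) simp
  finally show ?thesis
    using j by (simp add: mass_mat_def mass_matrix_def)
qed

text \<open>Take an eigenvector \<open>v\<close> for an eigenvalue \<open>z\<close> of maximal
  modulus. The mass matrix is nonnegative and the row sums of its powers are the edge counts, so the
  modulus of \<open>z ^ n * v $ j\<close> is at most \<open>V\<close> times a count. This is used at
  one index with a nonzero entry, and comparability of the counts carries it to all colours.\<close>

lemma size_Xi_ge: "\<exists>c>0. \<forall>j<K. \<forall>n. c * nat_spectral_radius (mass_matrix S) ^ n \<le> size_Xi j n"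
proof -
  define \<rho> where "\<rho> = nat_spectral_radius (mass_matrix S)"
  have "\<rho> \<in> norm ` spectrum mass_mat"
    unfolding \<rho>_def nat_spectral_radius_def mass_mat_def[symmetric]
    using spectral_radius_mem_max(1)[OF mass_mat_carrier K_pos] .
  then obtain z where z: "\<rho> = norm z" "eigenvalue mass_mat z"
    by (auto simp: spectrum_def)
  then obtain v where v: "v \<in> carrier_vec K" "v \<noteq> 0\<^sub>v K" "mass_mat *\<^sub>v v = z \<cdot>\<^sub>v v"
    using mass_mat_carrier unfolding eigenvalue_def eigenvector_def by auto
  obtain i where i: "i < K" "v $ i \<noteq> 0"
  proof -
    have "\<exists>i<K. v $ i \<noteq> 0"
    proof (rule ccontr)
      assume "\<not> ?thesis"
      then have "v = 0\<^sub>v K" using v(1) by (intro eq_vecI) auto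
      then show False using v(2) by simp
    qed
    then show ?thesis using that by blast
  qed
  define V where "V = Max ((\<lambda>l. norm (v $ l)) ` {..<K})"
  have V: "norm (v $ l) \<le> V" if "l < K" for l
    unfolding V_def using that by simp
  have V0: "0 < V"
    using less_le_trans[OF _ V[OF i(1)]] i(2) by simp
  have row: "z * v $ j = (\<Sum>l<K. mass_mat $$ (j, l) * v $ l)" if "j < K" for j
  proof -
    have "(mass_mat *\<^sub>v v) $ j = (\<Sum>l<K. mass_mat $$ (j, l) * v $ l)"
      using that v(1) mass_mat_carrier
      by (auto simp: scalar_prod_def atLeast0LessThan intro!: sum.cong)
    then show ?thesis
      using that v by simp
  qed
  have growth: "norm (z ^ n * v $ j) \<le> size_Xi j n * V" if "j < K" for j n
    using that
  proof (induction n arbitrary: j)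
    case 0
    then show ?case using V by (simp add: size_Xi_def)
  next
    case (Suc n)
    have "norm (z ^ Suc n * v $ j) = norm (\<Sum>l<K. mass_mat $$ (j, l) * (z ^ n * v $ l))"
    proof -
      have "z ^ Suc n * v $ j = z ^ n * (z * v $ j)"
        by simp
      also have "\<dots> = (\<Sum>l<K. mass_mat $$ (j, l) * (z ^ n * v $ l))"
        unfolding row[OF Suc.prems] sum_distrib_left by (intro sum.cong refl) simp
      finally show ?thesis by simp
    qed
    also have "\<dots> \<le> (\<Sum>l<K. norm (mass_mat $$ (j, l)) * (size_Xi l n * V))"
      using Suc.IH by (intro sum_norm_le) (auto simp: norm_mult intro!: mult_left_mono)
    also have "\<dots> = (\<Sum>l<K. Re (mass_mat $$ (j, l)) * size_Xi l n) * V"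
      unfolding sum_distrib_right using Suc.prems
      by (intro sum.cong refl) (simp add: mass_mat_def mass_matrix_def)
    also have "(\<Sum>l<K. Re (mass_mat $$ (j, l)) * size_Xi l n) = size_Xi j (Suc n)"
      using arg_cong[OF size_Xi_Suc_mass[OF Suc.prems, of n], of Re] by simp
    finally show ?case .
  qed
  show ?thesis
  proof (intro exI[of _ "norm (v $ i) / (V * rule_size)"] conjI allI impI)
    show "0 < norm (v $ i) / (V * rule_size)"
      using i V0 rule_size_ge_1 by simp
    fix j n assume j: "j < K"
    have "norm (v $ i) * \<rho> ^ n \<le> size_Xi i n * V"
      using growth[OF i(1), of n] by (simp add: norm_mult norm_power z mult.commute)
    also have "\<dots> \<le> rule_size * size_Xi j n * V"
      using size_Xi_comparable[OF i(1) j, of n] V0 by simp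
    finally show "norm (v $ i) / (V * rule_size) * nat_spectral_radius (mass_matrix S) ^ n \<le> size_Xi j n"
      using V0 rule_size_ge_1 unfolding \<rho>_def[symmetric] by (simp add: field_simps)
  qed
qed

text \<open>Dividing the mass matrix by \<open>t\<close> brings the spectral radius below 1, so the
  powers stay bounded. The gap between \<open>t\<close> and the spectral radius absorbs polynomial
  factors from Jordan blocks and is harmless for exponential rates.\<close>

lemma size_Xi_le:
  assumes t: "nat_spectral_radius (mass_matrix S) < t" "0 < t"
  shows "\<exists>C>0. \<forall>j<K. \<forall>n. size_Xi j n \<le> C * t ^ n"
proof -
  let ?t = "complex_of_real t"
  define B where "B = (1 / ?t) \<cdot>\<^sub>m mass_mat"
  have B: "B \<in> carrier_mat K K"
    using mass_mat_carrier by (simp add: B_def)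
  have "spectral_radius B < 1"
  proof -
    obtain z where z: "spectral_radius B = norm z" "eigenvalue B z"
      using spectral_radius_mem_max(1)[OF B K_pos] by (auto simp: spectrum_def)
    then obtain v where v: "v \<in> carrier_vec K" "v \<noteq> 0\<^sub>v K" "B *\<^sub>v v = z \<cdot>\<^sub>v v"
      using B unfolding eigenvalue_def eigenvector_def by auto
    have "mass_mat *\<^sub>v v = (?t * z) \<cdot>\<^sub>v v"
    proof -
      have "mass_mat *\<^sub>v v = ?t \<cdot>\<^sub>v (B *\<^sub>v v)"
        using t(2) mass_mat_carrier v(1)
        by (intro eq_vecI) (auto simp: B_def scalar_prod_def sum_distrib_left)
      then show ?thesis
        by (simp add: v(3) smult_smult_assoc)
    qed
    then have "norm (?t * z) \<in> norm ` spectrum mass_mat"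
      using v mass_mat_carrier unfolding spectrum_def eigenvalue_def eigenvector_def by auto
    from spectral_radius_mem_max(2)[OF mass_mat_carrier K_pos this]
    have "t * norm z \<le> spectral_radius mass_mat"
      using t(2) by (simp add: norm_mult)
    then have "t * norm z < t * 1"
      using t(1) unfolding nat_spectral_radius_def mass_mat_def by linarith
    then show ?thesis
      using t(2) z(1) by (simp only: mult_less_cancel_left_pos)
  qed
  then obtain c where c: "\<And>k. norm_bound (B ^\<^sub>m k) c"
    using spectral_radius_jnf_norm_bound_less_1_upper_triangular[OF B] by blast
  \<comment> \<open>\<open>e 0\<close> is the all-ones vector, so applying matrix powers to it gives
    row sums.\<close>
  define e where "e k = vec K (\<lambda>i. complex_of_real (size_Xi i k))" for k
  have step: "B *\<^sub>v e k = (1 / ?t) \<cdot>\<^sub>v e (Suc k)" for k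
  proof (rule eq_vecI)
    fix i assume "i < dim_vec ((1 / ?t) \<cdot>\<^sub>v e (Suc k))"
    then have i: "i < K" by (simp add: e_def)
    have "(B *\<^sub>v e k) $ i = (\<Sum>l<K. 1 / ?t * (mass_mat $$ (i, l) * complex_of_real (size_Xi l k)))"
      unfolding e_def mult_mat_vec_index[OF B i] using i mass_mat_carrier
      by (intro sum.cong refl) (simp add: B_def)
    also have "\<dots> = 1 / ?t * complex_of_real (size_Xi i (Suc k))"
      unfolding size_Xi_Suc_mass[OF i] sum_distrib_left ..
    finally show "(B *\<^sub>v e k) $ i = ((1 / ?t) \<cdot>\<^sub>v e (Suc k)) $ i"
      using i by (simp add: e_def)
  qed (use B in \<open>simp add: e_def\<close>)
  have e: "e k \<in> carrier_vec K" for k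
    by (simp add: e_def)
  have pow: "(B ^\<^sub>m k) *\<^sub>v e m = (1 / ?t) ^ k \<cdot>\<^sub>v e (m + k)" for k m
  proof (induction k arbitrary: m)
    case 0
    then show ?case using B e[of m] by simp
  next
    case (Suc k)
    have Bk: "B ^\<^sub>m k \<in> carrier_mat K K" using B by simp
    have "(B ^\<^sub>m Suc k) *\<^sub>v e m = (B ^\<^sub>m k) *\<^sub>v (B *\<^sub>v e m)"
      by (simp add: assoc_mult_mat_vec[OF Bk B e])
    also have "\<dots> = (1 / ?t) \<cdot>\<^sub>v ((B ^\<^sub>m k) *\<^sub>v e (Suc m))"
      unfolding step using mult_mat_vec[OF Bk e] by simp
    also have "\<dots> = (1 / ?t) ^ Suc k \<cdot>\<^sub>v e (m + Suc k)"
      unfolding Suc by (simp add: smult_smult_assoc)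
    finally show ?case .
  qed
  have bound: "size_Xi j n \<le> (real K * \<bar>c\<bar> + 1) * t ^ n" if j: "j < K" for j n
  proof -
    have Bn: "B ^\<^sub>m n \<in> carrier_mat K K" using B by simp
    have "(1 / ?t) ^ n * complex_of_real (size_Xi j n) = ((B ^\<^sub>m n) *\<^sub>v e 0) $ j"
      unfolding pow using j by (simp add: e_def)
    also have "\<dots> = (\<Sum>l<K. (B ^\<^sub>m n) $$ (j, l))"
      unfolding e_def mult_mat_vec_index[OF Bn j] by (simp add: size_Xi_def)
    finally have "norm ((1 / ?t) ^ n * complex_of_real (size_Xi j n)) = norm (\<Sum>l<K. (B ^\<^sub>m n) $$ (j, l))"
      by simp
    also have "\<dots> \<le> (\<Sum>l<K. \<bar>c\<bar>)"
    proof (rule sum_norm_le)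
      fix l assume "l \<in> {..<K}"
      then have "norm ((B ^\<^sub>m n) $$ (j, l)) \<le> c"
        using c[of n] j carrier_matD[OF Bn] unfolding norm_bound_def by (metis lessThan_iff)
      then show "norm ((B ^\<^sub>m n) $$ (j, l)) \<le> \<bar>c\<bar>" by simp
    qed
    also have "\<dots> \<le> real K * \<bar>c\<bar> + 1"
      by simp
    finally have "norm ((1 / ?t) ^ n * complex_of_real (size_Xi j n)) \<le> real K * \<bar>c\<bar> + 1" .
    moreover have "norm ((1 / ?t) ^ n * complex_of_real (size_Xi j n)) = size_Xi j n / t ^ n"
      using t(2) size_Xi_ge_1[OF j, of n] by (simp add: norm_mult norm_power norm_divide power_divide)
    ultimately show ?thesis
      using t(2) by (simp add: pos_divide_le_eq)
  qed
  show ?thesis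
    using bound by (intro exI[of _ "real K * \<bar>c\<bar> + 1"] conjI) (simp_all add: add_nonneg_pos)
qed

text \<open>Otherwise the edge counts would tend to 0, although every iterate has an edge.\<close>

lemma spectral_radius_mass_ge_1: "1 \<le> nat_spectral_radius (mass_matrix S)"
proof (rule ccontr)
  assume less: "\<not> ?thesis"
  define \<rho> where "\<rho> = max 0 (nat_spectral_radius (mass_matrix S))"
  have "\<rho> < 1" using less by (simp add: \<rho>_def)
  then obtain t where t: "\<rho> < t" "t < 1" using dense by blast
  then have "nat_spectral_radius (mass_matrix S) < t" "0 < t"
    by (auto simp: \<rho>_def)
  then obtain C where C: "0 < C" "\<And>j n. j < K \<Longrightarrow> size_Xi j n \<le> C * t ^ n"
    using size_Xi_le by blast
  have "(\<lambda>n. C * t ^ n) \<longlonglongrightarrow> C * 0"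
    using t \<open>0 < t\<close> by (intro tendsto_mult_left LIMSEQ_power_zero) simp
  moreover have "\<exists>N. \<forall>n\<ge>N. 1 \<le> C * t ^ n"
    using C(2)[OF K_pos] size_Xi_ge_1[OF K_pos] order_trans by blast
  ultimately show False
    using LIMSEQ_le_const by force
qed

lemma size_Xi_growth:
  assumes j: "j < K"
  shows "(\<lambda>n. ln (size_Xi j n) / real n) \<longlonglongrightarrow> ln (nat_spectral_radius (mass_matrix S))"
proof -
  define \<rho> where "\<rho> = nat_spectral_radius (mass_matrix S)"
  have \<rho>: "1 \<le> \<rho>"
    unfolding \<rho>_def by (rule spectral_radius_mass_ge_1)
  obtain c where c: "0 < c" "\<And>n. c * \<rho> ^ n \<le> size_Xi j n"
    using size_Xi_ge j unfolding \<rho>_def by blast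
  have const: "(\<lambda>n. ln a / real n + b) \<longlonglongrightarrow> 0 + b" for a b :: real
    by (intro tendsto_add tendsto_const lim_const_over_n)
  have pos: "0 < size_Xi j n" for n
    using size_Xi_ge_1[OF j, of n] by linarith
  show ?thesis
    unfolding \<rho>_def[symmetric]
  proof (rule order_tendstoI)
    fix a assume a: "a < ln \<rho>"
    have "\<forall>\<^sub>F n in sequentially. a < ln c / real n + ln \<rho>"
      using order_tendstoD(1)[OF const[of c "ln \<rho>"], of a] a by simp
    then show "\<forall>\<^sub>F n in sequentially. a < ln (size_Xi j n) / real n"
      using eventually_gt_at_top[of 0]
    proof eventually_elim
      case (elim n)
      have "ln (c * \<rho> ^ n) \<le> ln (size_Xi j n)"
        using c \<rho> pos[of n] by (subst ln_le_cancel_iff) auto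
      then have "ln c + real n * ln \<rho> \<le> ln (size_Xi j n)"
        using c \<rho> by (simp add: ln_mult ln_realpow)
      then have "(ln c + real n * ln \<rho>) / real n \<le> ln (size_Xi j n) / real n"
        by (rule divide_right_mono) simp
      then have "ln c / real n + ln \<rho> \<le> ln (size_Xi j n) / real n"
        using elim by (simp add: add_divide_distrib)
      then show ?case using elim by linarith
    qed
  next
    fix a assume a: "ln \<rho> < a"
    \<comment> \<open>A point strictly between the spectral radius and \<open>exp a\<close>, by
      averaging on the logarithmic scale.\<close>
    define t where "t = exp ((ln \<rho> + a) / 2)"
    have t: "\<rho> < t" "0 < t" "ln t < a"
    proof -
      have "\<rho> = exp (ln \<rho>)" using \<rho> by simp
      also have "\<dots> < t" unfolding t_def using a by simp
      finally show "\<rho> < t" .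
      show "0 < t" "ln t < a" unfolding t_def using a by simp_all
    qed
    obtain C where C: "0 < C" "\<And>n. size_Xi j n \<le> C * t ^ n"
      using size_Xi_le[OF t(1)[unfolded \<rho>_def] t(2)] j by blast
    have "\<forall>\<^sub>F n in sequentially. ln C / real n + ln t < a"
      using order_tendstoD(2)[OF const[of C "ln t"], of a] t by simp
    then show "\<forall>\<^sub>F n in sequentially. ln (size_Xi j n) / real n < a"
      using eventually_gt_at_top[of 0]
    proof eventually_elim
      case (elim n)
      have "ln (size_Xi j n) \<le> ln (C * t ^ n)"
        using C t pos[of n] by (subst ln_le_cancel_iff) auto
      then have "ln (size_Xi j n) \<le> ln C + real n * ln t"
        using C t by (simp add: ln_mult ln_realpow)
      then have "ln (size_Xi j n) / real n \<le> (ln C + real n * ln t) / real n"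
        by (rule divide_right_mono) simp
      then have "ln (size_Xi j n) / real n \<le> ln C / real n + ln t"
        using elim by (simp add: add_divide_distrib)
      then show ?case using elim by linarith
    qed
  qed
qed

end


section \<open>Distances and exit times in the iterates\<close>

lemma gdist_triangle:
  assumes "connected_graph G" "u \<in> verts G" "v \<in> verts G" "w \<in> verts G"
  shows "gdist G u w \<le> gdist G u v + gdist G v w"
proof (rule gdist_le)
  have "(u, v) \<in> adj G ^^ gdist G u v" "(v, w) \<in> adj G ^^ gdist G v w"
    using assms by (simp_all add: relpow_gdist connected_graphD)
  then show "(u, w) \<in> adj G ^^ (gdist G u v + gdist G v w)"
    unfolding relpow_add by blast
qed fact

declare Xi_from.simps(2) [simp del]

context eigs_system
begin

section \<open>Distances across copies\<close>

lemma verts_cases: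
  assumes j: "j < K" and x: "x \<in> verts (X j (q + p))"
  obtains "x \<in> verts (X j p)"
  | g w where "g \<in> arcs (X j p)" "w \<in> verts (X (ecol j g) q)" "x = embed (X j p) g w"
proof (cases x)
  case (Born l y)
  have l: "length l < q + p" "l \<in> arcs (X j (length l))" "y \<in> verts (R (ecol j l)) - {bp (ecol j l), bm (ecol j l)}"
    using x j unfolding Born by (auto simp: Born_verts_iff)
  show ?thesis
  proof (cases "length l < p")
    case True
    then have "x \<in> verts (X j p)"
      using l j unfolding Born by (simp add: Born_verts_iff)
    then show ?thesis by (rule that(1))
  next
    case False
    then obtain k where k: "length l = k + p"
      by (metis add.commute le_Suc_ex not_less)
    then obtain f g where fg: "l = f @ g" "g \<in> arcs (X j p)" "f \<in> arcs (X (ecol j g) k)"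
      using l(2) unfolding k arcs_Xi_append by blast
    have "Born f y \<in> verts (X (ecol j g) q)"
      using l k fg length_arc[OF fg(3)] by (simp add: Born_verts_iff col_less[OF j fg(2)] xcolour_append)
    then show ?thesis
      using that(2)[OF fg(2)] Born fg(1) by simp
  qed
qed (use Init_verts that in auto)

lemma adj_embed:
  assumes j: "j < K" and g: "g \<in> arcs (X j p)" and "(x, y) \<in> adj (X (ecol j g) q)"
  shows "(embed (X j p) g x, embed (X j p) g y) \<in> adj (X j (q + p))"
proof -
  have "(embed (X j p) g (tail (X (ecol j g) q) f), embed (X j p) g (head (X (ecol j g) q) f)) \<in> adj (X j (q + p))"
    if "f \<in> arcs (X (ecol j g) q)" for f
  proof -
    have "f @ g \<in> arcs (X j (q + p))"
      unfolding arcs_Xi_append using g that by blast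
    from adj_arc[OF this] show ?thesis
      by (simp add: ends_embed[OF length_arc[OF that]])
  qed
  then show ?thesis
    using assms(3) by (auto elim!: adjE intro: adj_sym)
qed

lemma gdist_embed_le:
  assumes j: "j < K" and g: "g \<in> arcs (X j p)"
    and x: "x \<in> verts (X (ecol j g) q)" and y: "y \<in> verts (X (ecol j g) q)"
  shows "gdist (X j (q + p)) (embed (X j p) g x) (embed (X j p) g y) \<le> gdiam (X (ecol j g) q)"
proof -
  have "(embed (X j p) g u, embed (X j p) g y) \<in> adj (X j (q + p)) ^^ l"
    if "(u, y) \<in> adj (X (ecol j g) q) ^^ l" for u l
    using that
  proof (induction l arbitrary: u)
    case (Suc l)
    then obtain w where "(u, w) \<in> adj (X (ecol j g) q)" "(w, y) \<in> adj (X (ecol j g) q) ^^ l"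
      by (meson relpow_Suc_D2)
    then show ?case
      using Suc.IH adj_embed[OF j g] by (meson relpow_Suc_I2)
  qed simp
  moreover have "(x, y) \<in> adj (X (ecol j g) q) ^^ gdist (X (ecol j g) q) x y"
    using connected_graphD[OF connected_Xi[OF col_less[OF j g]] x y] x by (intro relpow_gdist)
  ultimately have "gdist (X j (q + p)) (embed (X j p) g x) (embed (X j p) g y) \<le> gdist (X (ecol j g) q) x y"
    using embed_verts[OF j g x] by (intro gdist_le) auto
  also have "\<dots> \<le> gdiam (X (ecol j g) q)"
    using fin_digraph_Xi[OF col_less[OF j g]] x y
    by (intro gdist_le_gdiam) (auto simp: fin_digraph_def fin_digraph_axioms_def)
  finally show ?thesis .
qed

text \<open>A 1-Lipschitz function separates \<open>w\<close> from \<open>v\<close>: inside the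
  copies at \<open>v\<close> the distance to \<open>v\<close>, truncated at \<open>D\<close>, and
  the constant \<open>D\<close> elsewhere. Crossing any copy costs at least \<open>D\<close>, so the
  pieces agree at the vertices of level \<open>p\<close>.\<close>

lemma gdist_level_ge:
  assumes j: "j < K" and v: "v \<in> verts (X j p)" and w: "w \<in> verts (X j p)" "w \<noteq> v"
    and D: "\<And>l. l < K \<Longrightarrow> D \<le> real (gdist (X l q) Init_plus Init_minus)" "0 \<le> D"
  shows "D \<le> real (gdist (X j (q + p)) w v)"
proof -
  interpret P: fin_graph "X j p" using j by (rule fin_graph_Xi)
  define a where "a x = (if x = v then 0 else D)" for x
  define F where "F g x = (if tail (X j p) g = v then min D (real (gdist (X (ecol j g) q) x Init_plus))
      else if head (X j p) g = v then min D (real (gdist (X (ecol j g) q) x Init_minus)) else D)" for g x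
  have F_ends: "F g Init_plus = a (tail (X j p) g)" "F g Init_minus = a (head (X j p) g)"
    if g: "g \<in> arcs (X j p)" for g
  proof -
    have "gdist (X (ecol j g) q) Init_minus Init_plus = gdist (X (ecol j g) q) Init_plus Init_minus"
      using Init_verts by (rule gdist_sym[rotated])
    then show "F g Init_plus = a (tail (X j p) g)" "F g Init_minus = a (head (X j p) g)"
      using P.no_loop[OF g] D(1)[OF col_less[OF j g]] D(2) Init_verts
      by (auto simp: F_def a_def gdist_self)
  qed
  let ?\<phi> = "glue p a F"
  have lip: "\<bar>?\<phi> (tail (X j (q + p)) e) - ?\<phi> (head (X j (q + p)) e)\<bar> \<le> 1" if e: "e \<in> arcs (X j (q + p))" for e
  proof -
    obtain f g where fg: "e = f @ g" "g \<in> arcs (X j p)" "f \<in> arcs (X (ecol j g) q)"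
      using e unfolding arcs_Xi_append by blast
    let ?t = "tail (X (ecol j g) q) f" and ?h = "head (X (ecol j g) q) f"
    have ends: "?\<phi> (tail (X j (q + p)) e) = F g ?t" "?\<phi> (head (X j (q + p)) e) = F g ?h"
      using length_arc[OF fg(3)] by (simp_all add: fg(1) ends_embed glue_embed[where F=F and a=a, OF j fg(2) F_ends[OF fg(2)]])
    have L: "\<bar>real (gdist (X (ecol j g) q) ?t z) - real (gdist (X (ecol j g) q) ?h z)\<bar> \<le> 1"
      if "z \<in> verts (X (ecol j g) q)" for z
      using fin_digraph_Xi[OF col_less[OF j fg(2)], of q] connected_Xi[OF col_less[OF j fg(2)]] that fg(3)
      by (intro gdist_lipschitz) (auto simp: fin_digraph_def)
    show ?thesis
      unfolding ends using L[OF Init_verts(1)] L[OF Init_verts(2)] by (auto simp: F_def)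
  qed
  have "\<bar>?\<phi> w - ?\<phi> v\<bar> \<le> real (gdist (X j (q + p)) w v)"
    using v w verts_mono[of p "q + p" j] lip by (intro gdist_ge_lipschitz[OF connected_Xi[OF j]]) auto
  then show ?thesis
    using v w by (simp add: glue_level[OF j] a_def)
qed

section \<open>Exit-time bounds from test functions on one level\<close>

definition incidence :: "nat \<Rightarrow> nat \<Rightarrow> ('a, 'b) xvertex \<Rightarrow> 'b list \<Rightarrow> real" where
  "incidence j p v g = of_bool (tail (X j p) g = v) + of_bool (head (X j p) g = v)"

lemma exists_incident:
  assumes j: "j < K" and v: "v \<in> verts (X j p)"
  obtains g where "g \<in> arcs (X j p)" "tail (X j p) g = v \<or> head (X j p) g = v"
proof -
  interpret fin_graph "X j p" using j by (rule fin_graph_Xi)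
  have "nbrs (X j p) v \<noteq> {}"
    using nbrs_nonempty[OF v Init_verts(1)] nbrs_nonempty[OF v Init_verts(2)] by auto
  then obtain y where "(v, y) \<in> adj (X j p)"
    by (auto simp: nbrs_adj)
  then show ?thesis
    using that by (auto elim!: adjE)
qed

lemma sum_incidence_pos:
  assumes j: "j < K" and v: "v \<in> verts (X j p)"
  shows "0 < (\<Sum>g\<in>arcs (X j p). incidence j p v g)"
proof -
  obtain g where "g \<in> arcs (X j p)" "tail (X j p) g = v \<or> head (X j p) g = v"
    using exists_incident[OF assms] .
  then show ?thesis
    using finite_arcs_Xi[OF j] by (intro sum_pos2[of _ g]) (auto simp: incidence_def)
qed

lemma lift_pot_bounds:
  assumes j: "j < K" and g: "g \<in> arcs (X j p)"
  shows "min (a (tail (X j p) g)) (a (head (X j p) g)) \<le> lift j p q a (embed (X j p) g w)"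
    "lift j p q a (embed (X j p) g w) \<le> max (a (tail (X j p) g)) (a (head (X j p) g))"
proof -
  let ?s = "a (head (X j p) g)" and ?t = "a (tail (X j p) g)" and ?h = "pot (ecol j g) q w"
  have h: "0 \<le> ?h" "?h \<le> 1"
    using pot_nonneg pot_le_1 col_less[OF j g] by auto
  have "min ?t ?s \<le> (1 - ?h) * ?s + ?h * ?t" "(1 - ?h) * ?s + ?h * ?t \<le> max ?t ?s"
  proof -
    have "(1 - ?h) * min ?t ?s + ?h * min ?t ?s \<le> (1 - ?h) * ?s + ?h * ?t"
      using h by (intro add_mono mult_left_mono) auto
    then show "min ?t ?s \<le> (1 - ?h) * ?s + ?h * ?t"
      by (simp add: algebra_simps)
    have "(1 - ?h) * ?s + ?h * ?t \<le> (1 - ?h) * max ?t ?s + ?h * max ?t ?s"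
      using h by (intro add_mono mult_left_mono) auto
    then show "(1 - ?h) * ?s + ?h * ?t \<le> max ?t ?s"
      by (simp add: algebra_simps)
  qed
  then show "min ?t ?s \<le> lift j p q a (embed (X j p) g w)"
    "lift j p q a (embed (X j p) g w) \<le> max ?t ?s"
    unfolding lift_embed[OF j g] by (auto simp: algebra_simps)
qed

lemma lift_nonneg:
  assumes j: "j < K" and a: "\<And>x. 0 \<le> a x" and x: "x \<in> verts (X j (q + p))"
  shows "0 \<le> lift j p q a x"
  using verts_cases[OF j x]
proof cases
  case 1
  then show ?thesis using a by (simp add: lift_level[OF j])
next
  case (2 g w)
  have "0 \<le> min (a (tail (X j p) g)) (a (head (X j p) g))"
    using a by simp
  also have "\<dots> \<le> lift j p q a x"
    unfolding 2(3) by (rule lift_pot_bounds(1)[OF j 2(1)])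
  finally show ?thesis .
qed

text \<open>The test function is the potential that is 1 at \<open>v\<close> and 0 at all other vertices of level \<open>p\<close>.\<close>

lemma exit_time_le:
  assumes j: "j < K" and v: "v \<in> verts (X j p)" and A: "A \<subseteq> verts (X j (q + p))"
    and Av: "\<And>w. w \<in> A \<Longrightarrow> w \<in> verts (X j p) \<Longrightarrow> w = v"
    and c: "\<And>l. l < K \<Longrightarrow> c \<le> cond l q" and M: "\<And>l. l < K \<Longrightarrow> size_Xi l q \<le> M"
  shows "enn2real (expected_exit_time (X j (q + p)) v A) * c \<le> 2 * M"
proof -
  interpret P: fin_graph "X j p" using j by (rule fin_graph_Xi)
  interpret G: fin_graph "X j (q + p)" using j by (rule fin_graph_Xi)
  obtain z where z: "z \<in> verts (X j p)" "z \<noteq> v"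
    using Init_verts by (metis xvertex.distinct(1))
  then have "z \<in> verts (X j (q + p))" "z \<notin> A"
    using Av verts_mono[of p "q + p" j] by auto
  from G.exit_time_weak[OF A this] obtain f where f: "\<And>x. 0 \<le> f x" "\<And>x. x \<notin> A \<Longrightarrow> f x = 0"
    "\<And>v. expected_exit_time (X j (q + p)) v A = ennreal (f v)"
    "\<And>g. (\<And>x. x \<in> verts (X j (q + p)) \<Longrightarrow> 0 \<le> g x) \<Longrightarrow> unit_energy (X j (q + p)) f g \<le> mass (X j (q + p)) g"
    by metis
  define a :: "('a, 'b) xvertex \<Rightarrow> real" where "a x = of_bool (x = v)" for x
  define H where "H = lift j p q a"
  define d where "d = (\<Sum>g\<in>arcs (X j p). incidence j p v g)"
  \<comment> \<open>As \<open>A\<close> contains no other vertex of level \<open>p\<close>, the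
    energy below is \<open>f v\<close> times a weighted degree of \<open>v\<close>.\<close>
  have f_level: "f x = f v * a x" if "x \<in> verts (X j p)" for x
    using f(2)[of x] Av[of x] that by (auto simp: a_def)
  have "f v * c * d = (\<Sum>g\<in>arcs (X j p). f v * c * incidence j p v g)"
    by (simp add: d_def sum_distrib_left)
  also have "\<dots> \<le> (\<Sum>g\<in>arcs (X j p). cond (ecol j g) q * (a (tail (X j p) g) - a (head (X j p) g)) *
      (f (tail (X j p) g) - f (head (X j p) g)))"
  proof (rule sum_mono)
    fix g assume g: "g \<in> arcs (X j p)"
    have "(a (tail (X j p) g) - a (head (X j p) g)) * (f (tail (X j p) g) - f (head (X j p) g))
        = f v * incidence j p v g"
      unfolding f_level[OF P.tail_in_verts[OF g]] f_level[OF P.head_in_verts[OF g]]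
      using P.no_loop[OF g] by (auto simp: a_def incidence_def)
    moreover have "c * (f v * incidence j p v g) \<le> cond (ecol j g) q * (f v * incidence j p v g)"
      using c[OF col_less[OF j g]] f(1)[of v] by (intro mult_right_mono) (auto simp: incidence_def)
    ultimately show "f v * c * incidence j p v g \<le> cond (ecol j g) q * (a (tail (X j p) g) - a (head (X j p) g)) *
      (f (tail (X j p) g) - f (head (X j p) g))"
      by (simp add: mult_ac)
  qed
  also have "\<dots> = unit_energy (X j (q + p)) f H"
    unfolding H_def energy_commute[of "X j (q + p)" _ f] energy_lift[OF j] by (simp add: energy_def)
  \<comment> \<open>\<open>H\<close> need not vanish outside \<open>A\<close>, but it is
    nonnegative.\<close>
  also have "\<dots> \<le> mass (X j (q + p)) H"
    unfolding H_def by (intro f(4) lift_nonneg[OF j]) (auto simp: a_def)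
  also have "\<dots> \<le> (\<Sum>g\<in>arcs (X j p). 2 * M * incidence j p v g)"
    unfolding mass_append[OF j]
  proof (rule sum_mono)
    fix g assume g: "g \<in> arcs (X j p)"
    let ?i = "incidence j p v g"
    \<comment> \<open>The larger end value is 1 in copies at \<open>v\<close> and 0 in all others,
      so only copies at \<open>v\<close> carry mass.\<close>
    have "max (a (tail (X j p) g)) (a (head (X j p) g)) = ?i"
      using P.no_loop[OF g] by (auto simp: a_def incidence_def)
    then have H: "H (embed (X j p) g w) \<le> ?i" for w
      unfolding H_def using lift_pot_bounds(2)[OF j g] by metis
    have "mass (X (ecol j g) q) (\<lambda>w. H (embed (X j p) g w)) \<le> (\<Sum>e\<in>arcs (X (ecol j g) q). ?i + ?i)"
      unfolding mass_def by (intro sum_mono add_mono H)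
    also have "\<dots> = 2 * size_Xi (ecol j g) q * ?i"
      by (simp add: size_Xi_def)
    also have "\<dots> \<le> 2 * M * ?i"
      using M[OF col_less[OF j g]] by (intro mult_right_mono) (auto simp: incidence_def)
    finally show "mass (X (ecol j g) q) (\<lambda>w. H (embed (X j p) g w)) \<le> 2 * M * ?i" .
  qed
  also have "\<dots> = 2 * M * d"
    by (simp add: d_def sum_distrib_left)
  finally have "f v * c * d \<le> 2 * M * d" .
  then have "f v * c \<le> 2 * M"
    using sum_incidence_pos[OF j v] unfolding d_def[symmetric] by (rule mult_right_le_imp_le)
  then show ?thesis
    using f(1)[of v] by (simp add: f(3))
qed

text \<open>No rule edge joins the two planting vertices, so an edge of level \<open>p + 1\<close>
  at an old vertex has its other end inside a copy.\<close>

lemma nbrs_next_level: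
  assumes j: "j < K" and v: "v \<in> verts (X j p)" and x: "x \<in> nbrs (X j (Suc p)) v"
  obtains e y where "x = Born e y" "e \<in> arcs (X j p)"
proof -
  interpret P: fin_graph "X j p" using j by (rule fin_graph_Xi)
  obtain b where b: "b \<in> arcs (X j (Suc p))" "{tail (X j (Suc p)) b, head (X j (Suc p)) b} = {v, x}"
    using x by (auto simp: nbrs_adj elim!: adjE)
  obtain f e where fe: "b = f # e" "e \<in> arcs (X j p)" "f \<in> arcs (R (ecol j e))"
    using b(1) unfolding arcs_Xi_Suc by blast
  let ?p = "planted S j (X j p) e" and ?P = "{bp (ecol j e), bm (ecol j e)}"
  have "v \<noteq> Born e y" for y
    using v length_arc[OF fe(2)] j by (auto simp: Born_verts_iff)
  then have planted_v: "y \<in> ?P" if "?p y = v" for y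
    using that by (auto simp: planted_def split: if_splits)
  have "tail (R (ecol j e)) f \<noteq> head (R (ecol j e)) f"
    using fin_graph.no_loop[OF rule_fin_graph[OF col_less[OF j fe(2)]] fe(3)] .
  then have not_both: "tail (R (ecol j e)) f \<notin> ?P \<or> head (R (ecol j e)) f \<notin> ?P"
    using no_direct_arc[OF col_less[OF j fe(2)] fe(3)] by auto
  have "{?p (tail (R (ecol j e)) f), ?p (head (R (ecol j e)) f)} = {v, x}"
    using b(2) unfolding fe(1) tail_Xi_Suc .
  then have "\<exists>y. x = ?p y \<and> y \<notin> ?P"
    using planted_v not_both by (metis doubleton_eq_iff)
  then show ?thesis
    using that fe(2) by (auto simp: planted_def)
qed

text \<open>At the level of its birth a vertex has edges only in the copy where it was born, so its
  degree is bounded independently of the level.\<close>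

lemma card_arcs_at_Born:
  assumes j: "j < K" and e: "e \<in> arcs (X j p)"
  shows "(\<Sum>g\<in>arcs (X j (Suc p)). incidence j (Suc p) (Born e y) g) \<le> rule_size"
proof -
  interpret P: fin_graph "X j p" using j by (rule fin_graph_Xi)
  interpret Q: fin_graph "X j (Suc p)" using j by (rule fin_graph_Xi)
  interpret R: fin_graph "R (ecol j e)" using rule_fin_graph[OF col_less[OF j e]] .
  have zero: "incidence j (Suc p) (Born e y) g = 0"
    if g: "g \<in> arcs (X j (Suc p)) - (\<lambda>f. f # e) ` arcs (R (ecol j e))" for g
  proof -
    obtain f e' where fe: "g = f # e'" "e' \<in> arcs (X j p)" "f \<in> arcs (R (ecol j e'))"
      using g unfolding arcs_Xi_Suc by blast
    then have "e' \<noteq> e" using g by auto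
    have "Born e y \<notin> verts (X j p)"
      using length_arc[OF e] j by (simp add: Born_verts_iff)
    then have "tail (X j p) e' \<noteq> Born e y" "head (X j p) e' \<noteq> Born e y"
      using P.wellformed[OF fe(2)] by metis+
    then have "planted S j (X j p) e' u \<noteq> Born e y" for u
      using \<open>e' \<noteq> e\<close> by (simp add: planted_def)
    then show ?thesis
      unfolding incidence_def fe(1) tail_Xi_Suc by simp
  qed
  have "(\<Sum>g\<in>arcs (X j (Suc p)). incidence j (Suc p) (Born e y) g)
      = (\<Sum>g\<in>(\<lambda>f. f # e) ` arcs (R (ecol j e)). incidence j (Suc p) (Born e y) g)"
    using zero e Q.finite_arcs by (intro sum.mono_neutral_right) (auto simp: arcs_Xi_Suc)
  also have "\<dots> \<le> (\<Sum>g\<in>(\<lambda>f. f # e) ` arcs (R (ecol j e)). 1)"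
  proof (rule sum_mono)
    fix g assume "g \<in> (\<lambda>f. f # e) ` arcs (R (ecol j e))"
    then have "g \<in> arcs (X j (Suc p))"
      using e unfolding arcs_Xi_Suc by blast
    then show "incidence j (Suc p) (Born e y) g \<le> 1"
      using Q.no_loop[of g] by (auto simp: incidence_def)
  qed
  also have "\<dots> = real (card (arcs (R (ecol j e))))"
    by (simp add: card_image inj_on_def)
  also have "\<dots> \<le> rule_size"
    using card_rule_le[OF col_less[OF j e]] .
  finally show ?thesis .
qed

text \<open>The neighbours of \<open>v\<close> at level \<open>p + 1\<close> are new, hence of bounded degree.  The value
  \<open>\<epsilon>\<close> at these neighbours is so small that the test function is subharmonic away from \<open>v\<close>.\<close>

lemma exit_time_ge:
  assumes j: "j < K" and v: "v \<in> verts (X j p)" and A: "A \<subseteq> verts (X j (q + Suc p))"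
    and z: "z \<in> verts (X j (q + Suc p))" "z \<notin> A"
    and near: "\<And>g w y. g \<in> arcs (X j (Suc p)) \<Longrightarrow> w \<in> verts (X (ecol j g) q) \<Longrightarrow>
      y \<in> {tail (X j (Suc p)) g, head (X j (Suc p)) g} \<Longrightarrow> y = v \<or> y \<in> nbrs (X j (Suc p)) v \<Longrightarrow>
      embed (X j (Suc p)) g w \<in> A"
    and \<kappa>: "1 \<le> \<kappa>" "\<And>l l'. l < K \<Longrightarrow> l' < K \<Longrightarrow> cond l q \<le> \<kappa> * cond l' q"
    and C: "\<And>l. l < K \<Longrightarrow> cond l q \<le> C" and m: "\<And>l. l < K \<Longrightarrow> m \<le> size_Xi l q"
  shows "2 * m / (\<kappa> * rule_size) \<le> enn2real (expected_exit_time (X j (q + Suc p)) v A) * C"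
proof -
  let ?P = "X j (Suc p)" and ?G = "X j (q + Suc p)"
  interpret P: fin_graph ?P using j by (rule fin_graph_Xi)
  interpret G: fin_graph ?G using j by (rule fin_graph_Xi)
  from G.exit_time_weak[OF A z] obtain f where f: "\<And>x. 0 \<le> f x"
    "\<And>v. expected_exit_time ?G v A = ennreal (f v)"
    "\<And>g. (\<And>x. x \<in> verts ?G - A \<Longrightarrow> g x = 0) \<Longrightarrow> unit_energy ?G f g = mass ?G g"
    by metis
  \<comment> \<open>A positive value at the neighbours keeps \<open>H\<close> at least
    \<open>\<epsilon>\<close> throughout the copies at \<open>v\<close>, which gives the mass. At a
    neighbour, at most \<open>rule_size\<close> edges contribute at most
    \<open>\<epsilon> * \<kappa>\<close> times the weight of its edge to \<open>v\<close>; this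
    choice makes their total at most that weight.\<close>
  define \<epsilon> where "\<epsilon> = 1 / (\<kappa> * rule_size)"
  have "1 * 1 \<le> \<kappa> * rule_size"
    using \<kappa>(1) rule_size_ge_1 by (intro mult_mono) auto
  then have \<epsilon>: "0 < \<epsilon>" "\<epsilon> \<le> 1" "\<epsilon> * (\<kappa> * rule_size) = 1"
    by (auto simp: \<epsilon>_def)
  define a where "a x = (if x = v then 1 else if x \<in> nbrs ?P v then \<epsilon> else 0)" for x
  have a01: "0 \<le> a x" "a x \<le> 1" for x
    using \<epsilon> by (auto simp: a_def)
  define H where "H = lift j (Suc p) q a"
  define d where "d = (\<Sum>g\<in>arcs ?P. incidence j (Suc p) v g)"
  have vP: "v \<in> verts ?P"
    using v verts_mono[of p "Suc p" j] by auto
  have other: "head ?P g \<in> nbrs ?P v" if "g \<in> arcs ?P" "tail ?P g = v" for g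
    using adj_arc[OF that(1)] that(2) by (simp add: nbrs_adj)
  have other': "tail ?P g \<in> nbrs ?P v" if "g \<in> arcs ?P" "head ?P g = v" for g
    using adj_arc[OF that(1), THEN adj_sym] that(2) by (simp add: nbrs_adj)
  \<comment> \<open>By \<open>near\<close>, a copy containing a point outside \<open>A\<close> has
    neither \<open>v\<close> nor a neighbour of \<open>v\<close> as an end, so both end values are
    0.\<close>
  have H_supp: "H x = 0" if x: "x \<in> verts ?G - A" for x
  proof -
    have "x \<in> verts (X j (q + Suc p))" using x by simp
    from verts_cases[OF j this] show ?thesis
    proof cases
      case 1
      obtain g where g: "g \<in> arcs ?P" "tail ?P g = x \<or> head ?P g = x"
        using exists_incident[OF j 1] .
      have "x \<noteq> v \<and> x \<notin> nbrs ?P v"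
        using near[OF g(1) Init_verts(1), of x] near[OF g(1) Init_verts(2), of x] g x by auto
      then show ?thesis
        unfolding H_def lift_level[OF j 1] by (simp add: a_def)
    next
      case (2 g w)
      have "a (tail ?P g) = 0" "a (head ?P g) = 0"
        using near[OF 2(1,2), of "tail ?P g"] near[OF 2(1,2), of "head ?P g"] 2(3) x by (auto simp: a_def)
      then show ?thesis
        unfolding H_def 2(3) lift_embed[OF j 2(1)] by simp
    qed
  qed
  let ?w = "\<lambda>g. cond (ecol j g) q"
  have w: "0 < ?w g" "?w g \<le> C" if "g \<in> arcs ?P" for g
    using cond_pos C col_less[OF j that] by auto
  have lap_v: "laplacian ?P ?w a v \<le> C * d"
    unfolding laplacian_def d_def sum_distrib_left
  proof (rule sum_mono)
    fix g assume g: "g \<in> arcs ?P"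
    have "(a (tail ?P g) - a (head ?P g)) * (of_bool (tail ?P g = v) - of_bool (head ?P g = v))
        \<le> incidence j (Suc p) v g"
      using P.no_loop[OF g] a01[of "tail ?P g"] a01[of "head ?P g"] by (auto simp: incidence_def)
    then have "?w g * ((a (tail ?P g) - a (head ?P g)) * (of_bool (tail ?P g = v) - of_bool (head ?P g = v)))
        \<le> C * incidence j (Suc p) v g"
      using w[OF g] by (intro mult_mono' order_trans[OF mult_left_mono mult_right_mono]) (auto simp: incidence_def)
    then show "?w g * (a (tail ?P g) - a (head ?P g)) * (of_bool (tail ?P g = v) - of_bool (head ?P g = v))
        \<le> C * incidence j (Suc p) v g"
      by (simp add: mult.assoc)
  qed
  have lap_x: "laplacian ?P ?w a x \<le> 0" if x: "x \<noteq> v" for x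
  proof (cases "x \<in> nbrs ?P v")
    case False
    then have "a x = 0" using x by (simp add: a_def)
    show ?thesis
      unfolding laplacian_def
    proof (rule sum_nonpos)
      fix g assume g: "g \<in> arcs ?P"
      have "(a (tail ?P g) - a (head ?P g)) * (of_bool (tail ?P g = x) - of_bool (head ?P g = x)) \<le> 0"
        using a01[of "tail ?P g"] a01[of "head ?P g"] \<open>a x = 0\<close> by (auto simp: of_bool_def)
      then show "?w g * (a (tail ?P g) - a (head ?P g)) * (of_bool (tail ?P g = x) - of_bool (head ?P g = x)) \<le> 0"
        using w[OF g] by (simp add: mult.assoc mult_nonneg_nonpos)
    qed
  next
    case True
    then have "a x = \<epsilon>" using x by (simp add: a_def)
    obtain e y where e: "x = Born e y" "e \<in> arcs (X j p)"
      using nbrs_next_level[OF j v True] .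
    have "(v, x) \<in> adj ?P"
      using True by (simp add: nbrs_adj)
    then obtain b where b: "b \<in> arcs ?P" "{tail ?P b, head ?P b} = {v, x}"
      by (auto elim!: adjE)
    let ?i = "\<lambda>g. incidence j (Suc p) x g"
    \<comment> \<open>The edge \<open>b\<close> to \<open>v\<close> contributes
      \<open>\<epsilon> - 1\<close> times its weight, every other edge at \<open>x\<close> at most
      \<open>\<epsilon>\<close> times its own weight, which is compared with that of
      \<open>b\<close>.\<close>
    have term_le: "?w g * (a (tail ?P g) - a (head ?P g)) * (of_bool (tail ?P g = x) - of_bool (head ?P g = x))
        \<le> \<epsilon> * \<kappa> * ?w b * ?i g - of_bool (g = b) * ?w b" if g: "g \<in> arcs ?P" for g
    proof -
      have "?w g \<le> \<kappa> * ?w b"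
        using \<kappa>(2) col_less[OF j] g b(1) by blast
      then have le: "\<epsilon> * ?w g * ?i g \<le> \<epsilon> * \<kappa> * ?w b * ?i g"
        using \<epsilon>(1) by (intro mult_right_mono) (auto simp: incidence_def mult.assoc)
      have "(a (tail ?P g) - a (head ?P g)) * (of_bool (tail ?P g = x) - of_bool (head ?P g = x))
          \<le> \<epsilon> * ?i g - of_bool (g = b)"
      proof (cases "g = b")
        case True
        then have "tail ?P g = v \<and> head ?P g = x \<or> tail ?P g = x \<and> head ?P g = v"
          using b(2) by (auto simp: doubleton_eq_iff)
        then show ?thesis
          using x \<open>a x = \<epsilon>\<close> True by (auto simp: incidence_def a_def)
      next
        case False
        then show ?thesis
          using \<open>a x = \<epsilon>\<close> a01[of "tail ?P g"] a01[of "head ?P g"] \<epsilon> P.no_loop[OF g]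
          by (auto simp: incidence_def of_bool_def)
      qed
      then have "?w g * ((a (tail ?P g) - a (head ?P g)) * (of_bool (tail ?P g = x) - of_bool (head ?P g = x)))
          \<le> ?w g * (\<epsilon> * ?i g - of_bool (g = b))"
        using w(1)[OF g] by (intro mult_left_mono) auto
      also have "\<dots> \<le> \<epsilon> * \<kappa> * ?w b * ?i g - of_bool (g = b) * ?w b"
        using le by (auto simp: algebra_simps)
      finally show ?thesis
        by (simp add: mult.assoc)
    qed
    have "laplacian ?P ?w a x \<le> (\<Sum>g\<in>arcs ?P. \<epsilon> * \<kappa> * ?w b * ?i g - of_bool (g = b) * ?w b)"
      unfolding laplacian_def using term_le by (intro sum_mono)
    also have "\<dots> = \<epsilon> * \<kappa> * ?w b * (\<Sum>g\<in>arcs ?P. ?i g) - ?w b"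
      using b(1) by (simp add: sum_subtractf sum_distrib_left sum_distrib_right[symmetric])
    also have "\<dots> \<le> \<epsilon> * \<kappa> * ?w b * rule_size - ?w b"
      using card_arcs_at_Born[OF j e(2), of y] \<epsilon>(1) \<kappa>(1) w(1)[OF b(1)] unfolding e(1)
      by (intro diff_right_mono mult_left_mono) auto
    also have "\<dots> = (\<epsilon> * (\<kappa> * rule_size) - 1) * ?w b"
      by (simp add: algebra_simps)
    also have "\<dots> = 0"
      by (simp add: \<epsilon>(3))
    finally show ?thesis .
  qed
  have "2 * \<epsilon> * m * d = (\<Sum>g\<in>arcs ?P. 2 * \<epsilon> * m * incidence j (Suc p) v g)"
    by (simp add: d_def sum_distrib_left)
  also have "\<dots> \<le> mass ?G H"
    unfolding mass_append[OF j]
  proof (rule sum_mono)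
    fix g assume g: "g \<in> arcs ?P"
    let ?i = "incidence j (Suc p) v g"
    have "\<epsilon> * ?i \<le> min (a (tail ?P g)) (a (head ?P g))"
      using P.no_loop[OF g] other[OF g] other'[OF g] a01 \<epsilon> by (auto simp: incidence_def a_def)
    then have H: "\<epsilon> * ?i \<le> H (embed ?P g w)" for w
      unfolding H_def using lift_pot_bounds(1)[OF j g] order_trans by blast
    have "2 * \<epsilon> * m * ?i = m * (2 * \<epsilon> * ?i)"
      by simp
    also have "\<dots> \<le> size_Xi (ecol j g) q * (2 * \<epsilon> * ?i)"
      using m[OF col_less[OF j g]] \<epsilon> by (intro mult_right_mono) (auto simp: incidence_def)
    also have "\<dots> = (\<Sum>e\<in>arcs (X (ecol j g) q). \<epsilon> * ?i + \<epsilon> * ?i)"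
      by (simp add: size_Xi_def)
    also have "\<dots> \<le> mass (X (ecol j g) q) (\<lambda>w. H (embed ?P g w))"
      unfolding mass_def by (intro sum_mono add_mono H)
    finally show "2 * \<epsilon> * m * ?i \<le> mass (X (ecol j g) q) (\<lambda>w. H (embed ?P g w))" .
  qed
  also have "\<dots> = unit_energy ?G f H"
    using f(3)[OF H_supp] by simp
  also have "\<dots> = energy ?P ?w a f"
    unfolding H_def energy_commute[of ?G _ f] energy_lift[OF j] ..
  also have "\<dots> = (\<Sum>x\<in>verts ?P. f x * laplacian ?P ?w a x)"
    by (rule energy_eq_sum_laplacian) (rule P.fin_digraph_axioms)
  also have "\<dots> \<le> (\<Sum>x\<in>{v}. f x * laplacian ?P ?w a x)"
  proof -
    have "(\<Sum>x\<in>verts ?P. f x * laplacian ?P ?w a x)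
        \<le> (\<Sum>x\<in>verts ?P. of_bool (x = v) * (f x * laplacian ?P ?w a x))"
      using lap_x f(1) by (intro sum_mono) (auto simp: mult_nonneg_nonpos)
    also have "\<dots> = (\<Sum>x\<in>{v}. f x * laplacian ?P ?w a x)"
      using vP by simp
    finally show ?thesis .
  qed
  also have "\<dots> \<le> f v * (C * d)"
    using lap_v f(1)[of v] by (simp add: mult_left_mono)
  finally have "2 * \<epsilon> * m * d \<le> f v * C * d"
    by (simp add: mult.assoc)
  then have "2 * \<epsilon> * m \<le> f v * C"
    using sum_incidence_pos[OF j vP] unfolding d_def[symmetric] by (rule mult_right_le_imp_le)
  then show ?thesis
    unfolding f(2) using f(1)[of v] by (simp add: \<epsilon>_def)
qed

end


section \<open>The Einstein relation\<close>

lemma shifted_average_limit: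
  fixes s :: "nat \<Rightarrow> real"
  assumes s: "(\<lambda>q. s q / real q) \<longlonglongrightarrow> L"
  shows "(\<lambda>M. (c + s (M + k)) / real M) \<longlonglongrightarrow> L"
    and "(\<lambda>M. (c + s (M - k)) / real M) \<longlonglongrightarrow> L"
proof -
  have *: "(\<lambda>M. (c + s (h M)) / real M) \<longlonglongrightarrow> L"
    if h: "filterlim h at_top sequentially" "(\<lambda>M. real (h M) / real M) \<longlonglongrightarrow> 1" for h :: "nat \<Rightarrow> nat"
  proof -
    have "(\<lambda>M. c / real M + s (h M) / real (h M) * (real (h M) / real M)) \<longlonglongrightarrow> 0 + L * 1"
      by (intro tendsto_add tendsto_mult lim_const_over_n filterlim_compose[OF s h(1)] h(2))
    then have "(\<lambda>M. c / real M + s (h M) / real (h M) * (real (h M) / real M)) \<longlonglongrightarrow> L"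
      by (simp only: add_0_left mult_1_right)
    moreover have "\<forall>\<^sub>F M in sequentially. c / real M + s (h M) / real (h M) * (real (h M) / real M) = (c + s (h M)) / real M"
    proof -
      have "\<forall>\<^sub>F M in sequentially. 0 < h M"
        using eventually_compose_filterlim[OF eventually_gt_at_top[of 0] h(1)] .
      then show ?thesis
        by eventually_elim (simp add: add_divide_distrib)
    qed
    ultimately show ?thesis
      by (rule Lim_transform_eventually)
  qed
  show "(\<lambda>M. (c + s (M + k)) / real M) \<longlonglongrightarrow> L"
  proof (rule *)
    show "filterlim (\<lambda>M. M + k) at_top sequentially"
      by (rule filterlim_add_const_nat_at_top)
    have "(\<lambda>M. (real M + real k) / real M) \<longlonglongrightarrow> 1"
      by real_asymp
    then show "(\<lambda>M. real (M + k) / real M) \<longlonglongrightarrow> 1"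
      by simp
  qed
  show "(\<lambda>M. (c + s (M - k)) / real M) \<longlonglongrightarrow> L"
  proof (rule *)
    show "filterlim (\<lambda>M. M - k) at_top sequentially"
      by (rule filterlim_minus_const_nat_at_top)
    have "(\<lambda>M. (real M - real k) / real M) \<longlonglongrightarrow> 1"
      by real_asymp
    moreover have "\<forall>\<^sub>F M in sequentially. (real M - real k) / real M = real (M - k) / real M"
      using eventually_ge_at_top[of k] by eventually_elim (simp add: of_nat_diff)
    ultimately show "(\<lambda>M. real (M - k) / real M) \<longlonglongrightarrow> 1"
      by (rule Lim_transform_eventually)
  qed
qed

text \<open>The resistance dimension and the walk dimension are both limits of this kind. Numerator
  and denominator are divided by the scale \<open>M n\<close>; additive constants and a bounded
  shift of the scale then disappear.\<close>

lemma log_ratio_limit: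
  fixes s e r :: "nat \<Rightarrow> real" and M :: "nat \<Rightarrow> nat"
  assumes s: "(\<lambda>q. s q / real q) \<longlonglongrightarrow> L" and l: "0 < l"
    and M: "filterlim M at_top sequentially"
    and e: "\<forall>\<^sub>F n in sequentially. c1 + s (M n - k) \<le> e n \<and> e n \<le> c2 + s (M n + k)"
    and r: "\<forall>\<^sub>F n in sequentially. d1 + real (M n) * l \<le> r n \<and> r n \<le> d2 + real (M n) * l"
  shows "(\<lambda>n. e n / r n) \<longlonglongrightarrow> L / l"
proof -
  have M0: "\<forall>\<^sub>F n in sequentially. 0 < M n"
    using eventually_compose_filterlim[OF eventually_gt_at_top[of 0] M] .
  have 1: "(\<lambda>n. e n / real (M n)) \<longlonglongrightarrow> L"
  proof (rule tendsto_sandwich)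
    show "(\<lambda>n. (c1 + s (M n - k)) / real (M n)) \<longlonglongrightarrow> L" "(\<lambda>n. (c2 + s (M n + k)) / real (M n)) \<longlonglongrightarrow> L"
      using filterlim_compose[OF shifted_average_limit(2)[OF s] M]
        filterlim_compose[OF shifted_average_limit(1)[OF s] M] by auto
    show "\<forall>\<^sub>F n in sequentially. (c1 + s (M n - k)) / real (M n) \<le> e n / real (M n)"
      using e by eventually_elim (simp add: divide_right_mono)
    show "\<forall>\<^sub>F n in sequentially. e n / real (M n) \<le> (c2 + s (M n + k)) / real (M n)"
      using e by eventually_elim (simp add: divide_right_mono)
  qed
  have lin: "(\<lambda>n. (d + real (M n) * l) / real (M n)) \<longlonglongrightarrow> l" for d
  proof -
    have "(\<lambda>m. (d + real m * l) / real m) \<longlonglongrightarrow> l"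
      by real_asymp
    then show ?thesis
      using M by (rule filterlim_compose)
  qed
  have 2: "(\<lambda>n. r n / real (M n)) \<longlonglongrightarrow> l"
  proof (rule tendsto_sandwich[OF _ _ lin[of d1] lin[of d2]])
    show "\<forall>\<^sub>F n in sequentially. (d1 + real (M n) * l) / real (M n) \<le> r n / real (M n)"
      using r by eventually_elim (simp add: divide_right_mono)
    show "\<forall>\<^sub>F n in sequentially. r n / real (M n) \<le> (d2 + real (M n) * l) / real (M n)"
      using r by eventually_elim (simp add: divide_right_mono)
  qed
  have "(\<lambda>n. (e n / real (M n)) / (r n / real (M n))) \<longlonglongrightarrow> L / l"
    using 1 2 l by (intro tendsto_divide) auto
  moreover have "\<forall>\<^sub>F n in sequentially. (e n / real (M n)) / (r n / real (M n)) = e n / r n"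
    using M0 by eventually_elim simp
  ultimately show ?thesis
    by (rule Lim_transform_eventually)
qed

section \<open>Balls at the scales given by the constants\<close>

locale scaled_eigs = eigs_system S for S :: "('a, 'b) eigs" +
  fixes cd Cd :: real and c0 :: int
  assumes scale: "scale_constants S cd Cd c0"
begin

abbreviation "\<rho> \<equiv> rho_min S"
abbreviation "\<iota> \<equiv> initial_colour S"

lemma iota: "\<iota> < K"
  using eigs by (simp add: eigs_def)

lemma cd_pos: "0 < cd" and Cd_pos: "0 < Cd"
  using scale by (auto simp: scale_constants_def)

lemma gdist_bounds:
  assumes "l < K"
  shows "cd * \<rho> ^ n \<le> real (gdist (X l n) Init_plus Init_minus)"
    "real (gdist (X l n) Init_plus Init_minus) \<le> Cd * \<rho> ^ n" "real (gdiam (X l n)) \<le> Cd * \<rho> ^ n"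
proof -
  show 1: "cd * \<rho> ^ n \<le> real (gdist (X l n) Init_plus Init_minus)" "real (gdiam (X l n)) \<le> Cd * \<rho> ^ n"
    using scale assms unfolding scale_constants_def by blast+
  have "gdist (X l n) Init_plus Init_minus \<le> gdiam (X l n)"
    using scale assms unfolding scale_constants_def by blast
  then show "real (gdist (X l n) Init_plus Init_minus) \<le> Cd * \<rho> ^ n"
    using 1(2) by linarith
qed

lemma gdist_ge_1:
  assumes "l < K"
  shows "1 \<le> gdist (X l n) Init_plus Init_minus"
proof (rule ccontr)
  assume "\<not> ?thesis"
  then have "gdist (X l n) Init_plus Init_minus = 0" by simp
  moreover have "(Init_plus, Init_minus) \<in> adj (X l n) ^^ gdist (X l n) Init_plus Init_minus"
    using connected_graphD[OF connected_Xi[OF assms]] Init_verts by (intro relpow_gdist) auto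
  ultimately show False by simp
qed

text \<open>Distances are at least 1, so \<open>Cd * \<rho> ^ n\<close> cannot tend to 0. The
  condition \<open>cd * \<rho> powi c0 \<ge> 4 * Cd\<close> with \<open>cd \<le> Cd\<close> gives
  \<open>\<rho> powi c0 \<ge> 4\<close>, which excludes \<open>\<rho> = 1\<close> and then
  \<open>c0 \<le> 0\<close>.\<close>

lemma rho_gt_1: "1 < \<rho>" and c0_pos: "0 < c0"
proof -
  have 1: "1 \<le> Cd * \<rho> ^ n" for n
    using gdist_bounds(2)[OF iota, of n] gdist_ge_1[OF iota, of n] by linarith
  have "0 < Cd * \<rho> ^ 1"
    using 1[of 1] by linarith
  then have pos: "0 < \<rho>"
    using Cd_pos by (simp add: zero_less_mult_iff)
  have ge: "1 \<le> \<rho>"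
  proof (rule ccontr)
    assume "\<not> ?thesis"
    then have "(\<lambda>n. Cd * \<rho> ^ n) \<longlonglongrightarrow> Cd * 0"
      using pos by (intro tendsto_mult_left LIMSEQ_power_zero) simp
    then show False
      using 1 LIMSEQ_le_const[of "\<lambda>n. Cd * \<rho> ^ n" "Cd * 0" 1] by auto
  qed
  have "cd \<le> Cd"
    using gdist_bounds(1)[OF iota, of 0] gdist_bounds(2)[OF iota, of 0] by simp
  moreover have "0 < \<rho> powi c0"
    using pos by simp
  ultimately have "cd * \<rho> powi c0 \<le> Cd * \<rho> powi c0"
    by (intro mult_right_mono) auto
  moreover have "4 * Cd \<le> cd * \<rho> powi c0"
    using scale by (simp add: scale_constants_def)
  ultimately have "Cd * 4 \<le> Cd * \<rho> powi c0"
    by linarith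
  then have "4 \<le> \<rho> powi c0"
    using Cd_pos by (rule mult_left_le_imp_le)
  then have *: "1 < \<rho> powi c0" by simp
  then have "\<rho> \<noteq> 1" by auto
  then show gt: "1 < \<rho>" using ge by simp
  show "0 < c0"
  proof (rule ccontr)
    assume "\<not> 0 < c0"
    then have "\<rho> powi c0 \<le> 1"
      using gt by (auto simp: power_int_def inverse_le_1_iff intro!: power_le_one)
    then show False using * by simp
  qed
qed

definition k0 :: nat where "k0 = nat c0"

lemma k0: "c0 = int k0" "0 < k0"
  using c0_pos by (auto simp: k0_def)

lemma powi_c0: "\<rho> powi c0 = \<rho> ^ k0" "\<rho> powi (- c0) = inverse (\<rho> ^ k0)"
  using c0_pos by (simp_all add: power_int_def k0_def power_inverse)

lemma k0_outer: "4 * Cd \<le> cd * \<rho> ^ k0"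
  using scale unfolding scale_constants_def powi_c0 by simp

lemma k0_inner: "4 * \<rho> * Cd \<le> cd * \<rho> ^ k0"
proof -
  have "Cd * \<rho> powi (- c0) \<le> cd / (4 * \<rho>)"
    using scale unfolding scale_constants_def by blast
  then have "Cd * inverse (\<rho> ^ k0) \<le> cd / (4 * \<rho>)"
    by (simp only: powi_c0)
  then have "Cd * inverse (\<rho> ^ k0) * (4 * \<rho> * \<rho> ^ k0) \<le> cd / (4 * \<rho>) * (4 * \<rho> * \<rho> ^ k0)"
    using rho_gt_1 by (intro mult_right_mono) auto
  moreover have "Cd * inverse (\<rho> ^ k0) * (4 * \<rho> * \<rho> ^ k0) = 4 * \<rho> * Cd"
    "cd / (4 * \<rho>) * (4 * \<rho> * \<rho> ^ k0) = cd * \<rho> ^ k0"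
    using rho_gt_1 by simp_all
  ultimately show ?thesis by simp
qed

text \<open>Distinct vertices of level \<open>p\<close> are at distance at least
  \<open>cd * \<rho> ^ (m + k0)\<close>, and \<open>k0_outer\<close> makes this at least four times
  the radius.\<close>

lemma ball_level:
  assumes v: "v \<in> verts (X \<iota> p)" and r: "r \<le> Cd * \<rho> ^ m"
    and w: "w \<in> gball (X \<iota> (m + k0 + p)) v r" "w \<in> verts (X \<iota> p)"
  shows "w = v"
proof (rule ccontr)
  assume "w \<noteq> v"
  then have "cd * \<rho> ^ (m + k0) \<le> real (gdist (X \<iota> (m + k0 + p)) w v)"
    using v w gdist_bounds(1) cd_pos rho_gt_1 by (intro gdist_level_ge[OF iota]) auto
  also have "\<dots> < Cd * \<rho> ^ m"
    using w(1) r by (simp add: gball_def)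
  finally have "cd * \<rho> ^ k0 * \<rho> ^ m < Cd * \<rho> ^ m"
    by (simp add: power_add mult_ac)
  then have "cd * \<rho> ^ k0 < Cd"
    using rho_gt_1 by simp
  then show False
    using k0_outer Cd_pos by linarith
qed

text \<open>Every point of the copy is within one copy diameter of \<open>y\<close>, and
  \<open>y\<close> is within one of \<open>v\<close>; by \<open>k0_inner\<close> the sum is smaller
  than the radius.\<close>

lemma ball_near:
  assumes v: "v \<in> verts (X \<iota> p)" and r: "cd * \<rho> ^ (q + k0) \<le> r"
    and g: "g \<in> arcs (X \<iota> p)" and w: "w \<in> verts (X (ecol \<iota> g) q)"
    and y: "y \<in> {tail (X \<iota> p) g, head (X \<iota> p) g}" "y = v \<or> y \<in> nbrs (X \<iota> p) v"
  shows "embed (X \<iota> p) g w \<in> gball (X \<iota> (q + p)) v r"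
proof -
  interpret P: fin_graph "X \<iota> p" using iota by (rule fin_graph_Xi)
  have ends: "real (gdist (X \<iota> (q + p)) (embed (X \<iota> p) g' x) (embed (X \<iota> p) g' x')) \<le> Cd * \<rho> ^ q"
    if "g' \<in> arcs (X \<iota> p)" "x \<in> verts (X (ecol \<iota> g') q)" "x' \<in> verts (X (ecol \<iota> g') q)" for g' x x'
    using gdist_embed_le[OF iota that] gdist_bounds(3)[OF col_less[OF iota that(1)], of q]
    by (meson of_nat_mono order_trans)
  have wy: "real (gdist (X \<iota> (q + p)) (embed (X \<iota> p) g w) y) \<le> Cd * \<rho> ^ q"
    using ends[OF g w Init_verts(1)] ends[OF g w Init_verts(2)] y(1) by auto
  have yv: "real (gdist (X \<iota> (q + p)) y v) \<le> Cd * \<rho> ^ q"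
  proof (cases "y = v")
    case True
    then show ?thesis
      using v verts_mono[of p "q + p" \<iota>] Cd_pos rho_gt_1 by (simp add: gdist_self subset_iff)
  next
    case False
    then have "(v, y) \<in> adj (X \<iota> p)"
      using y(2) by (simp add: nbrs_adj)
    then show ?thesis
    proof (cases rule: adjE)
      case (1 g')
      then show ?thesis using ends[OF 1(1) Init_verts(2) Init_verts(1)] by simp
    next
      case (2 g')
      then show ?thesis using ends[OF 2(1) Init_verts(1) Init_verts(2)] by simp
    qed
  qed
  have in_verts: "embed (X \<iota> p) g w \<in> verts (X \<iota> (q + p))" "y \<in> verts (X \<iota> (q + p))" "v \<in> verts (X \<iota> (q + p))"
    using embed_verts[OF iota g w] y(1) v P.wellformed[OF g] verts_mono[of p "q + p" \<iota>] by auto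
  have "real (gdist (X \<iota> (q + p)) (embed (X \<iota> p) g w) v) \<le> 2 * Cd * \<rho> ^ q"
    using gdist_triangle[OF connected_Xi[OF iota] in_verts] wy yv by linarith
  also have "\<dots> < 4 * \<rho> * Cd * \<rho> ^ q"
    using Cd_pos rho_gt_1 by simp
  also have "\<dots> \<le> cd * \<rho> ^ k0 * \<rho> ^ q"
    using k0_inner rho_gt_1 by (intro mult_right_mono) auto
  also have "\<dots> \<le> r"
    using r by (simp add: power_add mult_ac)
  finally show ?thesis
    using in_verts by (simp add: gball_def)
qed

text \<open>Logarithm of the number of edges times the resistance, which is the order of the exit
  time at scale \<open>q\<close>.\<close>

definition growth :: "nat \<Rightarrow> real" where
  "growth q = ln (size_Xi \<iota> q) - ln (cond \<iota> q)"

lemma exit_time_bounds: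
  obtains c1 c2 where "\<And>v r n m. \<lbrakk>v \<in> verts (X \<iota> b); m + k0 + b \<le> n; k0 \<le> m;
      cd * \<rho> ^ m \<le> r; r \<le> Cd * \<rho> ^ m\<rbrakk> \<Longrightarrow>
    c1 + growth (m - k0) \<le> ln (enn2real (expected_exit_time (X \<iota> n) v (gball (X \<iota> n) v r))) \<and>
    ln (enn2real (expected_exit_time (X \<iota> n) v (gball (X \<iota> n) v r))) \<le> c2 + growth (m + k0)"
proof -
  obtain \<kappa> where \<kappa>: "1 \<le> \<kappa>" "\<And>n j l. j < K \<Longrightarrow> l < K \<Longrightarrow> cond j n \<le> \<kappa> * cond l n"
    using cond_comparable by blast
  \<comment> \<open>Besides the factor 2 of the mass, \<open>C1\<close> collects
    \<open>\<kappa> * rule_size\<close> from the small value at the neighbours, and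
    \<open>rule_size\<close> and \<open>\<kappa>\<close> from passing to the initial colour. Only
    the latter two enter \<open>C2\<close>.\<close>
  define C1 where "C1 = 2 / (\<kappa> * rule_size * rule_size * \<kappa>)"
  define C2 where "C2 = 2 * rule_size * \<kappa>"
  have C: "0 < C1" "0 < C2"
    using \<kappa>(1) rule_size_ge_1 by (auto simp: C1_def C2_def)
  have pos: "0 < size_Xi \<iota> q" "0 < cond \<iota> q" for q
    using size_Xi_ge_1[OF iota, of q] cond_pos[OF iota, of q] by auto
  have main: "ln C1 + growth (m - k0) \<le> ln (enn2real (expected_exit_time (X \<iota> n) v (gball (X \<iota> n) v r))) \<and>
    ln (enn2real (expected_exit_time (X \<iota> n) v (gball (X \<iota> n) v r))) \<le> ln C2 + growth (m + k0)"
    if v: "v \<in> verts (X \<iota> b)" and n: "m + k0 + b \<le> n" "k0 \<le> m"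
      and r: "cd * \<rho> ^ m \<le> r" "r \<le> Cd * \<rho> ^ m" for v r n m
  proof -
    define E where "E = enn2real (expected_exit_time (X \<iota> n) v (gball (X \<iota> n) v r))"
    have ball: "gball (X \<iota> n) v r \<subseteq> verts (X \<iota> n)"
      by (auto simp: gball_def)
    \<comment> \<open>For the upper bound: copies of order \<open>m + k0\<close>, too wide for the
      ball to reach a second vertex of level \<open>p\<close>.\<close>
    define p where "p = n - (m + k0)"
    have p: "n = m + k0 + p" "b \<le> p"
      using n(1) by (auto simp: p_def)
    have vp: "v \<in> verts (X \<iota> p)"
      using v verts_mono[OF p(2)] by blast
    define q where "q = m - k0"
    have q: "m = q + k0"
      using n(2) by (simp add: q_def)
    \<comment> \<open>For the lower bound: copies of order \<open>q = m - k0\<close> at level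
      \<open>Suc p' = n - q\<close>. Positivity of \<open>k0\<close> gives
      \<open>p \<le> p'\<close>, so \<open>v\<close> is present one level earlier, as
      \<open>exit_time_ge\<close> requires.\<close>
    define p' where "p' = k0 + k0 + p - 1"
    have p': "n = q + Suc p'" "p \<le> p'"
      using p(1) q k0(2) by (auto simp: p'_def)
    have vp': "v \<in> verts (X \<iota> p')"
      using vp verts_mono[OF p'(2)] by blast
    have ball_v: "w = v" if "w \<in> gball (X \<iota> n) v r" "w \<in> verts (X \<iota> p)" for w
      using ball_level[OF vp r(2)] that unfolding p(1) by blast
    have upper: "E * (cond \<iota> (m + k0) / \<kappa>) \<le> 2 * (rule_size * size_Xi \<iota> (m + k0))"
      unfolding E_def p(1)
    proof (rule exit_time_le[OF iota vp])
      show "cond \<iota> (m + k0) / \<kappa> \<le> cond l (m + k0)" if "l < K" for l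
        using \<kappa>(2)[OF iota that, of "m + k0"] \<kappa>(1) by (simp add: field_simps)
      show "size_Xi l (m + k0) \<le> rule_size * size_Xi \<iota> (m + k0)" if "l < K" for l
        using size_Xi_comparable[OF that iota] .
    qed (use ball ball_v p(1) in auto)
    obtain z where "z \<in> verts (X \<iota> p)" "z \<noteq> v"
      using Init_verts[of \<iota> p] by (cases "v = Init_plus") auto
    then have z: "z \<in> verts (X \<iota> n)" "z \<notin> gball (X \<iota> n) v r"
      using ball_v verts_mono[of p n \<iota>] p(1) by auto
    have lower: "2 * (size_Xi \<iota> q / rule_size) / (\<kappa> * rule_size) \<le> E * (\<kappa> * cond \<iota> q)"
      unfolding E_def p'(1)
    proof (rule exit_time_ge[OF iota vp' _ _ _ _ \<kappa>(1)])
      show "z \<in> verts (X \<iota> (q + Suc p'))" "z \<notin> gball (X \<iota> (q + Suc p')) v r"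
        "gball (X \<iota> (q + Suc p')) v r \<subseteq> verts (X \<iota> (q + Suc p'))"
        using z ball unfolding p'(1) by blast+
      show "cond l q \<le> \<kappa> * cond l' q" if "l < K" "l' < K" for l l'
        using \<kappa>(2)[OF that] .
      show "cond l q \<le> \<kappa> * cond \<iota> q" if "l < K" for l
        using \<kappa>(2)[OF that iota] .
      show "size_Xi \<iota> q / rule_size \<le> size_Xi l q" if "l < K" for l
        using size_Xi_comparable[OF iota that, of q] rule_size_ge_1 by (simp add: field_simps)
      show "embed (X \<iota> (Suc p')) g w \<in> gball (X \<iota> (q + Suc p')) v r"
        if "g \<in> arcs (X \<iota> (Suc p'))" "w \<in> verts (X (ecol \<iota> g) q)"
          "y \<in> {tail (X \<iota> (Suc p')) g, head (X \<iota> (Suc p')) g}" "y = v \<or> y \<in> nbrs (X \<iota> (Suc p')) v" for g w y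
        using vp' verts_mono[of p' "Suc p'" \<iota>] r(1) that
        unfolding q by (intro ball_near[OF _ _ that]) auto
    qed
    have lo: "C1 * (size_Xi \<iota> q / cond \<iota> q) \<le> E"
    proof -
      have "C1 * (size_Xi \<iota> q / cond \<iota> q) = 2 * (size_Xi \<iota> q / rule_size) / (\<kappa> * rule_size) / (\<kappa> * cond \<iota> q)"
        by (simp add: C1_def mult_ac)
      also have "\<dots> \<le> E * (\<kappa> * cond \<iota> q) / (\<kappa> * cond \<iota> q)"
        using lower \<kappa>(1) pos(2)[of q] by (intro divide_right_mono) auto
      also have "\<dots> = E"
        using \<kappa>(1) pos(2)[of q] by simp
      finally show ?thesis .
    qed
    have up: "E \<le> C2 * (size_Xi \<iota> (m + k0) / cond \<iota> (m + k0))"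
    proof -
      have "E = E * (cond \<iota> (m + k0) / \<kappa>) / (cond \<iota> (m + k0) / \<kappa>)"
        using \<kappa>(1) pos(2)[of "m + k0"] by simp
      also have "\<dots> \<le> 2 * (rule_size * size_Xi \<iota> (m + k0)) / (cond \<iota> (m + k0) / \<kappa>)"
        using upper \<kappa>(1) pos(2)[of "m + k0"] by (intro divide_right_mono) auto
      also have "\<dots> = C2 * (size_Xi \<iota> (m + k0) / cond \<iota> (m + k0))"
        by (simp add: C2_def mult_ac)
      finally show ?thesis .
    qed
    have posE: "0 < C1 * (size_Xi \<iota> q / cond \<iota> q)"
      using C pos by simp
    have "ln (C1 * (size_Xi \<iota> q / cond \<iota> q)) \<le> ln E"
      using lo posE by (subst ln_le_cancel_iff) auto
    moreover have "ln E \<le> ln (C2 * (size_Xi \<iota> (m + k0) / cond \<iota> (m + k0)))"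
      using up lo posE by (subst ln_le_cancel_iff) auto
    ultimately show ?thesis
      unfolding E_def[symmetric] using C pos[of q] pos[of "m + k0"]
      by (simp add: growth_def ln_mult ln_div q)
  qed
  show ?thesis
    by (rule that) (rule main)
qed

lemma growth_limit:
  "(\<lambda>q. growth q / real q) \<longlonglongrightarrow> ln (nat_spectral_radius (mass_matrix S)) - lim (\<lambda>n. ln (cond \<iota> n) / real n)"
  unfolding growth_def diff_divide_distrib
  using size_Xi_growth[OF iota] cond_growth[OF iota, unfolded convergent_LIMSEQ_iff] by (intro tendsto_diff)

lemma resistance_dim_eq: "resistance_dim S = - lim (\<lambda>n. ln (cond \<iota> n) / real n) / ln \<rho>"
proof -
  let ?c = "lim (\<lambda>n. ln (cond \<iota> n) / real n)"
  have l: "0 < ln \<rho>" using rho_gt_1 by simp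
  have lim: "(\<lambda>n. - ln (cond \<iota> n) / real n) \<longlonglongrightarrow> - ?c"
    using tendsto_minus[OF cond_growth[OF iota, unfolded convergent_LIMSEQ_iff]] by simp
  have "(\<lambda>n. - ln (cond \<iota> n) / ln (real (gdist (X \<iota> n) Init_plus Init_minus))) \<longlonglongrightarrow> - ?c / ln \<rho>"
  proof (rule log_ratio_limit[OF lim l filterlim_ident, where k=0 and ?c1.0=0 and ?c2.0=0 and ?d1.0="ln cd" and ?d2.0="ln Cd"])
    show "\<forall>\<^sub>F n in sequentially. ln cd + real n * ln \<rho> \<le> ln (real (gdist (X \<iota> n) Init_plus Init_minus)) \<and>
        ln (real (gdist (X \<iota> n) Init_plus Init_minus)) \<le> ln Cd + real n * ln \<rho>"
    proof (intro always_eventually allI conjI)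
      fix n
      have "0 < real (gdist (X \<iota> n) Init_plus Init_minus)"
        using gdist_ge_1[OF iota, of n] by linarith
      then have "ln (cd * \<rho> ^ n) \<le> ln (real (gdist (X \<iota> n) Init_plus Init_minus))"
        "ln (real (gdist (X \<iota> n) Init_plus Init_minus)) \<le> ln (Cd * \<rho> ^ n)"
        using gdist_bounds(1,2)[OF iota, of n] cd_pos Cd_pos rho_gt_1 by (simp_all add: ln_le_cancel_iff)
      then show "ln cd + real n * ln \<rho> \<le> ln (real (gdist (X \<iota> n) Init_plus Init_minus))"
        "ln (real (gdist (X \<iota> n) Init_plus Init_minus)) \<le> ln Cd + real n * ln \<rho>"
        using cd_pos Cd_pos rho_gt_1 by (simp_all add: ln_mult ln_realpow)
    qed
  qed simp
  moreover have "ln (1 / cond \<iota> n) = - ln (cond \<iota> n)" for n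
    using cond_pos[OF iota, of n] by (simp add: ln_div)
  ultimately show ?thesis
    unfolding resistance_dim_def eff_resistance_Xi[OF iota] by (intro limI) simp
qed

lemma walk_dim_limit:
  assumes v: "v \<in> limit_verts S" and adm: "admissible S cd Cd c0 v r"
  shows "(\<lambda>n. ln (enn2real (expected_exit_time (X \<iota> n) v (gball (X \<iota> n) v (r n)))) / ln (r n))
    \<longlonglongrightarrow> (ln (nat_spectral_radius (mass_matrix S)) - lim (\<lambda>n. ln (cond \<iota> n) / real n)) / ln \<rho>"
proof -
  have l: "0 < ln \<rho>" using rho_gt_1 by simp
  define b where "b = birth_level S v"
  have vb: "v \<in> verts (X \<iota> b)"
    using v unfolding b_def birth_level_def limit_verts_def by (auto intro: LeastI)
  obtain m where r_inf: "filterlim r at_top sequentially" and m: "\<forall>\<^sub>F n in sequentially.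
      c0 \<le> m n \<and> m n \<le> int n - int b - c0 \<and> cd * \<rho> powi m n \<le> r n \<and> r n \<le> Cd * \<rho> powi m n"
    using adm unfolding admissible_def b_def by auto
  \<comment> \<open>The conversion is faithful for large \<open>n\<close>, where
    \<open>m n \<ge> c0 > 0\<close>.\<close>
  define M where "M n = nat (m n)" for n
  have M: "\<forall>\<^sub>F n in sequentially. k0 \<le> M n \<and> M n + k0 + b \<le> n \<and> cd * \<rho> ^ M n \<le> r n \<and> r n \<le> Cd * \<rho> ^ M n"
    using m
  proof eventually_elim
    case (elim n)
    then have "m n = int (M n)"
      using k0 by (simp add: M_def)
    then show ?case
      using elim k0(1) by (auto simp: power_int_of_nat)
  qed
  have r_ln: "\<forall>\<^sub>F n in sequentially. ln cd + real (M n) * ln \<rho> \<le> ln (r n) \<and> ln (r n) \<le> ln Cd + real (M n) * ln \<rho>"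
    using M
  proof eventually_elim
    case (elim n)
    have "0 < cd * \<rho> ^ M n"
      using cd_pos rho_gt_1 by simp
    then have "ln (cd * \<rho> ^ M n) \<le> ln (r n)" "ln (r n) \<le> ln (Cd * \<rho> ^ M n)"
      using elim Cd_pos rho_gt_1 by (auto simp: ln_le_cancel_iff)
    then show ?case
      using cd_pos Cd_pos rho_gt_1 by (simp add: ln_mult ln_realpow)
  qed
  \<comment> \<open>The radius is at most \<open>Cd * \<rho> ^ M n\<close> for large
    \<open>n\<close>, so its divergence forces the scale to diverge.\<close>
  have M_inf: "filterlim M at_top sequentially"
  proof -
    have "filterlim (\<lambda>n. ln (r n)) at_top sequentially"
      using ln_at_top r_inf by (rule filterlim_compose)
    then have "filterlim (\<lambda>n. real (M n)) at_top sequentially"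
      unfolding filterlim_at_top
    proof (intro allI)
      fix Z :: real
      assume "\<forall>Z. \<forall>\<^sub>F n in sequentially. Z \<le> ln (r n)"
      then have "\<forall>\<^sub>F n in sequentially. ln Cd + Z * ln \<rho> \<le> ln (r n)" by blast
      then show "\<forall>\<^sub>F n in sequentially. Z \<le> real (M n)"
        using r_ln
      proof eventually_elim
        case (elim n)
        then have "Z * ln \<rho> \<le> real (M n) * ln \<rho>" by linarith
        then show ?case using l by simp
      qed
    qed
    then show ?thesis
      using filterlim_sequentially_iff_filterlim_real by blast
  qed
  obtain c1 c2 where c: "\<And>v r n m. \<lbrakk>v \<in> verts (X \<iota> b); m + k0 + b \<le> n; k0 \<le> m;
      cd * \<rho> ^ m \<le> r; r \<le> Cd * \<rho> ^ m\<rbrakk> \<Longrightarrow>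
    c1 + growth (m - k0) \<le> ln (enn2real (expected_exit_time (X \<iota> n) v (gball (X \<iota> n) v r))) \<and>
    ln (enn2real (expected_exit_time (X \<iota> n) v (gball (X \<iota> n) v r))) \<le> c2 + growth (m + k0)"
    using exit_time_bounds[of b] by blast
  have "\<forall>\<^sub>F n in sequentially.
    c1 + growth (M n - k0) \<le> ln (enn2real (expected_exit_time (X \<iota> n) v (gball (X \<iota> n) v (r n)))) \<and>
    ln (enn2real (expected_exit_time (X \<iota> n) v (gball (X \<iota> n) v (r n)))) \<le> c2 + growth (M n + k0)"
    using M by eventually_elim (rule c[OF vb], auto)
  from log_ratio_limit[OF growth_limit l M_inf this r_ln] show ?thesis .
qed

end

theorem theorem2p26:
  fixes S :: "('a, 'b) eigs" and cd Cd :: real and c0 :: int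
  assumes "eigs S" and "canonical S" and "distance_positive S" and "degree_primitive S"
    and "scale_constants S cd Cd c0"
  shows "\<exists>dim_W :: real.
     (\<forall>v \<in> limit_verts S. \<forall>r. admissible S cd Cd c0 v r \<longrightarrow>
        (\<lambda>n. ln (enn2real (expected_exit_time (Xi S n) v (gball (Xi S n) v (r n)))) / ln (r n))
          \<longlonglongrightarrow> dim_W) \<and>
     dim_W = box_dim S + resistance_dim S"
proof -
  interpret scaled_eigs S cd Cd c0
    using assms by unfold_locales
  have "box_dim S + resistance_dim S =
      (ln (nat_spectral_radius (mass_matrix S)) - lim (\<lambda>n. ln (cond \<iota> n) / real n)) / ln \<rho>"
    by (simp add: box_dim_def resistance_dim_eq diff_divide_distrib)
  then show ?thesis
    using walk_dim_limit by auto
qed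

end
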